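(* Let $\Omega\neq\emptyset$ be a compact metric space, let $T:\Omega\to\Omega$ be a minimal homeomorphism, let $l\in\mathbb{N}$, and let $D,V:\Omega\to M(l,\mathbb{R})$ be continuous maps such that $D(\omega)$ and $V(\omega)$ are symmetric and $D(\omega)$ is invertible for each $\omega\in\Omega$. For $\omega\in\Omega$ let $H_\omega$ be the bounded (self-adjoint) operator on $\ell^2(\mathbb{Z};\mathbb{C}^l)$ given by $$[H_\omega \mathbf{u}]_n = D(T^{n-1}\omega)\mathbf{u}_{n-1}+D(T^n\omega)\mathbf{u}_{n+1}+V(T^n\omega)\mathbf{u}_n,\qquad n\in\mathbb{Z},$$ and for $z\in\mathbb{C}$ let $(T,A(z,\cdot))$ be the associated Jacobi cocycle, with $$A(z,\omega)=\begin{bmatrix} D(T\omega)^{-1}(z-V(T\omega)) & -D(T\omega)^{-1}\\ D(T\omega) & 0\end{bmatrix}\in SL(2l,\mathbb{C}).$$ Then, for each $\omega\in\Omega$, $$\rho(H_\omega)=\{z\in\mathbb{C}\mid (T,A(z,\cdot))\in\mathcal{UG}\}=\{z\in\mathbb{C}\mid (T,A(z,\cdot))\in\mathcal{UH}\}.$$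
   Context: $M(l,\mathbb{R})$ is the space of $l\times l$ real matrices; $\rho(H_\omega)$ is the resolvent set of $H_\omega$ as an operator on $\ell^2(\mathbb{Z};\mathbb{C}^l)$. A homeomorphism $T$ of $\Omega$ is minimal if every orbit $\{T^j\omega\mid j\in\mathbb{Z}\}$ is dense in $\Omega$. $\mathbb{N}=\{1,2,\dots\}$. An $SL(2l,\mathbb{C})$-cocycle over a compact metric space $\Omega$ is a pair $(T,A)$, where $T:\Omega\to\Omega$ is a homeomorphism and $A:\Omega\to SL(2l,\mathbb{C})$ is continuous, acting on $\Omega\times\mathbb{C}^{2l}$ by $(\omega,\mathbf{u})\mapsto(T\omega,A(\omega)\mathbf{u})$. Its iterates are given by $A_n(\omega)=A(T^{n-1}\omega)\cdots A(T\omega)A(\omega)$ for $n\ge1$, $A_0(\omega)=\mathbb{I}_{2l}$, and $A_n(\omega)=A(T^{n}\omega)^{-1}\cdots A(T^{-2}\omega)^{-1}A(T^{-1}\omega)^{-1}$ for $n\le-1$. Uniform exponential growth: $(T,A)\in\mathcal{UG}$ if there exist constants $\beta>0$ and $\lambda>1$ such that for each $\omega\in\Omega$ and each $\mathbf{v}\in\mathbb{C}^{2l}\setminus\{\mathbf{0}\}$, either $\|A_n(\omega)\mathbf{v}\|\ge\beta\lambda^n\|\mathbf{v}\|$ for all $n\in\mathbb{N}$, or $\|A_{-n}(\omega)\mathbf{v}\|\ge\beta\lambda^n\|\mathbf{v}\|$ for all $n\in\mathbb{N}$. Uniform hyperbolicity: $(T,A)\in\mathcal{UH}$ if there exists a continuous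 Whitney splitting $\mathbb{C}^{2l}\times\Omega=E^s\oplus E^u$ (i.e. continuous subbundles with fibres satisfying $\mathbb{C}^{2l}=E^s(\omega)\oplus E^u(\omega)$ for each $\omega\in\Omega$) such that: (1) $E^s$ and $E^u$ are $(T,A)$-invariant, i.e. for each $\omega\in\Omega$, $j\in\mathbb{Z}$, $\mathbf{v}\in E^u(T^j\omega)$ and $\mathbf{w}\in E^s(T^j\omega)$, one has $A(T^j\omega)\mathbf{v}\in E^u(T^{j+1}\omega)$ and $A(T^j\omega)\mathbf{w}\in E^s(T^{j+1}\omega)$; (2) there exist $C>0$ and $\lambda>1$ such that for each $\omega\in\Omega$, $\mathbf{v}\in E^u(\omega)$, $\mathbf{w}\in E^s(\omega)$ and $n\in\mathbb{N}$, $\|A_{-n}(\omega)\mathbf{v}\|\le C\lambda^{-n}\|\mathbf{v}\|$ and $\|A_n(\omega)\mathbf{w}\|\le C\lambda^{-n}\|\mathbf{w}\|$. *)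

theory Defs
  imports "HOL-Analysis.Analysis"
begin

text \<open>The space is a compact subset \<open>\<Omega>\<close> of a metric type; maps are only meaningful on \<open>\<Omega>\<close>.
  Integer iterates \<open>T\<^sup>j\<close>, \<open>j < 0\<close>, use the inverse of \<open>T\<close> restricted to \<open>\<Omega>\<close>.\<close>

definition int_iterate :: "'a set \<Rightarrow> ('a \<Rightarrow> 'a) \<Rightarrow> int \<Rightarrow> 'a \<Rightarrow> 'a" where
  "int_iterate \<Omega> T j \<omega> =
     (if 0 \<le> j then (T ^^ nat j) \<omega> else (inv_into \<Omega> T ^^ nat (- j)) \<omega>)"

definition self_homeomorphism :: "'a::topological_space set \<Rightarrow> ('a \<Rightarrow> 'a) \<Rightarrow> bool" where
  "self_homeomorphism \<Omega> T \<longleftrightarrow> (\<exists>S. homeomorphism \<Omega> \<Omega> T S)"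

definition minimal_homeomorphism :: "'a::topological_space set \<Rightarrow> ('a \<Rightarrow> 'a) \<Rightarrow> bool" where
  "minimal_homeomorphism \<Omega> T \<longleftrightarrow>
     self_homeomorphism \<Omega> T \<and>
     (\<forall>\<omega>\<in>\<Omega>. \<Omega> \<subseteq> closure (range (\<lambda>j. int_iterate \<Omega> T j \<omega>)))"

subsection \<open>Cocycles, uniform growth, uniform hyperbolicity\<close>

definition SL_cocycle ::
  "'a::metric_space set \<Rightarrow> ('a \<Rightarrow> 'a) \<Rightarrow> ('a \<Rightarrow> complex^'n^'n) \<Rightarrow> bool" where
  "SL_cocycle \<Omega> T A \<longleftrightarrow>
     self_homeomorphism \<Omega> T \<and> continuous_on \<Omega> A \<and> (\<forall>\<omega>\<in>\<Omega>. det (A \<omega>) = 1)"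

primrec cocycle_fwd ::
  "'a set \<Rightarrow> ('a \<Rightarrow> 'a) \<Rightarrow> ('a \<Rightarrow> complex^'n^'n) \<Rightarrow> nat \<Rightarrow> 'a \<Rightarrow> complex^'n^'n" where
  "cocycle_fwd \<Omega> T A 0 \<omega> = mat 1"
| "cocycle_fwd \<Omega> T A (Suc n) \<omega> = A (int_iterate \<Omega> T (int n) \<omega>) ** cocycle_fwd \<Omega> T A n \<omega>"

primrec cocycle_bwd ::
  "'a set \<Rightarrow> ('a \<Rightarrow> 'a) \<Rightarrow> ('a \<Rightarrow> complex^'n^'n) \<Rightarrow> nat \<Rightarrow> 'a \<Rightarrow> complex^'n^'n" where
  "cocycle_bwd \<Omega> T A 0 \<omega> = mat 1"
| "cocycle_bwd \<Omega> T A (Suc n) \<omega> =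
     matrix_inv (A (int_iterate \<Omega> T (- int (Suc n)) \<omega>)) ** cocycle_bwd \<Omega> T A n \<omega>"

definition cocycle_iterate ::
  "'a set \<Rightarrow> ('a \<Rightarrow> 'a) \<Rightarrow> ('a \<Rightarrow> complex^'n^'n) \<Rightarrow> int \<Rightarrow> 'a \<Rightarrow> complex^'n^'n" where
  "cocycle_iterate \<Omega> T A n \<omega> =
     (if 0 \<le> n then cocycle_fwd \<Omega> T A (nat n) \<omega> else cocycle_bwd \<Omega> T A (nat (- n)) \<omega>)"

definition UG ::
  "'a::metric_space set \<Rightarrow> (('a \<Rightarrow> 'a) \<times> ('a \<Rightarrow> complex^'n^'n)) set" where
  "UG \<Omega> = {(T, A). SL_cocycle \<Omega> T A \<and>
     (\<exists>\<beta> > 0. \<exists>r::real > 1. \<forall>\<omega>\<in>\<Omega>. \<forall>v. v \<noteq> 0 \<longrightarrow>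
        (\<forall>n\<ge>1. norm (cocycle_iterate \<Omega> T A (int n) \<omega> *v v) \<ge> \<beta> * r ^ n * norm v) \<or>
        (\<forall>n\<ge>1. norm (cocycle_iterate \<Omega> T A (- int n) \<omega> *v v) \<ge> \<beta> * r ^ n * norm v))}"

text \<open>A continuous subbundle of the trivial bundle \<open>\<complex>\<^sup>n \<times> \<Omega>\<close>: locally on \<open>\<Omega>\<close>, the fibres have a
  basis of continuous sections. Here \<^term>\<open>vec.span\<close> and \<^term>\<open>vec.independent\<close> are over the
  complex scalars.\<close>

definition continuous_subbundle ::
  "'a::topological_space set \<Rightarrow> ('a \<Rightarrow> (complex^'n) set) \<Rightarrow> bool" where
  "continuous_subbundle \<Omega> E \<longleftrightarrow>
     (\<forall>\<omega>0\<in>\<Omega>. \<exists>U (k::nat) (e :: nat \<Rightarrow> 'a \<Rightarrow> complex^'n).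
        open U \<and> \<omega>0 \<in> U \<and>
        (\<forall>i<k. continuous_on (U \<inter> \<Omega>) (e i)) \<and>
        (\<forall>\<omega>\<in>U \<inter> \<Omega>.
           inj_on (\<lambda>i. e i \<omega>) {..<k} \<and>
           vec.independent ((\<lambda>i. e i \<omega>) ` {..<k}) \<and>
           vec.span ((\<lambda>i. e i \<omega>) ` {..<k}) = E \<omega>))"

definition Whitney_splitting ::
  "'a::topological_space set \<Rightarrow> ('a \<Rightarrow> (complex^'n) set) \<Rightarrow> ('a \<Rightarrow> (complex^'n) set) \<Rightarrow> bool" where
  "Whitney_splitting \<Omega> Es Eu \<longleftrightarrow>
     continuous_subbundle \<Omega> Es \<and> continuous_subbundle \<Omega> Eu \<and>
     (\<forall>\<omega>\<in>\<Omega>. Es \<omega> \<inter> Eu \<omega> = {0} \<and> {x + y | x y. x \<in> Es \<omega> \<and> y \<in> Eu \<omega>} = UNIV)"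

definition UH ::
  "'a::metric_space set \<Rightarrow> (('a \<Rightarrow> 'a) \<times> ('a \<Rightarrow> complex^'n^'n)) set" where
  "UH \<Omega> = {(T, A). SL_cocycle \<Omega> T A \<and>
     (\<exists>Es Eu. Whitney_splitting \<Omega> Es Eu \<and>
        (\<forall>\<omega>\<in>\<Omega>. \<forall>j.
           (\<forall>v\<in>Eu (int_iterate \<Omega> T j \<omega>).
              A (int_iterate \<Omega> T j \<omega>) *v v \<in> Eu (int_iterate \<Omega> T (j + 1) \<omega>)) \<and>
           (\<forall>w\<in>Es (int_iterate \<Omega> T j \<omega>).
              A (int_iterate \<Omega> T j \<omega>) *v w \<in> Es (int_iterate \<Omega> T (j + 1) \<omega>))) \<and>
        (\<exists>C > 0. \<exists>r::real > 1. \<forall>\<omega>\<in>\<Omega>. \<forall>v\<in>Eu \<omega>. \<forall>w\<in>Es \<omega>. \<forall>n\<ge>1.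
           norm (cocycle_iterate \<Omega> T A (- int n) \<omega> *v v) \<le> C * r powi (- int n) * norm v \<and>
           norm (cocycle_iterate \<Omega> T A (int n) \<omega> *v w) \<le> C * r powi (- int n) * norm w))}"

subsection \<open>The Hilbert space \<open>\<ell>\<^sup>2(\<int>; \<complex>\<^sup>l)\<close> and resolvent sets\<close>

definition ell2 :: "(int \<Rightarrow> complex^'l) set" where
  "ell2 = {u. (\<lambda>n. (norm (u n))\<^sup>2) summable_on UNIV}"

definition ell2_norm :: "(int \<Rightarrow> complex^'l) \<Rightarrow> real" where
  "ell2_norm u = sqrt (\<Sum>\<^sub>\<infinity>n. (norm (u n))\<^sup>2)"

definition ell2_bounded_operator ::
  "((int \<Rightarrow> complex^'l) \<Rightarrow> (int \<Rightarrow> complex^'l)) \<Rightarrow> bool" where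
  "ell2_bounded_operator R \<longleftrightarrow>
     (\<forall>u\<in>ell2. R u \<in> ell2) \<and>
     (\<forall>u\<in>ell2. \<forall>v\<in>ell2. R (\<lambda>n. u n + v n) = (\<lambda>n. R u n + R v n)) \<and>
     (\<forall>c. \<forall>u\<in>ell2. R (\<lambda>n. c *s u n) = (\<lambda>n. c *s R u n)) \<and>
     (\<exists>C. \<forall>u\<in>ell2. ell2_norm (R u) \<le> C * ell2_norm u)"

definition resolvent_set ::
  "((int \<Rightarrow> complex^'l) \<Rightarrow> (int \<Rightarrow> complex^'l)) \<Rightarrow> complex set" where
  "resolvent_set H = {z.
     bij_betw (\<lambda>u n. H u n - z *s u n) ell2 ell2 \<and>
     ell2_bounded_operator (inv_into ell2 (\<lambda>u n. H u n - z *s u n))}"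

subsection \<open>Jacobi operators and cocycles\<close>

abbreviation cmatrix :: "real^'m^'n \<Rightarrow> complex^'m^'n" where
  "cmatrix \<equiv> map_matrix complex_of_real"

definition jacobi_operator ::
  "'a set \<Rightarrow> ('a \<Rightarrow> 'a) \<Rightarrow> ('a \<Rightarrow> real^'l^'l) \<Rightarrow> ('a \<Rightarrow> real^'l^'l) \<Rightarrow> 'a
     \<Rightarrow> (int \<Rightarrow> complex^'l) \<Rightarrow> (int \<Rightarrow> complex^'l)" where
  "jacobi_operator \<Omega> T D V \<omega> u = (\<lambda>n.
     cmatrix (D (int_iterate \<Omega> T (n - 1) \<omega>)) *v u (n - 1)
     + cmatrix (D (int_iterate \<Omega> T n \<omega>)) *v u (n + 1)
     + cmatrix (V (int_iterate \<Omega> T n \<omega>)) *v u n)"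

definition block_matrix ::
  "'b^'l^'l \<Rightarrow> 'b^'l^'l \<Rightarrow> 'b^'l^'l \<Rightarrow> 'b^'l^'l \<Rightarrow> 'b^('l + 'l)^('l + 'l)" where
  "block_matrix P Q R S = (\<chi> i j. case (i, j) of
       (Inl p, Inl q) \<Rightarrow> P $ p $ q
     | (Inl p, Inr q) \<Rightarrow> Q $ p $ q
     | (Inr p, Inl q) \<Rightarrow> R $ p $ q
     | (Inr p, Inr q) \<Rightarrow> S $ p $ q)"

definition jacobi_cocycle ::
  "('a \<Rightarrow> 'a) \<Rightarrow> ('a \<Rightarrow> real^'l^'l) \<Rightarrow> ('a \<Rightarrow> real^'l^'l) \<Rightarrow> complex \<Rightarrow> 'a
     \<Rightarrow> complex^('l + 'l)^('l + 'l)" where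
  "jacobi_cocycle T D V z \<omega> = block_matrix
     (cmatrix (matrix_inv (D (T \<omega>))) ** (mat z - cmatrix (V (T \<omega>))))
     (- cmatrix (matrix_inv (D (T \<omega>))))
     (cmatrix (D (T \<omega>)))
     0"

end

theory Submission
  imports Defs
begin

text \<open>
  Fix \<open>z\<close>. A sequence \<open>u\<close> satisfies \<open>(H\<^sub>\<omega> - z) u = h\<close> exactly when its phase vectors
  \<open>w\<^sub>n = (u\<^sub>n, D(T\<^sup>n\<^sup>-\<^sup>1\<omega>) u\<^sub>n\<^sub>-\<^sub>1)\<close> satisfy the forced recursion
  \<open>w\<^sub>n\<^sub>+\<^sub>1 = A(z, T\<^sup>n\<^sup>-\<^sup>1\<omega>) w\<^sub>n + (D(T\<^sup>n\<omega>)\<inverse> h\<^sub>n, 0)\<close> (\<open>phase_Suc\<close>). The operator and the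
  cocycle are compared through one quantitative property of a single operator:
  \<open>c \<parallel>u\<parallel>\<^sup>2 \<le> \<parallel>(H\<^sub>\<omega> - z) u\<parallel>\<^sup>2\<close> on \<open>\<ell>\<^sup>2\<close> (\<open>bounded_below\<close>).

  \<^item> Being bounded below is equivalent to \<open>z \<in> \<rho>(H\<^sub>\<omega>)\<close> (\<open>resolvent_iff_bounded_below\<close>). Since \<open>D\<close> and
  \<open>V\<close> are real, complex conjugation turns a lower bound at \<open>z\<close> into one at the conjugate of \<open>z\<close>;
  since they are symmetric, \<open>H\<^sub>\<omega> - z\<close> is the adjoint of \<open>H\<^sub>\<omega>\<close> minus the conjugate. Their product
  is then a positive operator bounded from above and from below, which a Neumann series inverts.

  \<^item> Uniform growth implies a lower bound at every \<open>\<omega>\<close> (\<open>UG_imp_bounded_below\<close>): for a large \<open>N\<close> every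
  vector is expanded fourfold by \<open>A\<^sub>N\<close> or by \<open>A\<^sub>-\<^sub>N\<close>, so \<open>4 \<bar>w\<^sub>n\<bar>\<close> is at most
  \<open>\<bar>w\<^sub>n\<^sub>+\<^sub>N\<bar> + \<bar>w\<^sub>n\<^sub>-\<^sub>N\<bar>\<close> plus finitely many forcing terms; squaring and summing absorbs the
  shifted terms on the left.

  \<^item> A lower bound at one \<open>\<omega>\<close> implies uniform growth (\<open>bounded_below_imp_UG\<close>). Shifting the sequence moves
  the bound along the orbit, and minimality and continuity carry it, for finitely supported sequences,
  to all of \<open>\<Omega>\<close> with the same constant. Applied to a solution of \<open>H u = z u\<close> cut off outside
  a window, it says that the energy of the solution in any window is controlled by the energy at the
  two ends (\<open>solution_window_sum\<close>). A sequence with this property grows exponentially to the right or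
  to the left, at a uniform rate (\<open>window_sums_dichotomy\<close>).

  \<^item> Uniform hyperbolicity implies uniform growth because the stable and unstable parts of a vector are
  controlled by the vector itself, uniformly in \<open>\<omega>\<close> (\<open>transversality\<close>), and one of them carries at
  least half of its length.

  \<^item> Conversely, under uniform growth an orbit that is bounded in one time direction must grow in the
  other, hence it contracts in the first. So the vectors with forward bounded and with backward bounded
  orbits are the candidates for \<open>E\<^sup>s\<close> and \<open>E\<^sup>u\<close>. That they span is again a statement about the
  operator: the \<open>\<ell>\<^sup>2\<close> solution of \<open>(H\<^sub>\<omega> - z) u = \<delta>\<^sub>0 y\<close> arrives at the site \<open>0\<close> along an
  unstable orbit and leaves it along a stable one, and its jump there is a prescribed vector
  (\<open>bounded_below_splitting\<close>). Continuity of the two bundles follows from compactness of the graph of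
  the projection (\<open>dichotomy_imp_UH\<close>).
\<close>

section \<open>Complex matrices, block matrices and pairs of vectors\<close>

lemma matrix_inv_right: "invertible A \<Longrightarrow> A ** matrix_inv A = mat 1"
  and matrix_inv_left: "invertible A \<Longrightarrow> matrix_inv A ** A = mat 1"
  for A :: "'a::semiring_1^'n^'n"
  unfolding invertible_def matrix_inv_def
  by (metis (mono_tags, lifting) someI_ex)+

lemma continuous_on_det:
  fixes A :: "'b::topological_space \<Rightarrow> 'a::real_normed_field^'n^'n"
  assumes "continuous_on S A"
  shows "continuous_on S (\<lambda>x. det (A x))"
  unfolding det_def using assms by (intro continuous_intros)

text \<open>By Cramer's rule the entries of the inverse are quotients of determinants.\<close>

lemma continuous_on_matrix_inv:
  fixes A :: "'b::topological_space \<Rightarrow> 'a::real_normed_field^'n^'n"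
  assumes cont: "continuous_on S A" and inv: "\<And>x. x \<in> S \<Longrightarrow> invertible (A x)"
  shows "continuous_on S (\<lambda>x. matrix_inv (A x))"
proof -
  let ?C = "\<lambda>x i j. \<chi> p q. if q = i then axis j 1 $ p else A x $ p $ q"
  have entry: "matrix_inv (A x) $ i $ j = det (?C x i j) / det (A x)" if "x \<in> S" for x i j
  proof -
    have det: "det (A x) \<noteq> 0"
      using inv[OF that] by (simp add: invertible_det_nz)
    have "A x *v (matrix_inv (A x) *v axis j 1) = axis j 1"
      using matrix_inv_right[OF inv[OF that]] by (simp add: matrix_vector_mul_assoc)
    then have "matrix_inv (A x) *v axis j 1 = (\<chi> k. det (?C x k j) / det (A x))"
      using cramer[OF det, of "matrix_inv (A x) *v axis j 1" "axis j 1"] by simp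
    moreover have "(matrix_inv (A x) *v axis j 1) $ i = matrix_inv (A x) $ i $ j"
      by (simp add: matrix_vector_mult_def axis_def if_distrib cong: if_cong)
    ultimately show ?thesis by simp
  qed
  have "continuous_on S (\<lambda>x. matrix_inv (A x) $ i $ j)" for i j
  proof -
    have "continuous_on S (\<lambda>x. ?C x i j)"
    proof (intro continuous_on_vec_lambda)
      show "continuous_on S (\<lambda>x. if q = i then axis j 1 $ p else A x $ p $ q)" for p q
        by (cases "q = i") (auto intro!: continuous_intros cont)
    qed
    then have "continuous_on S (\<lambda>x. det (?C x i j) / det (A x))"
      using inv by (intro continuous_on_divide continuous_on_det cont) (auto simp: invertible_det_nz)
    then show ?thesis by (rule continuous_on_eq) (simp add: entry)
  qed
  then have "continuous_on S (\<lambda>x. \<chi> i j. matrix_inv (A x) $ i $ j)"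
    by (intro continuous_on_vec_lambda)
  then show ?thesis by simp
qed

lemma continuous_on_matrix_mult:
  fixes A B :: "'b::topological_space \<Rightarrow> 'a::real_normed_field^'n^'n"
  assumes "continuous_on S A" "continuous_on S B"
  shows "continuous_on S (\<lambda>x. A x ** B x)"
  unfolding matrix_matrix_mult_def using assms by (intro continuous_intros continuous_on_vec_lambda)

lemma continuous_on_matrix_vector_mult:
  fixes A :: "'b::topological_space \<Rightarrow> 'a::real_normed_field^'n^'m"
  assumes "continuous_on S A" "continuous_on S v"
  shows "continuous_on S (\<lambda>x. A x *v v x)"
  unfolding matrix_vector_mult_def using assms by (intro continuous_intros continuous_on_vec_lambda)

lemma continuous_on_block_matrix:
  fixes P Q R S :: "'b::topological_space \<Rightarrow> 'a::topological_space^'l^'l"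
  assumes "continuous_on X P" "continuous_on X Q" "continuous_on X R" "continuous_on X S"
  shows "continuous_on X (\<lambda>x. block_matrix (P x) (Q x) (R x) (S x))"
proof -
  have "continuous_on X (\<lambda>x. case (i, j) of
       (Inl p, Inl q) \<Rightarrow> P x $ p $ q
     | (Inl p, Inr q) \<Rightarrow> Q x $ p $ q
     | (Inr p, Inl q) \<Rightarrow> R x $ p $ q
     | (Inr p, Inr q) \<Rightarrow> S x $ p $ q)" for i j :: "'l + 'l"
    using assms by (cases i; cases j) (auto intro!: continuous_intros)
  then show ?thesis
    unfolding block_matrix_def by (intro continuous_on_vec_lambda)
qed

lemma norm_matrix_vector_mult_le:
  fixes A :: "complex^'n^'m"
  shows "norm (A *v x) \<le> norm A * norm x"
proof -
  have row: "norm ((A *v x) $ i) \<le> norm (A $ i) * norm x" for i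
  proof -
    have "norm ((A *v x) $ i) \<le> (\<Sum>j\<in>UNIV. \<bar>norm (A $ i $ j)\<bar> * \<bar>norm (x $ j)\<bar>)"
      unfolding matrix_vector_mult_def by (auto intro!: sum_norm_le simp: norm_mult)
    also have "\<dots> \<le> L2_set (\<lambda>j. norm (A $ i $ j)) UNIV * L2_set (\<lambda>j. norm (x $ j)) UNIV"
      by (rule L2_set_mult_ineq)
    finally show ?thesis by (simp add: norm_vec_def)
  qed
  have "norm (A *v x) \<le> L2_set (\<lambda>i. norm (A $ i) * norm x) UNIV"
    unfolding norm_vec_def[of "A *v x"] by (rule L2_set_mono) (use row in auto)
  also have "\<dots> = norm A * norm x"
    by (simp add: norm_vec_def[of A] L2_set_left_distrib)
  finally show ?thesis .
qed

lemma uniform_matrix_bound: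
  fixes A :: "'a::topological_space \<Rightarrow> complex^'n^'m"
  assumes "compact S" "continuous_on S A"
  obtains M where "M \<ge> 1" "\<And>\<omega> x. \<omega> \<in> S \<Longrightarrow> norm (A \<omega> *v x) \<le> M * norm x"
proof -
  have "bounded (A ` S)"
    using assms compact_continuous_image compact_imp_bounded by blast
  then obtain K where K: "\<And>\<omega>. \<omega> \<in> S \<Longrightarrow> norm (A \<omega>) \<le> K"
    unfolding bounded_iff by auto
  show thesis
  proof (rule that[of "max 1 K"])
    show "norm (A \<omega> *v x) \<le> max 1 K * norm x" if "\<omega> \<in> S" for \<omega> x
      using norm_matrix_vector_mult_le[of "A \<omega>" x] K[OF that]
      by (meson max.coboundedI2 mult_right_mono norm_ge_zero order_trans)
  qed simp
qed

lemma continuous_on_cmatrix: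
  assumes "continuous_on S A"
  shows "continuous_on S (\<lambda>x. cmatrix (A x))"
  unfolding map_matrix_def using assms by (intro continuous_intros continuous_on_vec_lambda)

lemma cmatrix_mult: "cmatrix (A ** B) = cmatrix A ** cmatrix B"
  by (simp add: vec_eq_iff matrix_matrix_mult_def)

lemma cmatrix_mat [simp]: "cmatrix (mat 1) = mat 1"
  by (simp add: vec_eq_iff mat_def)

lemma sum_UNIV_Plus: "(\<Sum>x\<in>UNIV. f x) = (\<Sum>x\<in>UNIV. f (Inl x)) + (\<Sum>x\<in>UNIV. f (Inr x))"
  for f :: "'p::finite + 'q::finite \<Rightarrow> 'b::comm_monoid_add"
  using sum.Plus[of UNIV UNIV f] by simp

lemma block_matrix_mult:
  "block_matrix P Q R S ** block_matrix P' Q' R' S' =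
   block_matrix (P ** P' + Q ** R') (P ** Q' + Q ** S') (R ** P' + S ** R') (R ** Q' + S ** S')"
  for P :: "'a::semiring_1^'l^'l"
  unfolding block_matrix_def matrix_matrix_mult_def
  by (auto simp: vec_eq_iff sum_UNIV_Plus split: sum.splits)

lemma block_matrix_one: "block_matrix (mat 1) 0 0 (mat 1) = (mat 1 :: 'a::semiring_1^('l::finite+'l)^('l+'l))"
  unfolding block_matrix_def mat_def by (auto simp: vec_eq_iff split: sum.splits)

lemma matrix_mult_zero [simp]: "(0::'a::semiring_1^'n^'m) ** (A::'a^'p^'n) = 0" "(B::'a^'n^'m) ** (0::'a^'p^'n) = 0"
  by (simp_all add: vec_eq_iff matrix_matrix_mult_def)

lemma matrix_add_rdistrib: "(A + B) ** C = A ** C + B ** C"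
  for A :: "'a::semiring_1^'n^'m"
  by (simp add: vec_eq_iff matrix_matrix_mult_def distrib_right sum.distrib)

lemma mat_two_mult: "mat 2 ** X = X + X" "X ** mat 2 = X + X"
  for X :: "complex^'n^'n"
proof -
  have two: "mat 2 = (mat 1 + mat 1 :: complex^'n^'n)"
    by (simp add: vec_eq_iff mat_def)
  show "mat 2 ** X = X + X" "X ** mat 2 = X + X"
    unfolding two by (simp_all only: matrix_add_rdistrib matrix_add_ldistrib matrix_mul_lid matrix_mul_rid)
qed

text \<open>The map sending \<open>X\<close> to the determinant of the unipotent matrix with off-diagonal block \<open>X\<close> turns sums
  into products. Conjugation with the block-diagonal matrix \<open>diag(2, 1)\<close> doubles \<open>X\<close>, so this
  determinant equals its own square.\<close>

lemma det_block_unipotent: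
  fixes X :: "complex^'l^'l"
  shows det_block_upper_unipotent: "det (block_matrix (mat 1) X 0 (mat 1)) = 1"
    and det_block_lower_unipotent: "det (block_matrix (mat 1) 0 X (mat 1)) = 1"
proof -
  let ?D = "block_matrix (mat 2) 0 0 (mat 1) :: complex^('l+'l)^('l+'l)"
  let ?E = "block_matrix (mat (1/2)) 0 0 (mat 1) :: complex^('l+'l)^('l+'l)"
  let ?U = "block_matrix (mat 1) X 0 (mat 1)"
  let ?L = "block_matrix (mat 1) 0 X (mat 1)"
  \<comment> \<open>Here \<open>*\<close> is the entrywise product, so the left-hand side is \<open>mat (1/2) + mat (1/2)\<close>.\<close>
  have half: "2 * mat (1/2) = (mat 1 :: complex^'l^'l)"
    by (simp add: vec_eq_iff mat_def)
  have "?D ** ?E = mat 1"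
    by (simp add: block_matrix_mult half mat_two_mult block_matrix_one)
  then have DE: "det ?D * det ?E = 1"
    by (metis det_I det_mul)
  have square: "a = 1" if "a * (a::complex) = a" "a \<noteq> 0" for a
    using that by simp
  have UU: "?U ** ?U = ?D ** ?U ** ?E"
    by (simp add: block_matrix_mult half mat_two_mult add.commute)
  have "det ?U * det ?U = det ?U * (det ?D * det ?E)"
    using arg_cong[OF UU, of det] by (simp add: det_mul mult_ac)
  moreover have "?U ** block_matrix (mat 1) (- X) 0 (mat 1) = mat 1"
    by (simp add: block_matrix_mult block_matrix_one)
  then have "det ?U \<noteq> 0"
    by (metis invertible_det_nz invertible_right_inverse)
  ultimately show "det ?U = 1"
    using DE square by simp
  have LL: "?D ** (?L ** ?L) = ?L ** ?D"
    by (simp add: block_matrix_mult mat_two_mult(1)[of X] mat_two_mult(2)[of X])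
  have "det ?D * (det ?L * det ?L) = det ?L * det ?D"
    using arg_cong[OF LL, of det] by (simp add: det_mul)
  moreover have "det ?D \<noteq> 0"
    using DE by auto
  moreover have "?L ** block_matrix (mat 1) 0 (- X) (mat 1) = mat 1"
    by (simp add: block_matrix_mult block_matrix_one)
  then have "det ?L \<noteq> 0"
    by (metis invertible_det_nz invertible_right_inverse)
  ultimately show "det ?L = 1"
    using square by simp
qed

lemma matrix_mult_neg: "A ** (- B) = - (A ** B)" "(- A) ** B = - (A ** B)"
  for A B :: "complex^'n^'n"
  by (simp_all add: vec_eq_iff matrix_matrix_mult_def sum_negf)

text \<open>As in Whitehead's lemma, the matrix is a product of unipotent block matrices.\<close>

lemma det_block_zero_corner:
  fixes P Q R :: "complex^'l^'l"
  assumes "Q ** R = mat 1" "R ** Q = mat 1"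
  shows "det (block_matrix P (- Q) R 0) = 1"
proof -
  let ?U = "\<lambda>X. block_matrix (mat 1) X 0 (mat 1) :: complex^('l+'l)^('l+'l)"
  let ?L = "\<lambda>X. block_matrix (mat 1) 0 X (mat 1) :: complex^('l+'l)^('l+'l)"
  have "block_matrix P (- Q) R 0 = ?U (P ** Q) ** (?U (- Q) ** ?L R ** ?U (- Q))"
    using assms
    by (simp add: block_matrix_mult matrix_mult_neg flip: matrix_mul_assoc)
  then show ?thesis
    by (simp add: det_mul det_block_upper_unipotent det_block_lower_unipotent)
qed

lemma matrix_vector_mult_uminus: "(- A) *v x = - (A *v x)" for A :: "complex^'n^'m"
  by (simp add: vec_eq_iff matrix_vector_mult_def sum_negf)

lemma mat_mult_vec: "mat z *v x = z *s x" for x :: "complex^'l"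
proof -
  have "(\<Sum>j\<in>UNIV. (if i = j then z else 0) * x $ j) = z * x $ i" for i
  proof -
    have "(\<Sum>j\<in>UNIV. (if i = j then z else 0) * x $ j) = (\<Sum>j\<in>UNIV. if i = j then z * x $ j else 0)"
      by (intro sum.cong) auto
    then show ?thesis by simp
  qed
  then show ?thesis
    by (simp add: vec_eq_iff matrix_vector_mult_def mat_def)
qed

definition vec_pair :: "complex^'l \<Rightarrow> complex^'l \<Rightarrow> complex^('l + 'l)" where
  "vec_pair x y = (\<chi> i. case i of Inl p \<Rightarrow> x $ p | Inr q \<Rightarrow> y $ q)"

lemma vec_pair_cases: obtains x y where "v = vec_pair x y"
proof (rule that)
  show "v = vec_pair (\<chi> p. v $ Inl p) (\<chi> q. v $ Inr q)"
    by (simp add: vec_pair_def vec_eq_iff split: sum.splits)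
qed

lemma vec_pair_add: "vec_pair x y + vec_pair x' y' = vec_pair (x + x') (y + y')"
  by (simp add: vec_pair_def vec_eq_iff split: sum.splits)

lemma vec_pair_eq_iff [simp]: "vec_pair x y = vec_pair x' y' \<longleftrightarrow> x = x' \<and> y = y'"
  by (auto simp: vec_pair_def vec_eq_iff split: sum.splits)

lemma vec_pair_0 [simp]: "vec_pair 0 0 = 0"
  by (simp add: vec_pair_def vec_eq_iff split: sum.splits)

lemma norm_vec_pair: "(norm (vec_pair x y))\<^sup>2 = (norm x)\<^sup>2 + (norm y)\<^sup>2"
  by (simp add: norm_vec_def L2_set_def sum_UNIV_Plus vec_pair_def sum_nonneg)

lemma norm_vec_pair_ge: "norm x \<le> norm (vec_pair x y)" "norm y \<le> norm (vec_pair x y)"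
  by (rule power2_le_imp_le; simp add: norm_vec_pair)+

lemma block_matrix_vec_pair:
  "block_matrix P Q R S *v vec_pair x y = vec_pair (P *v x + Q *v y) (R *v x + S *v y)"
  by (auto simp: block_matrix_def vec_pair_def matrix_vector_mult_def sum_UNIV_Plus vec_eq_iff split: sum.splits)

section \<open>Orbits of a homeomorphism and of a cocycle\<close>

locale compact_homeomorphism =
  fixes \<Omega> :: "'a::metric_space set" and T :: "'a \<Rightarrow> 'a"
  assumes compact: "compact \<Omega>" and homeo: "self_homeomorphism \<Omega> T"
begin

abbreviation iter :: "int \<Rightarrow> 'a \<Rightarrow> 'a" where "iter \<equiv> int_iterate \<Omega> T"

lemma homeomorphism_inv: "homeomorphism \<Omega> \<Omega> T (inv_into \<Omega> T)"
proof -
  obtain S where S: "homeomorphism \<Omega> \<Omega> T S"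
    using homeo unfolding self_homeomorphism_def by blast
  have "inv_into \<Omega> T x = S x" if "x \<in> \<Omega>" for x
  proof -
    have "inj_on T \<Omega>" by (metis S homeomorphism_apply1 inj_on_inverseI)
    then show ?thesis
      using S that by (metis homeomorphism_def image_eqI inv_into_f_eq)
  qed
  then show ?thesis
    using homeomorphism_cong[OF S] by metis
qed

lemma T_in [intro]: "\<omega> \<in> \<Omega> \<Longrightarrow> T \<omega> \<in> \<Omega>"
  and inv_in: "\<omega> \<in> \<Omega> \<Longrightarrow> inv_into \<Omega> T \<omega> \<in> \<Omega>"
  and T_inv: "\<omega> \<in> \<Omega> \<Longrightarrow> T (inv_into \<Omega> T \<omega>) = \<omega>"
  using homeomorphism_inv unfolding homeomorphism_def by auto

lemma iter_in [intro, simp]: "\<omega> \<in> \<Omega> \<Longrightarrow> iter j \<omega> \<in> \<Omega>"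
proof -
  assume "\<omega> \<in> \<Omega>"
  then have "(T ^^ n) \<omega> \<in> \<Omega>" "(inv_into \<Omega> T ^^ n) \<omega> \<in> \<Omega>" for n
    by (induction n) (auto intro: inv_in)
  then show ?thesis by (simp add: int_iterate_def)
qed

lemma iter_0 [simp]: "iter 0 \<omega> = \<omega>"
  by (simp add: int_iterate_def)

lemma iter_1 [simp]: "iter 1 \<omega> = T \<omega>"
  by (simp add: int_iterate_def)

lemma iter_Suc:
  assumes "\<omega> \<in> \<Omega>" shows "iter (j + 1) \<omega> = T (iter j \<omega>)"
proof (cases "0 \<le> j")
  case True
  then have "nat (j + 1) = Suc (nat j)" by simp
  then show ?thesis using True by (simp add: int_iterate_def)
next
  case False
  define k where "k = nat (- (j + 1))"
  have k: "nat (- j) = Suc k" "nat (- (j + 1)) = k"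
    using False by (auto simp: k_def)
  have "iter (j + 1) \<omega> = (inv_into \<Omega> T ^^ k) \<omega>"
    using False k by (cases "j = -1") (auto simp: int_iterate_def)
  moreover have "(inv_into \<Omega> T ^^ k) \<omega> \<in> \<Omega>"
    using assms by (induction k) (auto intro: inv_in)
  ultimately show ?thesis
    using False k by (simp add: int_iterate_def T_inv)
qed

lemma T_inj: "\<omega> \<in> \<Omega> \<Longrightarrow> \<theta> \<in> \<Omega> \<Longrightarrow> T \<omega> = T \<theta> \<Longrightarrow> \<omega> = \<theta>"
  using homeomorphism_inv by (metis homeomorphism_apply1)

lemma iter_add:
  assumes "\<omega> \<in> \<Omega>" shows "iter (i + j) \<omega> = iter i (iter j \<omega>)"
proof (induction i rule: int_induct[where k = 0])
  case (step1 i)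
  then show ?case
    using iter_Suc[OF assms, of "i + j"] iter_Suc[of "iter j \<omega>" i] assms by (simp add: algebra_simps)
next
  case (step2 i)
  have "T (iter (i - 1 + j) \<omega>) = T (iter (i - 1) (iter j \<omega>))"
    using iter_Suc[OF assms, of "i - 1 + j"] iter_Suc[of "iter j \<omega>" "i - 1"] assms step2
    by (simp add: algebra_simps)
  then show ?case using T_inj assms by blast
qed simp

lemma continuous_on_iter: "continuous_on \<Omega> (iter j)"
proof -
  have cont: "continuous_on \<Omega> (f ^^ n)" if "continuous_on \<Omega> f" "f ` \<Omega> \<subseteq> \<Omega>" for f n
  proof (induction n)
    case (Suc n)
    have "(f ^^ n) ` \<Omega> \<subseteq> \<Omega>"
      using that(2) by (induction n) auto
    then show ?case
      using continuous_on_compose[OF Suc continuous_on_subset[OF that(1)]] by simp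
  qed (simp add: id_def)
  show ?thesis
    using homeomorphism_inv cont[of T] cont[of "inv_into \<Omega> T"]
    unfolding homeomorphism_def int_iterate_def by (cases "0 \<le> j") (auto simp: id_def)
qed

lemma iter_image: "iter j ` \<Omega> = \<Omega>"
proof -
  have "x \<in> iter j ` \<Omega>" if "x \<in> \<Omega>" for x
    using iter_add[OF that, of j "-j"] that by (metis add.right_inverse image_eqI iter_0 iter_in)
  then show ?thesis by auto
qed

end

locale compact_SL_cocycle =
  fixes \<Omega> :: "'a::metric_space set" and T :: "'a \<Rightarrow> 'a" and A :: "'a \<Rightarrow> complex^'n^'n"
  assumes compact': "compact \<Omega>" and SL: "SL_cocycle \<Omega> T A"

sublocale compact_SL_cocycle \<subseteq> compact_homeomorphism \<Omega> T
  using compact' SL by unfold_locales (auto simp: SL_cocycle_def)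

context compact_SL_cocycle
begin

abbreviation "Aiter \<equiv> cocycle_iterate \<Omega> T A"

lemma invertible_A: "\<omega> \<in> \<Omega> \<Longrightarrow> invertible (A \<omega>)"
  using SL by (simp add: SL_cocycle_def invertible_det_nz)

lemma continuous_A: "continuous_on \<Omega> A"
  using SL by (simp add: SL_cocycle_def)

lemma Aiter_0 [simp]: "Aiter 0 \<omega> = mat 1"
  by (simp add: cocycle_iterate_def)

lemma Aiter_Suc:
  assumes "\<omega> \<in> \<Omega>" shows "Aiter (n + 1) \<omega> = A (iter n \<omega>) ** Aiter n \<omega>"
proof (cases "0 \<le> n")
  case True
  then have "nat (n + 1) = Suc (nat n)" by simp
  then show ?thesis using True by (simp add: cocycle_iterate_def)
next
  case False
  define k where "k = nat (- (n + 1))"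
  have k: "nat (- n) = Suc k" "n = - int (Suc k)"
    using False by (auto simp: k_def)
  have "Aiter (n + 1) \<omega> = cocycle_bwd \<Omega> T A k \<omega>"
    using False k by (cases "k = 0") (auto simp: cocycle_iterate_def)
  moreover have "Aiter n \<omega> = matrix_inv (A (iter n \<omega>)) ** cocycle_bwd \<Omega> T A k \<omega>"
    using False k by (simp add: cocycle_iterate_def)
  ultimately show ?thesis
    using matrix_inv_right[OF invertible_A[of "iter n \<omega>"]] assms by (simp add: matrix_mul_assoc)
qed

lemma A_inj: "\<omega> \<in> \<Omega> \<Longrightarrow> A \<omega> *v x = A \<omega> *v y \<Longrightarrow> x = y"
  by (metis invertible_A matrix_inv_left matrix_vector_mul_assoc matrix_vector_mul_lid)

text \<open>The recursion can be solved backwards because every \<open>A \<omega>\<close> is invertible.\<close>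

lemma orbit_unique:
  assumes "\<omega> \<in> \<Omega>" and orbit: "\<And>n. x (n + 1) = A (iter n \<omega>) *v x n"
  shows "x n = Aiter n \<omega> *v x 0"
proof (induction n rule: int_induct[where k = 0])
  case (step1 i)
  then show ?case by (simp add: Aiter_Suc[OF assms(1)] orbit matrix_vector_mul_assoc)
next
  case (step2 i)
  have "A (iter (i - 1) \<omega>) *v x (i - 1) = A (iter (i - 1) \<omega>) *v (Aiter (i - 1) \<omega> *v x 0)"
    using step2 orbit[of "i - 1"] Aiter_Suc[OF assms(1), of "i - 1"] by (simp add: matrix_vector_mul_assoc)
  then show ?case using A_inj assms(1) by blast
qed simp

text \<open>Both sides describe, as functions of \<open>n\<close>, the orbit over \<open>iter m \<omega>\<close> with the same initial vector.\<close>

lemma Aiter_add: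
  assumes "\<omega> \<in> \<Omega>" shows "Aiter (n + m) \<omega> *v v = Aiter n (iter m \<omega>) *v (Aiter m \<omega> *v v)"
proof -
  have "Aiter (n + m) \<omega> *v v = Aiter n (iter m \<omega>) *v (Aiter (0 + m) \<omega> *v v)"
  proof (rule orbit_unique)
    show "Aiter (n + 1 + m) \<omega> *v v = A (iter n (iter m \<omega>)) *v (Aiter (n + m) \<omega> *v v)" for n
      using Aiter_Suc[OF assms, of "n + m"] iter_add[OF assms, of n m]
      by (simp add: algebra_simps matrix_vector_mul_assoc)
  qed (use assms in simp)
  then show ?thesis by simp
qed

lemma Aiter_uminus:
  assumes "\<omega> \<in> \<Omega>"
  shows "Aiter (- n) (iter n \<omega>) *v (Aiter n \<omega> *v v) = v"
    and "Aiter n (iter (- n) \<omega>) *v (Aiter (- n) \<omega> *v v) = v"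
  using Aiter_add[OF assms, of "-n" n v] Aiter_add[OF assms, of n "-n" v] by simp_all

lemma continuous_on_Aiter: "continuous_on \<Omega> (Aiter n)"
proof -
  have A: "continuous_on \<Omega> (\<lambda>\<omega>. A (iter j \<omega>))" for j
    using continuous_on_compose2[OF continuous_A continuous_on_iter] iter_image by blast
  have "continuous_on \<Omega> (cocycle_fwd \<Omega> T A k)" for k
    by (induction k) (auto intro!: continuous_on_matrix_mult A continuous_on_const)
  moreover have "continuous_on \<Omega> (cocycle_bwd \<Omega> T A k)" for k
    by (induction k)
      (auto intro!: continuous_on_matrix_mult continuous_on_matrix_inv A continuous_on_const invertible_A
        simp del: of_nat_Suc)
  ultimately show ?thesis
    unfolding cocycle_iterate_def by (cases "0 \<le> n") auto
qed

text \<open>Each iterate is continuous on a compact set, and the sum of finitely many constants serves all of them.\<close>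

lemma uniform_Aiter_bound:
  obtains M where "M \<ge> 1" "\<And>n \<omega> v. \<bar>n\<bar> \<le> int N \<Longrightarrow> \<omega> \<in> \<Omega> \<Longrightarrow> norm (Aiter n \<omega> *v v) \<le> M * norm v"
proof -
  have "\<exists>M\<ge>1. \<forall>\<omega>\<in>\<Omega>. \<forall>v. norm (Aiter n \<omega> *v v) \<le> M * norm v" for n
    using uniform_matrix_bound[OF compact continuous_on_Aiter] by metis
  then obtain M where M: "\<And>n. M n \<ge> 1" "\<And>n \<omega> v. \<omega> \<in> \<Omega> \<Longrightarrow> norm (Aiter n \<omega> *v v) \<le> M n * norm v"
    by metis
  let ?M = "\<Sum>n\<in>{- int N..int N}. M n"
  have le: "M n \<le> ?M" if "\<bar>n\<bar> \<le> int N" for n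
    using that M(1) by (intro member_le_sum) (auto intro: order_trans[OF zero_le_one])
  show thesis
  proof (rule that[of ?M])
    show "?M \<ge> 1" using le[of 0] M(1)[of 0] by simp
    show "norm (Aiter n \<omega> *v v) \<le> ?M * norm v" if "\<bar>n\<bar> \<le> int N" "\<omega> \<in> \<Omega>" for n \<omega> v
      using M(2)[OF that(2), of n v] le[OF that(1)] by (meson mult_right_mono norm_ge_zero order_trans)
  qed
qed

end

section \<open>Square-summable sequences and Neumann series\<close>

abbreviation sq_norm :: "(int \<Rightarrow> complex^'l) \<Rightarrow> real" where
  "sq_norm u \<equiv> (\<Sum>\<^sub>\<infinity>n. (norm (u n))\<^sup>2)"

lemma ell2D: "u \<in> ell2 \<Longrightarrow> (\<lambda>n. (norm (u n))\<^sup>2) summable_on UNIV"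
  by (simp add: ell2_def)

lemma sq_norm_nonneg: "sq_norm u \<ge> 0"
  by (simp add: infsum_nonneg)

lemma summable_dominated:
  fixes f g :: "'a \<Rightarrow> real"
  assumes "g summable_on S" "\<And>x. 0 \<le> f x" "\<And>x. f x \<le> g x"
  shows "f summable_on S" "infsum f S \<le> infsum g S"
proof -
  show "f summable_on S"
    using assms by (intro summable_on_comparison_test[OF assms(1)]) auto
  then show "infsum f S \<le> infsum g S"
    using assms by (intro infsum_mono) auto
qed

lemma ell2_dominated:
  fixes u :: "int \<Rightarrow> complex^'l" and v :: "int \<Rightarrow> complex^'m"
  assumes "u \<in> ell2" "\<And>n. norm (v n) \<le> K * norm (u n)"
  shows "v \<in> ell2" "sq_norm v \<le> K\<^sup>2 * sq_norm u"
proof -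
  have le: "(norm (v n))\<^sup>2 \<le> K\<^sup>2 * (norm (u n))\<^sup>2" for n
    using power_mono[OF assms(2)[of n], of 2] by (simp add: power_mult_distrib)
  have sum: "(\<lambda>n. K\<^sup>2 * (norm (u n))\<^sup>2) summable_on UNIV"
    using assms(1) by (intro summable_on_cmult_right ell2D)
  show "v \<in> ell2"
    unfolding ell2_def using summable_dominated(1)[OF sum _ le] by simp
  show "sq_norm v \<le> K\<^sup>2 * sq_norm u"
    using summable_dominated(2)[OF sum _ le] by (simp add: infsum_cmult_right')
qed

lemma ell2_add:
  assumes "u \<in> ell2" "v \<in> ell2"
  shows "(\<lambda>n. u n + v n) \<in> ell2" "sq_norm (\<lambda>n. u n + v n) \<le> 2 * sq_norm u + 2 * sq_norm v"
proof -
  have le: "(norm (u n + v n))\<^sup>2 \<le> 2 * (norm (u n))\<^sup>2 + 2 * (norm (v n))\<^sup>2" for n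
  proof -
    have "(norm (u n + v n))\<^sup>2 \<le> (norm (u n) + norm (v n))\<^sup>2"
      by (intro power_mono norm_triangle_ineq) simp
    moreover have "0 \<le> (norm (u n) - norm (v n))\<^sup>2" by simp
    ultimately show ?thesis by (simp add: power2_eq_square algebra_simps)
  qed
  have sum: "(\<lambda>n. 2 * (norm (u n))\<^sup>2 + 2 * (norm (v n))\<^sup>2) summable_on UNIV"
    using assms by (intro summable_on_add summable_on_cmult_right ell2D)
  show "(\<lambda>n. u n + v n) \<in> ell2"
    unfolding ell2_def using summable_dominated(1)[OF sum _ le] by simp
  have "infsum (\<lambda>n. 2 * (norm (u n))\<^sup>2 + 2 * (norm (v n))\<^sup>2) UNIV = 2 * sq_norm u + 2 * sq_norm v"
    using assms by (subst infsum_add) (auto simp: infsum_cmult_right' intro!: summable_on_cmult_right ell2D)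
  then show "sq_norm (\<lambda>n. u n + v n) \<le> 2 * sq_norm u + 2 * sq_norm v"
    using summable_dominated(2)[OF sum _ le] by simp
qed

lemma norm_vector_smult: "norm (c *s x) = norm c * norm x" for x :: "complex^'l"
  by (simp add: norm_vec_def norm_mult L2_set_right_distrib)

lemma ell2_scale:
  assumes "u \<in> ell2"
  shows "(\<lambda>n. c *s u n) \<in> ell2"
  by (rule ell2_dominated(1)[OF assms, of _ "norm c"]) (simp add: norm_vector_smult)

lemma bij_shift: "bij_betw (\<lambda>n::int. n + k) UNIV UNIV"
  by (rule bij_betwI[of _ _ _ "\<lambda>n. n - k"]) auto

lemma infsum_shift: "(\<Sum>\<^sub>\<infinity>n. f (n + k :: int)) = infsum f UNIV"
  using infsum_reindex_bij_betw[OF bij_shift, of f] .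

lemma summable_shift: "(\<lambda>n. f (n + k :: int)) summable_on UNIV \<longleftrightarrow> f summable_on UNIV"
  using summable_on_reindex_bij_betw[OF bij_shift, of f] .

lemma ell2_shift: "u \<in> ell2 \<Longrightarrow> (\<lambda>n. u (n + k)) \<in> ell2"
  unfolding ell2_def using summable_shift[of "\<lambda>n. (norm (u n))\<^sup>2" k] by simp

lemma summable_inner:
  assumes "u \<in> ell2" "v \<in> ell2"
  shows "(\<lambda>n. u n \<bullet> v n) summable_on UNIV"
proof -
  have le: "norm (u n \<bullet> v n) \<le> (norm (u n))\<^sup>2 + (norm (v n))\<^sup>2" for n
  proof -
    have "0 \<le> (norm (u n) - norm (v n))\<^sup>2" "norm (u n \<bullet> v n) \<le> norm (u n) * norm (v n)"
      by (auto simp: Cauchy_Schwarz_ineq2)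
    moreover have "0 \<le> norm (u n) * norm (v n)" by simp
    ultimately show ?thesis by (simp add: power2_eq_square algebra_simps)
  qed
  have "(\<lambda>n. (norm (u n))\<^sup>2 + (norm (v n))\<^sup>2) summable_on UNIV"
    using assms by (intro summable_on_add ell2D)
  from summable_dominated(1)[OF this norm_ge_zero le] show ?thesis
    using summable_on_iff_abs_summable_on_real[of "\<lambda>n. u n \<bullet> v n"] by simp
qed

lemma norm_le_ell2_norm: "u \<in> ell2 \<Longrightarrow> norm (u n) \<le> ell2_norm u"
  using finite_sum_le_infsum[OF ell2D, of u "{n}"] unfolding ell2_norm_def
  by (intro real_le_rsqrt) simp

lemma infsum_sum_finite:
  fixes f :: "'i \<Rightarrow> 'b \<Rightarrow> real"
  assumes "finite I" "\<And>i. i \<in> I \<Longrightarrow> f i summable_on S"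
  shows "(\<lambda>n. \<Sum>i\<in>I. f i n) summable_on S" "infsum (\<lambda>n. \<Sum>i\<in>I. f i n) S = (\<Sum>i\<in>I. infsum (f i) S)"
proof -
  have "(\<lambda>n. \<Sum>i\<in>I. f i n) summable_on S \<and> infsum (\<lambda>n. \<Sum>i\<in>I. f i n) S = (\<Sum>i\<in>I. infsum (f i) S)"
    using assms
  proof (induction I)
    case (insert i I)
    then show ?case
      by (auto simp: infsum_add intro!: summable_on_add)
  qed simp
  then show "(\<lambda>n. \<Sum>i\<in>I. f i n) summable_on S" "infsum (\<lambda>n. \<Sum>i\<in>I. f i n) S = (\<Sum>i\<in>I. infsum (f i) S)"
    by auto
qed

lemma L2_set_le_ell2_norm: "L2_set (\<lambda>n. norm (u n)) F \<le> ell2_norm u" if "u \<in> ell2" "finite F"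
  unfolding ell2_norm_def L2_set_def
  using finite_sum_le_infsum[OF ell2D[OF that(1)] that(2)] by simp

text \<open>Compatibility with coordinatewise convergent series. Operators of finite range such as \<open>H\<^sub>\<omega>\<close> have
  this property, and it lets a Neumann series be summed coordinate by coordinate, without a completeness
  argument in \<open>\<ell>\<^sup>2\<close>.\<close>

definition local_linear :: "((int \<Rightarrow> complex^'l) \<Rightarrow> (int \<Rightarrow> complex^'l)) \<Rightarrow> bool" where
  "local_linear K \<longleftrightarrow> (\<forall>g u. (\<forall>n. (\<lambda>k::nat. g k n) sums u n) \<longrightarrow> (\<forall>n. (\<lambda>k. K (g k) n) sums K u n))"

lemma local_linear_sums:
  "local_linear K \<Longrightarrow> (\<And>n. (\<lambda>k::nat. g k n) sums u n) \<Longrightarrow> (\<lambda>k. K (g k) n) sums K u n"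
  by (simp add: local_linear_def)

text \<open>The powers \<open>K\<^sup>k f\<close> decay geometrically in norm, so their sum converges in every coordinate. Minkowski's
  inequality bounds the sum over finitely many coordinates uniformly, which puts the limit into
  \<open>\<ell>\<^sup>2\<close>.\<close>

lemma Neumann_series:
  fixes K :: "(int \<Rightarrow> complex^'l) \<Rightarrow> (int \<Rightarrow> complex^'l)"
  assumes K_ell2: "\<And>u. u \<in> ell2 \<Longrightarrow> K u \<in> ell2"
    and contr: "\<And>u. u \<in> ell2 \<Longrightarrow> sq_norm (K u) \<le> q * sq_norm u"
    and q: "0 \<le> q" "q < 1" and loc: "local_linear K" and f: "f \<in> ell2"
  obtains u where "u \<in> ell2" "\<And>n. u n = K u n + f n"
proof -
  define g where "g k = (K ^^ k) f" for k
  have g_Suc: "g (Suc k) = K (g k)" for k by (simp add: g_def)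
  have g_ell2: "g k \<in> ell2" for k
    by (induction k) (auto simp: g_def f intro: K_ell2)
  have g_sq: "sq_norm (g k) \<le> q ^ k * sq_norm f" for k
  proof (induction k)
    case (Suc k)
    have "sq_norm (g (Suc k)) \<le> q * sq_norm (g k)"
      unfolding g_Suc by (rule contr[OF g_ell2])
    also have "\<dots> \<le> q * (q ^ k * sq_norm f)"
      using Suc q by (intro mult_left_mono)
    finally show ?case by (simp add: mult.assoc)
  qed (simp add: g_def)
  define s where "s = sqrt q"
  have s: "0 \<le> s" "s < 1"
    using q by (auto simp: s_def)
  have g_norm: "ell2_norm (g k) \<le> s ^ k * ell2_norm f" for k
    using real_sqrt_le_mono[OF g_sq[of k]]
    by (simp add: ell2_norm_def s_def real_sqrt_mult real_sqrt_power)
  have geo: "summable (\<lambda>k. s ^ k * ell2_norm f)"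
    using s by (intro summable_mult2 summable_geometric) auto
  have "summable (\<lambda>k. g k n)" for n
  proof (rule summable_comparison_test'[OF geo])
    show "norm (g k n) \<le> s ^ k * ell2_norm f" for k
      using norm_le_ell2_norm[OF g_ell2] g_norm order_trans by blast
  qed
  then obtain u where u: "\<And>n. (\<lambda>k. g k n) sums u n"
    unfolding summable_def by metis
  show thesis
  proof (rule that)
    let ?B = "\<Sum>k. s ^ k * ell2_norm f"
    have bound: "L2_set (\<lambda>n. norm (u n)) F \<le> ?B" if "finite F" for F
    proof (rule LIMSEQ_le_const2)
      have "(\<lambda>m. \<Sum>k<m. g k n) \<longlonglongrightarrow> u n" for n
        using u[of n] by (simp add: sums_def)
      then show "(\<lambda>m. L2_set (\<lambda>n. norm (\<Sum>k<m. g k n)) F) \<longlonglongrightarrow> L2_set (\<lambda>n. norm (u n)) F"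
        unfolding L2_set_def by (intro tendsto_intros)
      have "L2_set (\<lambda>n. norm (\<Sum>k<m. g k n)) F \<le> (\<Sum>k<m. s ^ k * ell2_norm f)" for m
      proof (induction m)
        case (Suc m)
        have "L2_set (\<lambda>n. norm (\<Sum>k<Suc m. g k n)) F
            \<le> L2_set (\<lambda>n. norm (\<Sum>k<m. g k n) + norm (g m n)) F"
          by (intro L2_set_mono) (auto intro: norm_triangle_ineq)
        also have "\<dots> \<le> L2_set (\<lambda>n. norm (\<Sum>k<m. g k n)) F + L2_set (\<lambda>n. norm (g m n)) F"
          by (rule L2_set_triangle_ineq)
        also have "\<dots> \<le> (\<Sum>k<m. s ^ k * ell2_norm f) + s ^ m * ell2_norm f"
          using Suc L2_set_le_ell2_norm[OF g_ell2 that, of m] g_norm[of m] by linarith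
        finally show ?case by simp
      qed (simp add: L2_set_def)
      moreover have "(\<Sum>k<m. s ^ k * ell2_norm f) \<le> ?B" for m
        using s by (intro sum_le_suminf geo) (auto simp: ell2_norm_def sq_norm_nonneg)
      ultimately show "\<exists>N. \<forall>m\<ge>N. L2_set (\<lambda>n. norm (\<Sum>k<m. g k n)) F \<le> ?B"
        using order_trans by blast
    qed
    have "(\<Sum>n\<in>F. (norm (u n))\<^sup>2) \<le> ?B\<^sup>2" if "finite F" for F
      using bound[OF that] unfolding L2_set_def by (rule sqrt_le_D)
    then show "u \<in> ell2"
      unfolding ell2_def by (auto intro!: nonneg_bdd_above_summable_on bdd_aboveI2[where M = "?B\<^sup>2"])
    show "u n = K u n + f n" for n
    proof -
      have "(\<lambda>k. g (Suc k) n) sums K u n"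
        unfolding g_Suc by (rule local_linear_sums[OF loc u])
      then have "(\<lambda>k. g k n) sums (K u n + g 0 n)"
        by (rule sums_Suc_iff[THEN iffD1])
      then show ?thesis
        using u[of n] sums_unique2 by (fastforce simp: g_def)
    qed
  qed
qed

text \<open>If \<open>M\<close> is the adjoint of \<open>L\<close>, then \<open>\<langle>M L u, u\<rangle> = \<parallel>L u\<parallel>\<^sup>2\<close>, so \<open>M L\<close> is positive and bounded below.
  For small \<open>t\<close> the operator \<open>1 - t M L\<close> is then a contraction, and a Neumann series solves
  \<open>M (L u) = f\<close>.\<close>

lemma adjoint_pair_surjective:
  fixes L M :: "(int \<Rightarrow> complex^'l) \<Rightarrow> (int \<Rightarrow> complex^'l)"
  assumes L_ell2: "\<And>u. u \<in> ell2 \<Longrightarrow> L u \<in> ell2" and M_ell2: "\<And>u. u \<in> ell2 \<Longrightarrow> M u \<in> ell2"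
    and bound: "\<And>u. u \<in> ell2 \<Longrightarrow> sq_norm (M (L u)) \<le> B * sq_norm u"
    and below: "\<And>u. u \<in> ell2 \<Longrightarrow> c * sq_norm u \<le> sq_norm (L u)"
    and c: "0 < c" "c\<^sup>2 \<le> B"
    and adj: "\<And>u v. u \<in> ell2 \<Longrightarrow> v \<in> ell2 \<Longrightarrow> (\<Sum>\<^sub>\<infinity>n. L u n \<bullet> v n) = (\<Sum>\<^sub>\<infinity>n. u n \<bullet> M v n)"
    and loc: "local_linear L" "local_linear M" and f: "f \<in> ell2"
  obtains v where "v \<in> ell2" "M v = f"
proof -
  have B: "B > 0"
    using c by (meson less_le_trans zero_less_power)
  \<comment> \<open>Minimises the contraction factor \<open>1 - 2 t c + t\<^sup>2 B\<close>, giving \<open>1 - c\<^sup>2 / B\<close>.\<close>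
  define t where "t = c / B"
  have t: "t > 0" using c B by (simp add: t_def)
  define K where "K u n = u n - t *\<^sub>R M (L u) n" for u n
  have comp: "M (L u) \<in> ell2" if "u \<in> ell2" for u
    by (intro M_ell2 L_ell2 that)
  have scale: "(\<lambda>n. a *\<^sub>R u n) \<in> ell2" if "u \<in> ell2" for a :: real and u :: "int \<Rightarrow> complex^'l"
    by (rule ell2_dominated(1)[OF that, of _ "\<bar>a\<bar>"]) simp
  have K_ell2: "K u \<in> ell2" if "u \<in> ell2" for u
    using ell2_add(1)[OF that scale[OF comp[OF that], of "- t"]] by (simp add: K_def[abs_def])
  have contr: "sq_norm (K u) \<le> (1 - c\<^sup>2 / B) * sq_norm u" if u: "u \<in> ell2" for u
  proof -
    note sums = ell2D[OF u] ell2D[OF comp[OF u]] summable_inner[OF u comp[OF u]]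
    have "(norm (K u n))\<^sup>2 = ((norm (u n))\<^sup>2 + (- 2 * t) * (u n \<bullet> M (L u) n)) + t\<^sup>2 * (norm (M (L u) n))\<^sup>2" for n
      unfolding K_def power2_norm_eq_inner
      by (simp add: inner_diff_left inner_diff_right inner_commute algebra_simps power2_eq_square)
    then have "sq_norm (K u) = (\<Sum>\<^sub>\<infinity>n. ((norm (u n))\<^sup>2 + (- 2 * t) * (u n \<bullet> M (L u) n)) + t\<^sup>2 * (norm (M (L u) n))\<^sup>2)"
      by simp
    also have "\<dots> = (sq_norm u + (- 2 * t) * (\<Sum>\<^sub>\<infinity>n. u n \<bullet> M (L u) n)) + t\<^sup>2 * sq_norm (M (L u))"
      using infsum_add[OF summable_on_add[OF sums(1) summable_on_cmult_right[OF sums(3), of "- 2 * t"]]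
          summable_on_cmult_right[OF sums(2), of "t\<^sup>2"]]
        infsum_add[OF sums(1) summable_on_cmult_right[OF sums(3), of "- 2 * t"]]
      by (simp only: infsum_cmult_right')
    also have "(\<Sum>\<^sub>\<infinity>n. u n \<bullet> M (L u) n) = sq_norm (L u)"
      using adj[OF u L_ell2[OF u]] by (simp add: power2_norm_eq_inner)
    also have "(sq_norm u + (- 2 * t) * sq_norm (L u)) + t\<^sup>2 * sq_norm (M (L u))
        \<le> (sq_norm u + (- 2 * t) * (c * sq_norm u)) + t\<^sup>2 * (B * sq_norm u)"
      using bound[OF u] below[OF u] t by (intro add_mono mult_left_mono mult_left_mono_neg) auto
    also have "\<dots> = (1 - c\<^sup>2 / B) * sq_norm u"
      using B by (simp add: t_def field_simps power2_eq_square)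
    finally show ?thesis .
  qed
  have "local_linear K"
    unfolding local_linear_def K_def
  proof (intro allI impI)
    fix g :: "nat \<Rightarrow> int \<Rightarrow> complex^'l" and u n
    assume u: "\<forall>n. (\<lambda>k. g k n) sums u n"
    have "(\<lambda>k. L (g k) n) sums L u n" for n
      using local_linear_sums[OF loc(1)] u by blast
    then have "(\<lambda>k. M (L (g k)) n) sums M (L u) n"
      by (rule local_linear_sums[OF loc(2), of "\<lambda>k. L (g k)" "L u"])
    then show "(\<lambda>k. g k n - t *\<^sub>R M (L (g k)) n) sums (u n - t *\<^sub>R M (L u) n)"
      using u by (intro sums_diff sums_scaleR_right) auto
  qed
  moreover have "0 \<le> 1 - c\<^sup>2 / B" "1 - c\<^sup>2 / B < 1"
    using c B by auto
  ultimately obtain u where u: "u \<in> ell2" "\<And>n. u n = K u n + t *\<^sub>R f n"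
    using Neumann_series[of K, OF K_ell2 contr _ _ _ scale[OF f, of t]] by metis
  have "M (L u) n = f n" for n
    using u(2)[of n] t by (simp add: K_def)
  then show thesis
    using that[of "L u"] L_ell2[OF u(1)] by blast
qed

section \<open>The resolvent set of a Jacobi operator\<close>

lemma bounded_linear_vector_smult: "bounded_linear (\<lambda>x. z *s x)" for z :: complex
  by (rule bounded_linear_intro[where K = "norm z"])
    (simp_all add: vector_add_ldistrib norm_vector_smult vec_eq_iff scaleR_conv_of_real)

lemma inner_cmatrix: "(cmatrix A *v x) \<bullet> y = x \<bullet> (cmatrix (transpose A) *v y)"
proof -
  have "(cmatrix A *v x) \<bullet> y = (\<Sum>i\<in>UNIV. \<Sum>j\<in>UNIV. A $ i $ j * (x $ j \<bullet> y $ i))"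
    by (simp add: inner_vec_def matrix_vector_mult_def inner_sum_left flip: scaleR_conv_of_real)
  also have "\<dots> = (\<Sum>j\<in>UNIV. \<Sum>i\<in>UNIV. A $ i $ j * (x $ j \<bullet> y $ i))"
    by (rule sum.swap)
  also have "\<dots> = x \<bullet> (cmatrix (transpose A) *v y)"
    by (simp add: inner_vec_def matrix_vector_mult_def inner_sum_right transpose_def flip: scaleR_conv_of_real)
  finally show ?thesis .
qed

lemma inner_vector_smult: "(z *s x) \<bullet> y = x \<bullet> (cnj z *s y)" for x y :: "complex^'l"
  by (simp add: inner_vec_def inner_complex_def algebra_simps)

definition conj_vec :: "complex^'l \<Rightarrow> complex^'l" where
  "conj_vec x = (\<chi> i. cnj (x $ i))"

lemma norm_conj_vec [simp]: "norm (conj_vec x) = norm x"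
  by (simp add: conj_vec_def norm_vec_def)

lemma conj_vec_linear:
  "conj_vec (x + y) = conj_vec x + conj_vec y" "conj_vec (x - y) = conj_vec x - conj_vec y"
  "conj_vec (z *s x) = cnj z *s conj_vec x"
  "conj_vec (cmatrix A *v x) = cmatrix A *v conj_vec x"
  by (simp_all add: conj_vec_def vec_eq_iff matrix_vector_mult_def)

locale jacobi = compact_homeomorphism \<Omega> T
  for \<Omega> :: "'a::metric_space set" and T :: "'a \<Rightarrow> 'a" +
  fixes D V :: "'a \<Rightarrow> real^'l^'l"
  assumes D_cont: "continuous_on \<Omega> D" and V_cont: "continuous_on \<Omega> V"
    and D_sym: "\<And>\<omega>. \<omega> \<in> \<Omega> \<Longrightarrow> transpose (D \<omega>) = D \<omega>"
    and V_sym: "\<And>\<omega>. \<omega> \<in> \<Omega> \<Longrightarrow> transpose (V \<omega>) = V \<omega>"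
    and D_inv: "\<And>\<omega>. \<omega> \<in> \<Omega> \<Longrightarrow> invertible (D \<omega>)"
begin

definition shifted_jacobi :: "complex \<Rightarrow> 'a \<Rightarrow> (int \<Rightarrow> complex^'l) \<Rightarrow> int \<Rightarrow> complex^'l" where
  "shifted_jacobi z \<omega> u n = jacobi_operator \<Omega> T D V \<omega> u n - z *s u n"

lemmas shifted_jacobi_eq = shifted_jacobi_def jacobi_operator_def

lemma D_inverse:
  assumes "\<omega> \<in> \<Omega>"
  shows "cmatrix (D \<omega>) ** cmatrix (matrix_inv (D \<omega>)) = mat 1"
    and "cmatrix (matrix_inv (D \<omega>)) ** cmatrix (D \<omega>) = mat 1"
  using assms D_inv by (simp_all add: matrix_inv_left matrix_inv_right flip: cmatrix_mult)

lemma D_inverse_vec: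
  assumes "\<omega> \<in> \<Omega>"
  shows "cmatrix (D \<omega>) *v (cmatrix (matrix_inv (D \<omega>)) *v x) = x"
    and "cmatrix (matrix_inv (D \<omega>)) *v (cmatrix (D \<omega>) *v x) = x"
  using D_inverse[OF assms] by (simp_all add: matrix_vector_mul_assoc)

lemma coefficient_bound:
  "\<exists>M\<ge>1. \<forall>\<omega>\<in>\<Omega>. \<forall>x. norm (cmatrix (D \<omega>) *v x) \<le> M * norm x \<and>
      norm (cmatrix (V \<omega>) *v x) \<le> M * norm x \<and> norm (cmatrix (matrix_inv (D \<omega>)) *v x) \<le> M * norm x"
proof -
  obtain a where a: "a \<ge> 1" "\<And>\<omega> x. \<omega> \<in> \<Omega> \<Longrightarrow> norm (cmatrix (D \<omega>) *v x) \<le> a * norm x"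
    using uniform_matrix_bound[OF compact continuous_on_cmatrix[OF D_cont]] by blast
  obtain b where b: "b \<ge> 1" "\<And>\<omega> x. \<omega> \<in> \<Omega> \<Longrightarrow> norm (cmatrix (V \<omega>) *v x) \<le> b * norm x"
    using uniform_matrix_bound[OF compact continuous_on_cmatrix[OF V_cont]] by blast
  obtain c where c: "c \<ge> 1" "\<And>\<omega> x. \<omega> \<in> \<Omega> \<Longrightarrow> norm (cmatrix (matrix_inv (D \<omega>)) *v x) \<le> c * norm x"
    using uniform_matrix_bound[OF compact continuous_on_cmatrix[OF continuous_on_matrix_inv[OF D_cont D_inv]]]
    by blast
  have mono: "y \<le> (a + b + c) * norm x" if "y \<le> k * norm x" "k \<in> {a, b, c}" for y k and x :: "complex^'l"
  proof -
    have "k * norm x \<le> (a + b + c) * norm x"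
      using a(1) b(1) c(1) that(2) by (intro mult_right_mono) auto
    then show ?thesis using that(1) by linarith
  qed
  show ?thesis
    using a(1) b(1) c(1) mono[OF a(2)] mono[OF b(2)] mono[OF c(2)]
    by (intro exI[of _ "a + b + c"]) simp
qed

lemma shifted_jacobi_local_linear: "local_linear (shifted_jacobi z \<omega>)"
  unfolding local_linear_def
proof (intro allI impI)
  fix g :: "nat \<Rightarrow> int \<Rightarrow> complex^'l" and u n
  assume u: "\<forall>n. (\<lambda>k. g k n) sums u n"
  have "(\<lambda>k. A *v g k m) sums (A *v u m)" for A :: "complex^'l^'l" and m
    using bounded_linear.sums[OF matrix_vector_mul_bounded_linear] u by blast
  moreover have "(\<lambda>k. z *s g k n) sums (z *s u n)"
    using bounded_linear.sums[OF bounded_linear_vector_smult] u by blast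
  ultimately show "(\<lambda>k. shifted_jacobi z \<omega> (g k) n) sums shifted_jacobi z \<omega> u n"
    unfolding shifted_jacobi_eq by (intro sums_diff sums_add)
qed

lemma shifted_jacobi_bounded:
  obtains B where "\<And>\<omega> u. \<omega> \<in> \<Omega> \<Longrightarrow> u \<in> ell2 \<Longrightarrow> shifted_jacobi z \<omega> u \<in> ell2 \<and> sq_norm (shifted_jacobi z \<omega> u) \<le> B * sq_norm u"
proof -
  obtain M where M: "M \<ge> 1"
    "\<And>\<omega> x. \<omega> \<in> \<Omega> \<Longrightarrow> norm (cmatrix (D \<omega>) *v x) \<le> M * norm x"
    "\<And>\<omega> x. \<omega> \<in> \<Omega> \<Longrightarrow> norm (cmatrix (V \<omega>) *v x) \<le> M * norm x"
    "\<And>\<omega> x. \<omega> \<in> \<Omega> \<Longrightarrow> norm (cmatrix (matrix_inv (D \<omega>)) *v x) \<le> M * norm x"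
    using coefficient_bound by blast
  show thesis
  proof (rule that)
    fix \<omega> and u :: "int \<Rightarrow> complex^'l" assume \<omega>: "\<omega> \<in> \<Omega>" and u: "u \<in> ell2"
    let ?a = "\<lambda>n. cmatrix (D (iter (n - 1) \<omega>)) *v u (n - 1)"
    let ?b = "\<lambda>n. cmatrix (D (iter n \<omega>)) *v u (n + 1)"
    let ?c = "\<lambda>n. cmatrix (V (iter n \<omega>)) *v u n + (- z) *s u n"
    have shift: "sq_norm (\<lambda>n. u (n + k)) = sq_norm u" for k
      using infsum_shift[of "\<lambda>n. (norm (u n))\<^sup>2" k] .
    have a: "?a \<in> ell2" "sq_norm ?a \<le> M\<^sup>2 * sq_norm u"
      using ell2_dominated[OF ell2_shift[OF u, of "-1"], of ?a M] M(2) \<omega> shift[of "-1"] by auto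
    have b: "?b \<in> ell2" "sq_norm ?b \<le> M\<^sup>2 * sq_norm u"
      using ell2_dominated[OF ell2_shift[OF u, of 1], of ?b M] M(2) \<omega> shift[of 1] by auto
    have "norm (?c n) \<le> (M + norm z) * norm (u n)" for n
      using M(3)[OF iter_in[OF \<omega>], of n "u n"] norm_triangle_ineq[of "cmatrix (V (iter n \<omega>)) *v u n" "(- z) *s u n"]
      by (simp add: norm_vector_smult algebra_simps)
    note c = ell2_dominated[OF u this]
    have "shifted_jacobi z \<omega> u = (\<lambda>n. (?a n + ?b n) + ?c n)"
      by (simp add: shifted_jacobi_eq fun_eq_iff vector_smult_lneg algebra_simps)
    then show "shifted_jacobi z \<omega> u \<in> ell2 \<and> sq_norm (shifted_jacobi z \<omega> u) \<le> (8 * M\<^sup>2 + 2 * (M + norm z)\<^sup>2) * sq_norm u"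
      using ell2_add[OF ell2_add(1)[OF a(1) b(1)] c(1)] ell2_add(2)[OF a(1) b(1)] a(2) b(2) c(2)
      by (simp add: algebra_simps)
  qed
qed

lemma shifted_jacobi_ell2: "\<omega> \<in> \<Omega> \<Longrightarrow> u \<in> ell2 \<Longrightarrow> shifted_jacobi z \<omega> u \<in> ell2"
  using shifted_jacobi_bounded by blast

text \<open>The inner product here is the real one, the real part of the Hermitian product; for it, multiplication
  by \<open>z\<close> has as adjoint the multiplication by the conjugate of \<open>z\<close>. The two hopping terms exchange their
  roles after a shift of the summation index by one.\<close>

lemma shifted_jacobi_adjoint:
  assumes \<omega>: "\<omega> \<in> \<Omega>" and u: "u \<in> ell2" and v: "v \<in> ell2"
  shows "(\<Sum>\<^sub>\<infinity>n. shifted_jacobi z \<omega> u n \<bullet> v n) = (\<Sum>\<^sub>\<infinity>n. u n \<bullet> shifted_jacobi (cnj z) \<omega> v n)"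
proof -
  obtain M where M: "M \<ge> 1"
    "\<And>\<omega> x. \<omega> \<in> \<Omega> \<Longrightarrow> norm (cmatrix (D \<omega>) *v x) \<le> M * norm x"
    "\<And>\<omega> x. \<omega> \<in> \<Omega> \<Longrightarrow> norm (cmatrix (V \<omega>) *v x) \<le> M * norm x"
    "\<And>\<omega> x. \<omega> \<in> \<Omega> \<Longrightarrow> norm (cmatrix (matrix_inv (D \<omega>)) *v x) \<le> M * norm x"
    using coefficient_bound by blast
  let ?d = "\<lambda>n. cmatrix (D (iter n \<omega>))"
  define p where "p n = (?d n *v u n) \<bullet> v (n + 1)" for n
  define q where "q n = u (n + 1) \<bullet> (?d n *v v n)" for n
  define r where "r n = u n \<bullet> (cmatrix (V (iter n \<omega>)) *v v n - cnj z *s v n)" for n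
  have d: "(\<lambda>n. ?d n *v x n) \<in> ell2" if "x \<in> ell2" for x
    by (rule ell2_dominated(1)[OF that, of _ M]) (simp add: M(2) \<omega>)
  have p: "p summable_on UNIV"
    unfolding p_def using summable_inner[OF d[OF u] ell2_shift[OF v]] .
  have q: "q summable_on UNIV"
    unfolding q_def using summable_inner[OF ell2_shift[OF u] d[OF v]] .
  have p': "(\<lambda>n. p (n - 1)) summable_on UNIV" and q': "(\<lambda>n. q (n - 1)) summable_on UNIV"
    using summable_shift[of p "-1"] summable_shift[of q "-1"] p q by auto
  have dsym: "(?d n *v x) \<bullet> y = x \<bullet> (?d n *v y)" for n x y
    using \<omega> by (simp add: inner_cmatrix D_sym)
  have vsym: "(cmatrix (V (iter n \<omega>)) *v x) \<bullet> y = x \<bullet> (cmatrix (V (iter n \<omega>)) *v y)" for n x y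
    using \<omega> by (simp add: inner_cmatrix V_sym)
  have left: "shifted_jacobi z \<omega> u n \<bullet> v n = (p (n - 1) + q n) + r n" for n
    by (simp add: shifted_jacobi_eq p_def q_def r_def inner_add_left inner_diff_left inner_diff_right
        inner_vector_smult dsym[of n] vsym)
  have right: "u n \<bullet> shifted_jacobi (cnj z) \<omega> v n = (q (n - 1) + p n) + r n" for n
    by (simp add: shifted_jacobi_eq p_def q_def r_def inner_add_right inner_diff_right dsym)
  have "(\<lambda>n. shifted_jacobi z \<omega> u n \<bullet> v n + - (p (n - 1) + q n)) summable_on UNIV"
    by (intro summable_on_add[OF summable_inner[OF shifted_jacobi_ell2[OF \<omega> u] v, of z]]
        summable_on_uminus[THEN iffD2] summable_on_add[OF p' q])
  moreover have "(\<lambda>n. shifted_jacobi z \<omega> u n \<bullet> v n + - (p (n - 1) + q n)) = r"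
    by (simp add: left fun_eq_iff)
  ultimately have r: "r summable_on UNIV"
    by simp
  have "(\<Sum>\<^sub>\<infinity>n. shifted_jacobi z \<omega> u n \<bullet> v n) = ((\<Sum>\<^sub>\<infinity>n. p (n - 1)) + infsum q UNIV) + infsum r UNIV"
    unfolding left using infsum_add[OF summable_on_add[OF p' q] r] infsum_add[OF p' q] by simp
  moreover have "(\<Sum>\<^sub>\<infinity>n. u n \<bullet> shifted_jacobi (cnj z) \<omega> v n) = ((\<Sum>\<^sub>\<infinity>n. q (n - 1)) + infsum p UNIV) + infsum r UNIV"
    unfolding right using infsum_add[OF summable_on_add[OF q' p] r] infsum_add[OF q' p] by simp
  moreover have "(\<Sum>\<^sub>\<infinity>n. p (n - 1)) = infsum p UNIV" "(\<Sum>\<^sub>\<infinity>n. q (n - 1)) = infsum q UNIV"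
    using infsum_shift[of p "-1"] infsum_shift[of q "-1"] by auto
  ultimately show ?thesis by simp
qed

definition bounded_below :: "complex \<Rightarrow> 'a \<Rightarrow> bool" where
  "bounded_below z \<omega> \<longleftrightarrow> (\<exists>c>0. \<forall>u\<in>ell2. c * sq_norm u \<le> sq_norm (shifted_jacobi z \<omega> u))"

text \<open>The coefficients are real, so \<open>H\<^sub>\<omega>\<close> commutes with complex conjugation.\<close>

lemma bounded_below_cnj:
  assumes "bounded_below z \<omega>" shows "bounded_below (cnj z) \<omega>"
proof -
  obtain c where c: "c > 0" "\<And>u. u \<in> ell2 \<Longrightarrow> c * sq_norm u \<le> sq_norm (shifted_jacobi z \<omega> u)"
    using assms unfolding bounded_below_def by blast
  have "c * sq_norm u \<le> sq_norm (shifted_jacobi (cnj z) \<omega> u)" if u: "u \<in> ell2" for u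
  proof -
    have "(\<lambda>n. conj_vec (u n)) \<in> ell2"
      using u by (simp add: ell2_def)
    moreover have "shifted_jacobi z \<omega> (\<lambda>n. conj_vec (u n)) n = conj_vec (shifted_jacobi (cnj z) \<omega> u n)" for n
      by (simp add: shifted_jacobi_eq conj_vec_linear)
    ultimately show ?thesis
      using c(2)[of "\<lambda>n. conj_vec (u n)"] by simp
  qed
  then show ?thesis
    unfolding bounded_below_def using c(1) by blast
qed

text \<open>The lower bound for the conjugate of \<open>z\<close> makes \<open>H\<^sub>\<omega> - z\<close>, its adjoint, surjective.\<close>

lemma bounded_below_surjective:
  assumes \<omega>: "\<omega> \<in> \<Omega>" and below: "bounded_below z \<omega>" and f: "f \<in> ell2"
  obtains u where "u \<in> ell2" "shifted_jacobi z \<omega> u = f"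
proof -
  obtain c where c: "c > 0" "\<And>u. u \<in> ell2 \<Longrightarrow> c * sq_norm u \<le> sq_norm (shifted_jacobi (cnj z) \<omega> u)"
    using bounded_below_cnj[OF below] unfolding bounded_below_def by blast
  obtain B where B: "\<And>u. u \<in> ell2 \<Longrightarrow> sq_norm (shifted_jacobi z \<omega> u) \<le> B * sq_norm u"
    using shifted_jacobi_bounded[of z] \<omega> by metis
  obtain B' where B': "\<And>u. u \<in> ell2 \<Longrightarrow> sq_norm (shifted_jacobi (cnj z) \<omega> u) \<le> B' * sq_norm u"
    using shifted_jacobi_bounded[of "cnj z"] \<omega> by metis
  have "sq_norm (shifted_jacobi z \<omega> (shifted_jacobi (cnj z) \<omega> u)) \<le> (c\<^sup>2 + \<bar>B\<bar> * \<bar>B'\<bar>) * sq_norm u" if u: "u \<in> ell2" for u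
  proof -
    have "sq_norm (shifted_jacobi z \<omega> (shifted_jacobi (cnj z) \<omega> u)) \<le> B * sq_norm (shifted_jacobi (cnj z) \<omega> u)"
      by (rule B[OF shifted_jacobi_ell2[OF \<omega> u]])
    also have "\<dots> \<le> \<bar>B\<bar> * sq_norm (shifted_jacobi (cnj z) \<omega> u)"
      by (intro mult_right_mono sq_norm_nonneg) simp
    also have "\<dots> \<le> \<bar>B\<bar> * (\<bar>B'\<bar> * sq_norm u)"
    proof (intro mult_left_mono)
      have "B' * sq_norm u \<le> \<bar>B'\<bar> * sq_norm u"
        by (intro mult_right_mono sq_norm_nonneg) simp
      then show "sq_norm (shifted_jacobi (cnj z) \<omega> u) \<le> \<bar>B'\<bar> * sq_norm u"
        using B'[OF u] by linarith
    qed simp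
    also have "\<dots> \<le> (c\<^sup>2 + \<bar>B\<bar> * \<bar>B'\<bar>) * sq_norm u"
      using mult_nonneg_nonneg[OF zero_le_power2[of c] sq_norm_nonneg[of u]] by (simp add: algebra_simps)
    finally show ?thesis .
  qed
  then show thesis
    using adjoint_pair_surjective[of "shifted_jacobi (cnj z) \<omega>" "shifted_jacobi z \<omega>" "c\<^sup>2 + \<bar>B\<bar> * \<bar>B'\<bar>" c f thesis]
      shifted_jacobi_ell2[OF \<omega>] c shifted_jacobi_adjoint[OF \<omega>, of _ _ "cnj z"] shifted_jacobi_local_linear f that by auto
qed

text \<open>A bounded inverse is the same as a lower bound together with surjectivity, and the lower bound implies
  surjectivity.\<close>

lemma resolvent_iff_bounded_below:
  assumes \<omega>: "\<omega> \<in> \<Omega>"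
  shows "z \<in> resolvent_set (jacobi_operator \<Omega> T D V \<omega>) \<longleftrightarrow> bounded_below z \<omega>"
proof -
  let ?R = "inv_into ell2 (shifted_jacobi z \<omega>)"
  have op: "(\<lambda>u n. jacobi_operator \<Omega> T D V \<omega> u n - z *s u n) = shifted_jacobi z \<omega>"
    by (simp add: shifted_jacobi_def fun_eq_iff)
  have res: "z \<in> resolvent_set (jacobi_operator \<Omega> T D V \<omega>)
      \<longleftrightarrow> bij_betw (shifted_jacobi z \<omega>) ell2 ell2 \<and> ell2_bounded_operator ?R"
    by (simp add: resolvent_set_def op)
  show ?thesis
  proof
    assume "z \<in> resolvent_set (jacobi_operator \<Omega> T D V \<omega>)"
    then have bij: "bij_betw (shifted_jacobi z \<omega>) ell2 ell2" and R: "ell2_bounded_operator ?R"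
      by (auto simp: res)
    obtain C where C: "\<And>f. f \<in> ell2 \<Longrightarrow> ell2_norm (?R f) \<le> C * ell2_norm f"
      using R unfolding ell2_bounded_operator_def by blast
    have "1 / (C\<^sup>2 + 1) * sq_norm u \<le> sq_norm (shifted_jacobi z \<omega> u)" if u: "u \<in> ell2" for u
    proof -
      have "ell2_norm u \<le> C * ell2_norm (shifted_jacobi z \<omega> u)"
        using C[OF shifted_jacobi_ell2[OF \<omega> u, of z]] bij_betw_inv_into_left[OF bij u] by simp
      then have "(ell2_norm u)\<^sup>2 \<le> (C * ell2_norm (shifted_jacobi z \<omega> u))\<^sup>2"
        by (intro power_mono) (simp_all add: ell2_norm_def sq_norm_nonneg)
      then have "sq_norm u \<le> C\<^sup>2 * sq_norm (shifted_jacobi z \<omega> u)"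
        by (simp add: ell2_norm_def power_mult_distrib sq_norm_nonneg)
      then have "sq_norm u \<le> (C\<^sup>2 + 1) * sq_norm (shifted_jacobi z \<omega> u)"
        using sq_norm_nonneg[of "shifted_jacobi z \<omega> u"] by (simp add: algebra_simps)
      moreover have "C\<^sup>2 + 1 > 0"
        by (simp add: add_nonneg_pos)
      ultimately show ?thesis by (simp add: field_simps)
    qed
    moreover have "1 / (C\<^sup>2 + 1) > 0"
      by (simp add: add_nonneg_pos)
    ultimately show "bounded_below z \<omega>"
      unfolding bounded_below_def by blast
  next
    assume below: "bounded_below z \<omega>"
    then obtain c where c: "c > 0" "\<And>u. u \<in> ell2 \<Longrightarrow> c * sq_norm u \<le> sq_norm (shifted_jacobi z \<omega> u)"
      unfolding bounded_below_def by blast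
    have add: "shifted_jacobi z \<omega> (\<lambda>n. u n + v n) = (\<lambda>n. shifted_jacobi z \<omega> u n + shifted_jacobi z \<omega> v n)" for u v
      by (simp add: shifted_jacobi_eq fun_eq_iff matrix_vector_right_distrib vector_add_ldistrib algebra_simps)
    have scale: "shifted_jacobi z \<omega> (\<lambda>n. a *s u n) = (\<lambda>n. a *s shifted_jacobi z \<omega> u n)" for a u
      by (simp add: shifted_jacobi_eq fun_eq_iff vec.scale vec.scale_right_distrib vec.scale_right_diff_distrib
          vector_smult_assoc mult.commute)
    have inj: "u = v" if "u \<in> ell2" "v \<in> ell2" "shifted_jacobi z \<omega> u = shifted_jacobi z \<omega> v" for u v
    proof -
      let ?w = "\<lambda>n. u n + (- 1) *s v n"
      have w: "?w \<in> ell2"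
        by (intro ell2_add(1) ell2_scale that)
      have "shifted_jacobi z \<omega> ?w = (\<lambda>n. 0)"
        unfolding add scale that(3) by (simp add: vec_eq_iff)
      then have "c * sq_norm ?w \<le> 0"
        using c(2)[OF w] by simp
      then have "sq_norm ?w \<le> 0"
        using c(1) by (simp add: mult_le_0_iff)
      then have "norm (?w n) = 0" for n
        using norm_le_ell2_norm[OF w, of n] sq_norm_nonneg[of ?w] by (simp add: ell2_norm_def)
      then show ?thesis by (simp add: fun_eq_iff vec_eq_iff)
    qed
    have bij: "bij_betw (shifted_jacobi z \<omega>) ell2 ell2"
    proof (rule bij_betwI')
      show "\<exists>u\<in>ell2. f = shifted_jacobi z \<omega> u" if "f \<in> ell2" for f
        using bounded_below_surjective[OF \<omega> below that] by metis
    qed (use inj shifted_jacobi_ell2[OF \<omega>] in auto)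
    have R: "?R f \<in> ell2" "shifted_jacobi z \<omega> (?R f) = f" if "f \<in> ell2" for f
      using bij_betw_inv_into_right[OF bij that] bij_betwE[OF bij_betw_inv_into[OF bij]] that by auto
    have R_eq: "?R f = u" if "u \<in> ell2" "shifted_jacobi z \<omega> u = f" for u f
      using that bij_betw_inv_into_left[OF bij] by blast
    have "ell2_norm (?R f) \<le> sqrt (1 / c) * ell2_norm f" if "f \<in> ell2" for f
    proof -
      have "sq_norm (?R f) \<le> 1 / c * sq_norm f"
        using c(2)[OF R(1)[OF that]] c(1) R(2)[OF that] by (simp add: field_simps)
      then show ?thesis
        unfolding ell2_norm_def real_sqrt_mult[symmetric] by (rule real_sqrt_le_mono)
    qed
    moreover have "?R (\<lambda>n. f n + g n) = (\<lambda>n. ?R f n + ?R g n)" if "f \<in> ell2" "g \<in> ell2" for f g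
      using that by (intro R_eq) (auto simp: add R intro!: ell2_add)
    moreover have "?R (\<lambda>n. a *s f n) = (\<lambda>n. a *s ?R f n)" if "f \<in> ell2" for f a
      using that by (intro R_eq) (auto simp: scale R intro!: ell2_scale)
    ultimately have "ell2_bounded_operator ?R"
      unfolding ell2_bounded_operator_def using R(1) by blast
    then show "z \<in> resolvent_set (jacobi_operator \<Omega> T D V \<omega>)"
      using bij by (simp add: res)
  qed
qed

end

section \<open>Uniform growth bounds the operator from below\<close>

context compact_SL_cocycle
begin

text \<open>How far a forced orbit drifts from the unforced one in \<open>N\<close> steps; only the forcing terms that act in
  between contribute, each amplified by a bounded factor. Drift into the past is obtained from this
  one by starting \<open>N\<close> steps earlier.\<close>

lemma forced_orbit_error:
  obtains K where "K \<ge> 0"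
    "\<And>\<omega> w g n. \<omega> \<in> \<Omega> \<Longrightarrow> (\<And>n. w (n + 1) = A (iter n \<omega>) *v w n + g n) \<Longrightarrow>
      norm (w (n + int N) - Aiter (int N) (iter n \<omega>) *v w n) \<le> K * (\<Sum>i\<in>{0..int N}. norm (g (n + i)))"
proof -
  obtain M where M: "M \<ge> 1" "\<And>\<omega> x. \<omega> \<in> \<Omega> \<Longrightarrow> norm (A \<omega> *v x) \<le> M * norm x"
    using uniform_matrix_bound[OF compact continuous_A] by blast
  define G where "G g n k = (\<Sum>i\<in>{0..int k}. norm (g (n + i)))" for g :: "int \<Rightarrow> complex^'n" and n k
  have G_Suc: "G g n (Suc k) = G g n k + norm (g (n + int (Suc k)))" for g n k
  proof -
    have "{0..int (Suc k)} = insert (int (Suc k)) {0..int k}" by auto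
    then show ?thesis by (simp add: G_def)
  qed
  have G_ge: "norm (g (n + int k)) \<le> G g n k" for g n k
    unfolding G_def by (intro member_le_sum) auto
  have G_nonneg: "0 \<le> G g n k" for g n k
    unfolding G_def by (intro sum_nonneg) auto
  have "\<exists>K\<ge>0. \<forall>\<omega>\<in>\<Omega>. \<forall>w g n. (\<forall>n. w (n + 1) = A (iter n \<omega>) *v w n + g n) \<longrightarrow>
      norm (w (n + int N) - Aiter (int N) (iter n \<omega>) *v w n) \<le> K * G g n N"
  proof (induction N)
    case 0
    show ?case by (intro exI[of _ 0]) simp
  next
    case (Suc N)
    then obtain K where K: "K \<ge> 0" "\<And>\<omega> w g n. \<omega> \<in> \<Omega> \<Longrightarrow> \<forall>n. w (n + 1) = A (iter n \<omega>) *v w n + g n \<Longrightarrow>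
      norm (w (n + int N) - Aiter (int N) (iter n \<omega>) *v w n) \<le> K * G g n N"
      by blast
    show ?case
    proof (intro exI[of _ "M * K + 1"] conjI ballI allI impI)
      show "0 \<le> M * K + 1" using M(1) K(1) by simp
      fix \<omega> w g n assume \<omega>: "\<omega> \<in> \<Omega>" and rec: "\<forall>n. w (n + 1) = A (iter n \<omega>) *v w n + g n"
      let ?e = "w (n + int N) - Aiter (int N) (iter n \<omega>) *v w n"
      have idx: "n + int (Suc N) = n + int N + 1" "int (Suc N) = int N + 1" by auto
      have "iter (int N) (iter n \<omega>) = iter (n + int N) \<omega>"
        using iter_add[OF \<omega>, of "int N" n] by (simp add: add.commute)
      then have "w (n + int (Suc N)) - Aiter (int (Suc N)) (iter n \<omega>) *v w n
          = A (iter (n + int N) \<omega>) *v ?e + g (n + int N)"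
        using rec[rule_format, of "n + int N"] Aiter_Suc[of "iter n \<omega>" "int N"] \<omega>
        by (simp add: matrix_vector_mult_diff_distrib matrix_vector_mul_assoc idx(1) idx(2) del: of_nat_Suc flip: add.assoc)
      then have "norm (w (n + int (Suc N)) - Aiter (int (Suc N)) (iter n \<omega>) *v w n)
          \<le> norm (A (iter (n + int N) \<omega>) *v ?e) + norm (g (n + int N))"
        by (simp add: norm_triangle_ineq)
      also have "\<dots> \<le> M * norm ?e + G g n N"
        using M(2) \<omega> G_ge by (intro add_mono) auto
      also have "\<dots> \<le> M * (K * G g n N) + G g n N"
        using K(2)[OF \<omega> rec, of n] M(1) by (intro add_mono mult_left_mono) auto
      also have "\<dots> = (M * K + 1) * G g n N"
        by (simp add: algebra_simps)
      also have "\<dots> \<le> (M * K + 1) * G g n (Suc N)"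
        using M(1) K(1) by (intro mult_left_mono) (auto simp: G_Suc)
      finally show "norm (w (n + int (Suc N)) - Aiter (int (Suc N)) (iter n \<omega>) *v w n)
          \<le> (M * K + 1) * G g n (Suc N)" .
    qed
  qed
  then show thesis
    using that unfolding G_def by blast
qed

text \<open>The recursion \<open>w\<^sub>n\<^sub>+\<^sub>1 = A w\<^sub>n + g\<^sub>n\<close> has the a priori estimate \<open>\<parallel>w\<parallel>\<^sup>2 \<le> K \<parallel>g\<parallel>\<^sup>2\<close>. If every
  vector is expanded fourfold by \<open>A\<^sub>N\<close> or by \<open>A\<^sub>-\<^sub>N\<close>, then \<open>16 \<bar>w\<^sub>n\<bar>\<^sup>2\<close> is at most \<open>3 \<bar>w\<^sub>n\<^sub>+\<^sub>N\<bar>\<^sup>2 + 3 \<bar>w\<^sub>n\<^sub>-\<^sub>N\<bar>\<^sup>2\<close> plus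
  forcing, and after summation the coefficients \<open>16 > 3 + 3\<close> decide.\<close>

lemma UG_forced_bound:
  assumes UG: "(T, A) \<in> UG \<Omega>"
  obtains K where "K \<ge> 0"
    "\<And>\<omega> w g. \<omega> \<in> \<Omega> \<Longrightarrow> w \<in> ell2 \<Longrightarrow> g \<in> ell2 \<Longrightarrow> (\<And>n. w (n + 1) = A (iter n \<omega>) *v w n + g n) \<Longrightarrow>
      sq_norm w \<le> K * sq_norm g"
proof -
  obtain \<beta> r :: real where \<beta>: "\<beta> > 0" and r: "r > 1" and growth: "\<And>\<omega> v. \<omega> \<in> \<Omega> \<Longrightarrow> v \<noteq> 0 \<Longrightarrow>
      (\<forall>n\<ge>1. norm (Aiter (int n) \<omega> *v v) \<ge> \<beta> * r ^ n * norm v) \<or>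
      (\<forall>n\<ge>1. norm (Aiter (- int n) \<omega> *v v) \<ge> \<beta> * r ^ n * norm v)"
    using UG unfolding UG_def by auto
  obtain N0 where "4 / \<beta> < r ^ N0"
    using real_arch_pow[OF r] by blast
  moreover have "r ^ N0 \<le> r ^ Suc N0"
    using r by (intro power_increasing) auto
  ultimately obtain N where N: "N \<ge> 1" "4 \<le> \<beta> * r ^ N"
    using \<beta> that[of 0] by (metis One_nat_def Suc_le_mono divide_less_eq less_eq_real_def less_le_trans mult.commute zero_le)
  have four: "4 * norm v \<le> norm (Aiter (int N) \<omega> *v v) + norm (Aiter (- int N) \<omega> *v v)" if "\<omega> \<in> \<Omega>" for \<omega> v
  proof (cases "v = 0")
    case False
    have "4 * norm v \<le> \<beta> * r ^ N * norm v"
      using N by (intro mult_right_mono) auto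
    moreover have "\<beta> * r ^ N * norm v \<le> norm (Aiter (int N) \<omega> *v v) \<or> \<beta> * r ^ N * norm v \<le> norm (Aiter (- int N) \<omega> *v v)"
      using growth[OF that False] N(1) by blast
    ultimately show ?thesis
      using norm_ge_zero[of "Aiter (int N) \<omega> *v v"] norm_ge_zero[of "Aiter (- int N) \<omega> *v v"] by linarith
  qed simp
  obtain K where K: "K \<ge> 0"
    "\<And>\<omega> w g n. \<omega> \<in> \<Omega> \<Longrightarrow> (\<And>n. w (n + 1) = A (iter n \<omega>) *v w n + g n) \<Longrightarrow>
      norm (w (n + int N) - Aiter (int N) (iter n \<omega>) *v w n) \<le> K * (\<Sum>i\<in>{0..int N}. norm (g (n + i)))"
    using forced_orbit_error[of N] by blast
  obtain M where M: "M \<ge> 1" "\<And>n \<omega> v. \<bar>n\<bar> \<le> int N \<Longrightarrow> \<omega> \<in> \<Omega> \<Longrightarrow> norm (Aiter n \<omega> *v v) \<le> M * norm v"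
    using uniform_Aiter_bound[of N] by blast
  define I where "I = {- int N..int N}"
  define L where "L = K + M * K"
  have L: "L \<ge> 0" using K(1) M(1) by (simp add: L_def)
  let ?c = "12 * L\<^sup>2 * (real (card I))\<^sup>2 / 10"
  show thesis
  proof (rule that[of ?c])
    show "0 \<le> ?c" by simp
    fix \<omega> w g assume \<omega>: "\<omega> \<in> \<Omega>" and w: "w \<in> ell2" and g: "g \<in> ell2"
      and rec: "\<And>n. w (n + 1) = A (iter n \<omega>) *v w n + g n"
    define G where "G n = (\<Sum>i\<in>I. norm (g (n + i)))" for n
    have fwd: "norm (w (n + int N) - Aiter (int N) (iter n \<omega>) *v w n) \<le> K * G n" for n
    proof -
      have "(\<Sum>i\<in>{0..int N}. norm (g (n + i))) \<le> G n"
        unfolding G_def I_def by (intro sum_mono2) auto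
      then show ?thesis
        using K(2)[of \<omega> w g n, OF \<omega> rec] K(1) by (meson mult_left_mono order_trans)
    qed
    have bwd: "norm (w (n - int N) - Aiter (- int N) (iter n \<omega>) *v w n) \<le> M * K * G n" for n
    proof -
      let ?\<theta> = "iter (n - int N) \<omega>"
      have \<theta>: "?\<theta> \<in> \<Omega>" "iter (int N) ?\<theta> = iter n \<omega>"
        using \<omega> iter_add[OF \<omega>, of "int N" "n - int N"] by auto
      have "(\<Sum>i\<in>{0..int N}. norm (g (n - int N + i))) = (\<Sum>i\<in>{- int N..0}. norm (g (n + i)))"
        by (rule sum.reindex_bij_witness[of _ "\<lambda>i. i + int N" "\<lambda>i. i - int N"]) (auto simp: algebra_simps)
      also have "\<dots> \<le> G n"
        unfolding G_def I_def by (intro sum_mono2) auto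
      finally have "norm (w n - Aiter (int N) ?\<theta> *v w (n - int N)) \<le> K * G n"
        using K(2)[of \<omega> w g "n - int N", OF \<omega> rec] K(1) by (simp add: mult_left_mono order_trans)
      moreover have "Aiter (- int N) (iter n \<omega>) *v (w n - Aiter (int N) ?\<theta> *v w (n - int N))
          = Aiter (- int N) (iter n \<omega>) *v w n - w (n - int N)"
        using Aiter_uminus(1)[OF \<theta>(1), of "int N"] \<theta>(2) by (simp add: matrix_vector_mult_diff_distrib)
      moreover have "norm (Aiter (- int N) (iter n \<omega>) *v e) \<le> M * (K * G n)" if "norm e \<le> K * G n" for e
      proof -
        have "norm (Aiter (- int N) (iter n \<omega>) *v e) \<le> M * norm e"
          using M(2) \<omega> by simp
        also have "\<dots> \<le> M * (K * G n)"
          using that M(1) by (intro mult_left_mono) auto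
        finally show ?thesis .
      qed
      ultimately have "norm (Aiter (- int N) (iter n \<omega>) *v w n - w (n - int N)) \<le> M * (K * G n)"
        by metis
      then show ?thesis by (simp add: norm_minus_commute mult.assoc)
    qed
    have point: "16 * (norm (w n))\<^sup>2 \<le> 3 * (norm (w (n + int N)))\<^sup>2 + 3 * (norm (w (n + (- int N))))\<^sup>2 + 3 * L\<^sup>2 * (G n)\<^sup>2" for n
    proof -
      have "norm (Aiter (int N) (iter n \<omega>) *v w n) \<le> norm (w (n + int N)) + K * G n"
        "norm (Aiter (- int N) (iter n \<omega>) *v w n) \<le> norm (w (n - int N)) + M * K * G n"
        using fwd[of n] bwd[of n]
          norm_triangle_sub[of "Aiter (int N) (iter n \<omega>) *v w n" "w (n + int N)"]
          norm_triangle_sub[of "Aiter (- int N) (iter n \<omega>) *v w n" "w (n - int N)"]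
        by (simp_all add: norm_minus_commute)
      then have "4 * norm (w n) \<le> norm (w (n + int N)) + norm (w (n - int N)) + L * G n"
        using four[of "iter n \<omega>" "w n"] \<omega> by (simp add: L_def algebra_simps)
      then have "(4 * norm (w n))\<^sup>2 \<le> (norm (w (n + int N)) + norm (w (n - int N)) + L * G n)\<^sup>2"
        by (intro power_mono) auto
      also have "\<dots> \<le> 3 * (norm (w (n + int N)))\<^sup>2 + 3 * (norm (w (n - int N)))\<^sup>2 + 3 * (L * G n)\<^sup>2"
      proof -
        have "(x + y + t)\<^sup>2 \<le> 3 * x\<^sup>2 + 3 * y\<^sup>2 + 3 * t\<^sup>2" for x y t :: real
        proof -
          have "0 \<le> (x - y)\<^sup>2 + (y - t)\<^sup>2 + (x - t)\<^sup>2" by simp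
          then show ?thesis by (simp add: power2_eq_square algebra_simps)
        qed
        then show ?thesis .
      qed
      finally show ?thesis by (simp add: power_mult_distrib mult.assoc)
    qed
    have G_sq: "(G n)\<^sup>2 \<le> real (card I) * (\<Sum>i\<in>I. (norm (g (n + i)))\<^sup>2)" for n
      unfolding G_def using sum_squared_le_sum_of_squares[of "\<lambda>i. norm (g (n + i))" I] by (simp add: mult.commute)
    have gs: "(\<lambda>n. (norm (g (n + i)))\<^sup>2) summable_on UNIV" for i
      using ell2D[OF ell2_shift[OF g]] .
    have ws: "(\<lambda>n. (norm (w (n + i)))\<^sup>2) summable_on UNIV" for i
      using ell2D[OF ell2_shift[OF w]] .
    define R where "R n = (\<Sum>i\<in>I. (norm (g (n + i)))\<^sup>2)" for n
    have R: "R summable_on UNIV" "infsum R UNIV = real (card I) * sq_norm g"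
    proof -
      have fin: "finite I" by (simp add: I_def)
      show "R summable_on UNIV"
        unfolding R_def using infsum_sum_finite(1)[OF fin, of "\<lambda>i n. (norm (g (n + i)))\<^sup>2"] gs by blast
      have "infsum R UNIV = (\<Sum>i\<in>I. \<Sum>\<^sub>\<infinity>n. (norm (g (n + i)))\<^sup>2)"
        unfolding R_def using infsum_sum_finite(2)[OF fin, of "\<lambda>i n. (norm (g (n + i)))\<^sup>2"] gs by blast
      then show "infsum R UNIV = real (card I) * sq_norm g"
        using infsum_shift[of "\<lambda>n. (norm (g n))\<^sup>2"] by simp
    qed
    let ?a = "\<lambda>n. 3 * (norm (w (n + int N)))\<^sup>2" and ?b = "\<lambda>n. 3 * (norm (w (n + (- int N))))\<^sup>2"
      and ?r = "\<lambda>n. 3 * L\<^sup>2 * real (card I) * R n"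
    have le: "16 * (norm (w n))\<^sup>2 \<le> (?a n + ?b n) + ?r n" for n
    proof -
      have "3 * L\<^sup>2 * (G n)\<^sup>2 \<le> 3 * L\<^sup>2 * (real (card I) * R n)"
        using G_sq[of n] unfolding R_def by (intro mult_left_mono) auto
      then show ?thesis using point[of n] by (simp add: mult.assoc)
    qed
    have sa: "?a summable_on UNIV" and sb: "?b summable_on UNIV" and sr: "?r summable_on UNIV"
      by (intro summable_on_cmult_right ws R(1))+
    have "16 * sq_norm w \<le> infsum (\<lambda>n. (?a n + ?b n) + ?r n) UNIV"
      using summable_dominated(2)[OF summable_on_add[OF summable_on_add[OF sa sb] sr] _ le]
      by (simp add: infsum_cmult_right')
    also have "\<dots> = (3 * sq_norm w + 3 * sq_norm w) + 3 * L\<^sup>2 * real (card I) * (real (card I) * sq_norm g)"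
      using infsum_add[OF summable_on_add[OF sa sb] sr] infsum_add[OF sa sb]
        infsum_shift[of "\<lambda>n. (norm (w n))\<^sup>2" "int N"] infsum_shift[of "\<lambda>n. (norm (w n))\<^sup>2" "- int N"] R(2)
      by (simp only: infsum_cmult_right')
    finally show "sq_norm w \<le> ?c * sq_norm g"
      using mult_nonneg_nonneg[OF mult_nonneg_nonneg[of "L\<^sup>2" "(real (card I))\<^sup>2"] sq_norm_nonneg[of g]]
      by (simp add: power2_eq_square algebra_simps)
  qed
qed

end

locale jacobi_energy = jacobi \<Omega> T D V
  for \<Omega> :: "'a::metric_space set" and T :: "'a \<Rightarrow> 'a" and D V :: "'a \<Rightarrow> real^'l^'l" +
  fixes z :: complex
begin

lemma jacobi_SL_cocycle: "SL_cocycle \<Omega> T (jacobi_cocycle T D V z)"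
  unfolding SL_cocycle_def
proof (intro conjI ballI)
  show "self_homeomorphism \<Omega> T" by (rule homeo)
  have T_cont: "continuous_on \<Omega> T"
    using continuous_on_iter[of 1] by (simp cong: continuous_on_cong)
  have DT: "continuous_on \<Omega> (\<lambda>\<omega>. D (T \<omega>))" and VT: "continuous_on \<Omega> (\<lambda>\<omega>. V (T \<omega>))"
    by (auto intro!: continuous_on_compose2[OF D_cont T_cont] continuous_on_compose2[OF V_cont T_cont])
  have inv: "continuous_on \<Omega> (\<lambda>\<omega>. cmatrix (matrix_inv (D (T \<omega>))))"
    by (intro continuous_on_cmatrix continuous_on_matrix_inv DT D_inv T_in)
  show "continuous_on \<Omega> (jacobi_cocycle T D V z)"
    unfolding jacobi_cocycle_def
    by (intro continuous_on_block_matrix continuous_on_matrix_mult continuous_intros inv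
        continuous_on_cmatrix DT VT)
  show "det (jacobi_cocycle T D V z \<omega>) = 1" if "\<omega> \<in> \<Omega>" for \<omega>
    unfolding jacobi_cocycle_def
    using D_inverse[OF T_in[OF that]] by (intro det_block_zero_corner) auto
qed

end

sublocale jacobi_energy \<subseteq> compact_SL_cocycle \<Omega> T "jacobi_cocycle T D V z"
  using compact jacobi_SL_cocycle by unfold_locales

context jacobi_energy
begin

abbreviation "J \<equiv> jacobi_cocycle T D V z"

text \<open>The second component carries the matrix \<open>D\<close> so that the transfer matrices have determinant one.
  The vector at time \<open>n\<close> lives over the base point \<open>iter (n - 1) \<omega>\<close>.\<close>

definition phase :: "'a \<Rightarrow> (int \<Rightarrow> complex^'l) \<Rightarrow> int \<Rightarrow> complex^('l + 'l)" where
  "phase \<omega> u n = vec_pair (u n) (cmatrix (D (iter (n - 1) \<omega>)) *v u (n - 1))"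

text \<open>The jump of the phase vector caused by a source \<open>y\<close> sitting at the base point \<open>\<omega>\<close>.\<close>

definition kick :: "'a \<Rightarrow> complex^'l \<Rightarrow> complex^('l + 'l)" where
  "kick \<omega> y = vec_pair (cmatrix (matrix_inv (D \<omega>)) *v y) 0"

lemma J_vec_pair:
  assumes "\<omega> \<in> \<Omega>"
  shows "J (iter (n - 1) \<omega>) *v vec_pair x y =
    vec_pair (cmatrix (matrix_inv (D (iter n \<omega>))) *v (z *s x - cmatrix (V (iter n \<omega>)) *v x - y))
      (cmatrix (D (iter n \<omega>)) *v x)"
proof -
  have "T (iter (n - 1) \<omega>) = iter n \<omega>"
    using iter_Suc[OF assms, of "n - 1"] by simp
  then show ?thesis
    by (simp add: jacobi_cocycle_def block_matrix_vec_pair matrix_vector_mult_diff_distrib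
        matrix_vector_mult_diff_rdistrib mat_mult_vec matrix_vector_mult_uminus flip: matrix_vector_mul_assoc)
qed

lemma phase_Suc:
  assumes \<omega>: "\<omega> \<in> \<Omega>"
  shows "phase \<omega> u (n + 1) = J (iter (n - 1) \<omega>) *v phase \<omega> u n + kick (iter n \<omega>) (shifted_jacobi z \<omega> u n)"
proof -
  let ?D = "cmatrix (D (iter n \<omega>))" and ?E = "cmatrix (matrix_inv (D (iter n \<omega>)))"
  let ?rest = "z *s u n - cmatrix (V (iter n \<omega>)) *v u n - cmatrix (D (iter (n - 1) \<omega>)) *v u (n - 1)"
  have "?rest + shifted_jacobi z \<omega> u n = ?D *v u (n + 1)"
    by (simp add: shifted_jacobi_eq)
  then have "?E *v ?rest + ?E *v shifted_jacobi z \<omega> u n = u (n + 1)"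
    using D_inverse_vec(2)[OF iter_in[OF \<omega>], of n "u (n + 1)"] by (metis matrix_vector_right_distrib)
  then show ?thesis
    unfolding phase_def kick_def J_vec_pair[OF \<omega>] vec_pair_add by simp
qed

text \<open>The second component of an orbit is forced to be \<open>D\<close> times the preceding first component, so every
  orbit of the cocycle comes from a solution of \<open>H u = z u\<close>.\<close>

lemma orbit_is_phase:
  assumes \<omega>: "\<omega> \<in> \<Omega>" and orbit: "\<And>n. x (n + 1) = J (iter (n - 1) \<omega>) *v x n"
  obtains u where "\<And>n. x n = phase \<omega> u n" "\<And>n. shifted_jacobi z \<omega> u n = 0"
proof -
  have "\<exists>a b. x n = vec_pair a b" for n
    using vec_pair_cases by blast
  then obtain u p where xup: "\<And>n. x n = vec_pair (u n) (p n)"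
    by metis
  have p: "p (n + 1) = cmatrix (D (iter n \<omega>)) *v u n" for n
    using orbit[of n] unfolding xup J_vec_pair[OF \<omega>] by simp
  have x: "x n = phase \<omega> u n" for n
    using p[of "n - 1"] by (simp add: xup phase_def)
  have "shifted_jacobi z \<omega> u n = 0" for n
  proof -
    have "kick (iter n \<omega>) (shifted_jacobi z \<omega> u n) = 0"
      using phase_Suc[OF \<omega>, of u n] orbit[of n] by (simp flip: x)
    then have "cmatrix (matrix_inv (D (iter n \<omega>))) *v shifted_jacobi z \<omega> u n = 0"
      unfolding kick_def by (metis vec_pair_0 vec_pair_eq_iff)
    then show ?thesis
      using D_inverse_vec(1)[OF iter_in[OF \<omega>]] by (metis matrix_vector_mult_0_right)
  qed
  with x show thesis using that by blast
qed

lemma phase_ell2: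
  assumes \<omega>: "\<omega> \<in> \<Omega>" and u: "u \<in> ell2"
  shows "phase \<omega> u \<in> ell2" "sq_norm u \<le> sq_norm (phase \<omega> u)"
proof -
  obtain M where M: "M \<ge> 1" "\<And>\<omega> x. \<omega> \<in> \<Omega> \<Longrightarrow> norm (cmatrix (D \<omega>) *v x) \<le> M * norm x"
    using coefficient_bound by blast
  let ?a = "\<lambda>n. vec_pair (u n) 0" and ?b = "\<lambda>n. vec_pair 0 (cmatrix (D (iter (n - 1) \<omega>)) *v u (n - 1))"
  have n0: "norm (vec_pair x 0) = norm x" "norm (vec_pair 0 x) = norm x" for x :: "complex^'l"
    using norm_vec_pair[of x 0] norm_vec_pair[of 0 x] by simp_all
  have a: "?a \<in> ell2"
    by (rule ell2_dominated(1)[OF u, of _ 1]) (simp add: n0)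
  have b: "?b \<in> ell2"
    by (rule ell2_dominated(1)[OF ell2_shift[OF u, of "-1"], of _ M]) (use M \<omega> in \<open>simp add: n0\<close>)
  have "phase \<omega> u = (\<lambda>n. ?a n + ?b n)"
    by (simp add: fun_eq_iff phase_def vec_pair_add)
  then show w: "phase \<omega> u \<in> ell2"
    using ell2_add(1)[OF a b] by simp
  show "sq_norm u \<le> sq_norm (phase \<omega> u)"
    using ell2_dominated(2)[OF w, of u 1] by (simp add: phase_def norm_vec_pair_ge)
qed

lemma kick_ell2:
  obtains M where "M \<ge> 1"
    "\<And>\<omega> h. \<omega> \<in> \<Omega> \<Longrightarrow> h \<in> ell2 \<Longrightarrow> (\<lambda>n. kick (iter n \<omega>) (h n)) \<in> ell2 \<and>
       sq_norm (\<lambda>n. kick (iter n \<omega>) (h n)) \<le> M\<^sup>2 * sq_norm h"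
proof -
  obtain M where M: "M \<ge> 1" "\<And>\<omega> x. \<omega> \<in> \<Omega> \<Longrightarrow> norm (cmatrix (matrix_inv (D \<omega>)) *v x) \<le> M * norm x"
    using coefficient_bound by blast
  have "norm (kick (iter n \<omega>) y) \<le> M * norm y" if "\<omega> \<in> \<Omega>" for \<omega> n y
    using M(2)[OF iter_in[OF that], of n y] norm_vec_pair[of "cmatrix (matrix_inv (D (iter n \<omega>))) *v y" 0]
    by (simp add: kick_def)
  then have "(\<lambda>n. kick (iter n \<omega>) (h n)) \<in> ell2 \<and>
       sq_norm (\<lambda>n. kick (iter n \<omega>) (h n)) \<le> M\<^sup>2 * sq_norm h" if "\<omega> \<in> \<Omega>" "h \<in> ell2" for \<omega> and h :: "int \<Rightarrow> complex^'l"
    using ell2_dominated[OF that(2), of "\<lambda>n. kick (iter n \<omega>) (h n)" M] that(1) by blast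
  then show thesis using that[of M] M(1) by blast
qed

text \<open>The source \<open>(H\<^sub>\<omega> - z) u\<close> enters the recursion for the phase vectors as forcing.\<close>

lemma UG_imp_bounded_below:
  assumes UG: "(T, J) \<in> UG \<Omega>" and \<omega>: "\<omega> \<in> \<Omega>"
  shows "bounded_below z \<omega>"
proof -
  obtain K where K: "K \<ge> 0"
    "\<And>\<omega> w g. \<omega> \<in> \<Omega> \<Longrightarrow> w \<in> ell2 \<Longrightarrow> g \<in> ell2 \<Longrightarrow> (\<And>n. w (n + 1) = J (iter n \<omega>) *v w n + g n) \<Longrightarrow>
      sq_norm w \<le> K * sq_norm g"
    using UG_forced_bound[OF UG] by blast
  obtain M where M: "M \<ge> 1"
    "\<And>\<omega> h. \<omega> \<in> \<Omega> \<Longrightarrow> h \<in> ell2 \<Longrightarrow> (\<lambda>n. kick (iter n \<omega>) (h n)) \<in> ell2 \<and>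
       sq_norm (\<lambda>n. kick (iter n \<omega>) (h n)) \<le> M\<^sup>2 * sq_norm h"
    using kick_ell2 by blast
  have pos: "K * M\<^sup>2 + 1 > 0"
    using K(1) by (simp add: add_nonneg_pos)
  have "1 / (K * M\<^sup>2 + 1) * sq_norm u \<le> sq_norm (shifted_jacobi z \<omega> u)" if u: "u \<in> ell2" for u
  proof -
    let ?g = "\<lambda>n. kick (iter n \<omega>) (shifted_jacobi z \<omega> u n)"
    have g: "?g \<in> ell2" "sq_norm ?g \<le> M\<^sup>2 * sq_norm (shifted_jacobi z \<omega> u)"
      using M(2)[OF \<omega> shifted_jacobi_ell2[OF \<omega> u]] by auto
    have "iter n (iter (- 1) \<omega>) = iter (n - 1) \<omega>" for n
      using iter_add[OF \<omega>, of n "-1"] by simp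
    then have "sq_norm (phase \<omega> u) \<le> K * sq_norm ?g"
      using phase_Suc[OF \<omega>, of u] by (intro K(2)[of "iter (- 1) \<omega>"] iter_in phase_ell2 \<omega> u g) simp
    also have "\<dots> \<le> K * (M\<^sup>2 * sq_norm (shifted_jacobi z \<omega> u))"
      using g(2) K(1) by (rule mult_left_mono)
    finally have "sq_norm u \<le> (K * M\<^sup>2 + 1) * sq_norm (shifted_jacobi z \<omega> u)"
      using phase_ell2(2)[OF \<omega> u] sq_norm_nonneg[of "shifted_jacobi z \<omega> u"] by (simp add: algebra_simps)
    then show ?thesis
      using pos by (simp add: field_simps)
  qed
  then show ?thesis
    unfolding bounded_below_def using pos by (intro exI[of _ "1 / (K * M\<^sup>2 + 1)"]) auto
qed

end

section \<open>A lower bound for the operator forces uniform growth\<close>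

text \<open>Let \<open>S\<^sub>L\<close> be the sum of \<open>a\<close> over the window from \<open>-L\<close> to \<open>L\<close>. Its increments are the end values, so the
  hypothesis reads \<open>S\<^sub>L \<le> C (S\<^sub>L - S\<^sub>L\<^sub>-\<^sub>1)\<close> and \<open>S\<^sub>L\<close> grows exponentially. If \<open>a\<close> is small at \<open>-p\<close>, the left
  end can be frozen there: it accounts for at most half of the bound, and the sums keep growing when only
  the right end moves. The price is to replace \<open>C\<close> by \<open>2 C\<close>, which explains the rate.\<close>

lemma window_sums_grow_right:
  fixes a :: "int \<Rightarrow> real"
  assumes nonneg: "\<And>j. a j \<ge> 0" and C: "C \<ge> 1"
    and window: "\<And>m n. m \<le> n \<Longrightarrow> (\<Sum>j\<in>{m..n}. a j) \<le> C * (a m + a n)"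
  defines "\<mu> \<equiv> 2 * C / (2 * C - 1)"
  assumes pq: "1 \<le> p" "p \<le> q" and left: "2 * C * a (- int p) < \<mu> ^ p * a 0"
  shows "\<mu> ^ q * a 0 \<le> 2 * C * a (int q)"
proof -
  have \<mu>: "\<mu> > 0" "2 * C - 1 > 0"
    using C by (auto simp: \<mu>_def)
  define S where "S L = (\<Sum>j\<in>{- int L..int L}. a j)" for L
  have S_nonneg: "S L \<ge> 0" for L
    unfolding S_def by (intro sum_nonneg nonneg)
  have grow: "\<mu> * x \<le> y" if "(2 * C) * x \<le> (2 * C - 1) * y" for x y
    using that \<mu>(2) by (simp add: \<mu>_def field_simps)
  have S_Suc: "\<mu> * S L \<le> S (Suc L)" for L
  proof (rule grow)
    have "{- int (Suc L)..int (Suc L)} = insert (- int (Suc L)) (insert (int (Suc L)) {- int L..int L})"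
      by auto
    then have eq: "S (Suc L) = a (- int (Suc L)) + (a (int (Suc L)) + S L)"
      unfolding S_def by simp
    have "S (Suc L) \<le> C * (S (Suc L) - S L)"
      using window[of "- int (Suc L)" "int (Suc L)"] eq by (simp add: S_def add.commute)
    moreover have "C * S (Suc L) \<ge> C * S L"
      using eq nonneg[of "- int (Suc L)"] nonneg[of "int (Suc L)"] C by (intro mult_left_mono) auto
    ultimately show "(2 * C) * S L \<le> (2 * C - 1) * S (Suc L)"
      by (simp add: algebra_simps)
  qed
  have S_ge: "\<mu> ^ L * a 0 \<le> S L" for L
  proof (induction L)
    case (Suc L)
    then have "\<mu> * (\<mu> ^ L * a 0) \<le> \<mu> * S L"
      using \<mu> by (intro mult_left_mono) auto
    then show ?case using S_Suc[of L] by (simp add: mult.assoc)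
  qed (simp add: S_def)
  define F where "F j = (\<Sum>i\<in>{- int p..int j}. a i)" for j :: nat
  have "F p = S p"
    by (simp add: F_def S_def)
  have F_mono: "F p \<le> F j" if "p \<le> j" for j
    unfolding F_def using that nonneg by (intro sum_mono2) auto
  have F_le: "F j \<le> 2 * C * a (int j)" if "p \<le> j" for j
  proof -
    have "F j \<le> C * (a (- int p) + a (int j))"
      unfolding F_def using that by (intro window) auto
    moreover have "2 * C * a (- int p) \<le> F j"
      using left S_ge[of p] \<open>F p = S p\<close> F_mono[OF that] by simp
    ultimately show ?thesis by (simp add: algebra_simps)
  qed
  have "\<mu> ^ j * a 0 \<le> F j" if "p \<le> j" for j
    using that
  proof (induction j rule: dec_induct)
    case base
    then show ?case using S_ge[of p] \<open>F p = S p\<close> by simp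
  next
    case (step j)
    have "{- int p..int (Suc j)} = insert (int (Suc j)) {- int p..int j}"
      by auto
    then have "F (Suc j) = a (int (Suc j)) + F j"
      unfolding F_def by simp
    then have "\<mu> * F j \<le> F (Suc j)"
      using F_le[of "Suc j"] step by (intro grow) (simp add: algebra_simps)
    moreover have "\<mu> * (\<mu> ^ j * a 0) \<le> \<mu> * F j"
      using step \<mu> by (intro mult_left_mono) auto
    ultimately show ?case by (simp add: mult.assoc)
  qed
  then show ?thesis
    using F_le[of q] pq by force
qed

text \<open>Smallness at \<open>-p\<close> and at \<open>q\<close> is contradictory: if \<open>p \<le> q\<close> the values to the right of \<open>p\<close> are large,
  otherwise the reflected sequence has this property.\<close>

lemma window_sums_dichotomy:
  fixes a :: "int \<Rightarrow> real"
  assumes nonneg: "\<And>j. a j \<ge> 0" and C: "C \<ge> 1"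
    and window: "\<And>m n. m \<le> n \<Longrightarrow> (\<Sum>j\<in>{m..n}. a j) \<le> C * (a m + a n)"
  defines "\<mu> \<equiv> 2 * C / (2 * C - 1)"
  shows "(\<forall>n\<ge>1. \<mu> ^ n * a 0 \<le> 2 * C * a (int n)) \<or> (\<forall>n\<ge>1. \<mu> ^ n * a 0 \<le> 2 * C * a (- int n))"
proof (rule ccontr)
  assume "\<not> ?thesis"
  then obtain p q where p: "1 \<le> p" "2 * C * a (- int p) < \<mu> ^ p * a 0"
    and q: "1 \<le> q" "2 * C * a (int q) < \<mu> ^ q * a 0"
    by (auto simp: not_le)
  have reflect: "(\<Sum>j\<in>{m..n}. a (- j)) \<le> C * (a (- m) + a (- n))" if "m \<le> n" for m n
  proof -
    have "(\<Sum>j\<in>{m..n}. a (- j)) = (\<Sum>j\<in>{- n..- m}. a j)"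
      by (rule sum.reindex_bij_witness[of _ uminus uminus]) auto
    then show ?thesis
      using window[of "- n" "- m"] that by (simp add: add.commute)
  qed
  show False
  proof (cases "p \<le> q")
    case True
    then show False
      using window_sums_grow_right[OF nonneg C window p(1) True] p q unfolding \<mu>_def by force
  next
    case False
    then show False
      using window_sums_grow_right[of "\<lambda>j. a (- j)" C q p] nonneg C reflect p q
      unfolding \<mu>_def by force
  qed
qed

context jacobi
begin

lemma shifted_jacobi_iter: "\<omega> \<in> \<Omega> \<Longrightarrow> shifted_jacobi z (iter k \<omega>) u n = shifted_jacobi z \<omega> (\<lambda>j. u (j - k)) (n + k)"
  by (simp add: shifted_jacobi_eq algebra_simps flip: iter_add)

lemma continuous_on_Hz: "continuous_on \<Omega> (\<lambda>\<omega>. shifted_jacobi z \<omega> u n)"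
proof -
  have "continuous_on \<Omega> (\<lambda>\<omega>. cmatrix (F (iter j \<omega>)) *v x)" if "continuous_on \<Omega> F" for F :: "'a \<Rightarrow> real^'l^'l" and j x
    using continuous_on_compose2[OF that continuous_on_iter[of j]] iter_image
    by (intro continuous_on_matrix_vector_mult continuous_on_cmatrix continuous_on_const) auto
  then show ?thesis
    unfolding shifted_jacobi_eq using D_cont V_cont by (intro continuous_intros)
qed

text \<open>The inequality for a finitely supported sequence involves finitely many coefficients, so it is a closed
  condition on the base point. It holds along the orbit of \<open>\<omega>0\<close>, where a change of base point is a shift of the
  sequence, hence on the closure of that orbit.\<close>

lemma bounded_below_window:
  assumes minimal: "\<Omega> \<subseteq> closure (range (\<lambda>j. iter j \<omega>0))" and \<omega>0: "\<omega>0 \<in> \<Omega>"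
    and below: "bounded_below z \<omega>0"
  obtains c where "c > 0"
    "\<And>\<omega> u m n. \<omega> \<in> \<Omega> \<Longrightarrow> (\<And>j. j \<notin> {m..n} \<Longrightarrow> u j = 0) \<Longrightarrow>
      c * (\<Sum>j\<in>{m..n}. (norm (u j))\<^sup>2) \<le> (\<Sum>j\<in>{m-1..n+1}. (norm (shifted_jacobi z \<omega> u j))\<^sup>2)"
proof -
  obtain c where c: "c > 0" "\<And>u. u \<in> ell2 \<Longrightarrow> c * sq_norm u \<le> sq_norm (shifted_jacobi z \<omega>0 u)"
    using below unfolding bounded_below_def by blast
  have finsupp: "u \<in> ell2 \<and> sq_norm u = (\<Sum>j\<in>S. (norm (u j))\<^sup>2)"
    if "finite S" "\<And>j. j \<notin> S \<Longrightarrow> u j = 0" for S and u :: "int \<Rightarrow> complex^'l"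
  proof -
    have "((\<lambda>j. (norm (u j))\<^sup>2) has_sum (\<Sum>j\<in>S. (norm (u j))\<^sup>2)) UNIV"
      by (rule has_sum_cong_neutral[THEN iffD1, OF _ _ _ has_sum_finite[OF that(1)]]) (use that(2) in auto)
    then show ?thesis
      by (auto simp: ell2_def has_sum_iff)
  qed
  have at_\<omega>0: "c * (\<Sum>j\<in>{m..n}. (norm (u j))\<^sup>2) \<le> (\<Sum>j\<in>{m-1..n+1}. (norm (shifted_jacobi z \<omega>0 u j))\<^sup>2)"
    if u: "\<And>j. j \<notin> {m..n} \<Longrightarrow> u j = 0" for u m n
  proof -
    have "shifted_jacobi z \<omega>0 u j = 0" if "j \<notin> {m-1..n+1}" for j
    proof -
      have "u j = 0" "u (j - 1) = 0" "u (j + 1) = 0"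
        using that by (auto intro!: u)
      then show ?thesis by (simp add: shifted_jacobi_eq)
    qed
    then have "sq_norm (shifted_jacobi z \<omega>0 u) = (\<Sum>j\<in>{m-1..n+1}. (norm (shifted_jacobi z \<omega>0 u j))\<^sup>2)"
      using finsupp[of "{m-1..n+1}" "shifted_jacobi z \<omega>0 u"] by blast
    moreover have "u \<in> ell2" "sq_norm u = (\<Sum>j\<in>{m..n}. (norm (u j))\<^sup>2)"
      using finsupp[of "{m..n}" u] u by auto
    ultimately show ?thesis using c(2)[of u] by simp
  qed
  show thesis
  proof (rule that[OF c(1)])
    fix \<omega> m n and u :: "int \<Rightarrow> complex^'l"
    assume \<omega>: "\<omega> \<in> \<Omega>" and u: "\<And>j. j \<notin> {m..n} \<Longrightarrow> u j = 0"
    let ?f = "\<lambda>\<omega>. \<Sum>j\<in>{m-1..n+1}. (norm (shifted_jacobi z \<omega> u j))\<^sup>2"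
    let ?S = "{\<omega> \<in> \<Omega>. c * (\<Sum>j\<in>{m..n}. (norm (u j))\<^sup>2) \<le> ?f \<omega>}"
    have "closed ?S"
      using compact_imp_closed[OF compact]
      by (intro continuous_on_closed_Collect_le continuous_intros continuous_on_Hz)
    moreover have "iter k \<omega>0 \<in> ?S" for k
    proof -
      have "c * (\<Sum>j\<in>{m+k..n+k}. (norm (u (j - k)))\<^sup>2) \<le> (\<Sum>j\<in>{m+k-1..n+k+1}. (norm (shifted_jacobi z \<omega>0 (\<lambda>j. u (j - k)) j))\<^sup>2)"
        by (rule at_\<omega>0) (use u in auto)
      also have "(\<Sum>j\<in>{m+k..n+k}. (norm (u (j - k)))\<^sup>2) = (\<Sum>j\<in>{m..n}. (norm (u j))\<^sup>2)"
        by (rule sum.reindex_bij_witness[of _ "\<lambda>j. j + k" "\<lambda>j. j - k"]) auto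
      also have "(\<Sum>j\<in>{m+k-1..n+k+1}. (norm (shifted_jacobi z \<omega>0 (\<lambda>j. u (j - k)) j))\<^sup>2) = ?f (iter k \<omega>0)"
        by (rule sum.reindex_bij_witness[of _ "\<lambda>j. j + k" "\<lambda>j. j - k"]) (auto simp: shifted_jacobi_iter[OF \<omega>0])
      finally show ?thesis using \<omega>0 by simp
    qed
    ultimately have "closure (range (\<lambda>j. iter j \<omega>0)) \<subseteq> ?S"
      by (intro closure_minimal) auto
    then show "c * (\<Sum>j\<in>{m..n}. (norm (u j))\<^sup>2) \<le> ?f \<omega>"
      using minimal \<omega> by blast
  qed
qed

end

context jacobi_energy
begin

text \<open>Cutting a solution \<open>u\<close> off outside a window produces a sequence \<open>v\<close> for which \<open>(H\<^sub>\<omega> - z) v\<close> is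
  supported at the sites next to the two ends and controlled by the phase vectors there. The lower bound then
  controls all of \<open>u\<close> in the window.\<close>

lemma solution_window_sum:
  assumes M: "M \<ge> 1" "\<And>\<omega> x. \<omega> \<in> \<Omega> \<Longrightarrow> norm (cmatrix (D \<omega>) *v x) \<le> M * norm x"
    and c: "c > 0" "\<And>u m n. (\<And>j. j \<notin> {m..n} \<Longrightarrow> u j = 0) \<Longrightarrow>
      c * (\<Sum>j\<in>{m..n}. (norm (u j))\<^sup>2) \<le> (\<Sum>j\<in>{m-1..n+1}. (norm (shifted_jacobi z \<omega> u j))\<^sup>2)"
    and \<omega>: "\<omega> \<in> \<Omega>" and sol: "\<And>j. shifted_jacobi z \<omega> u j = 0" and mn: "m \<le> n"
  defines "a \<equiv> \<lambda>j. (norm (phase \<omega> u j))\<^sup>2"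
  shows "(\<Sum>j\<in>{m..n+1}. a j) \<le> (1 + (1 + M\<^sup>2) * (8 * M\<^sup>2) / c) * (a m + a (n + 1))"
proof -
  define x where "x j = norm (phase \<omega> u j)" for j
  define v where "v j = (if m \<le> j \<and> j \<le> n then u j else 0)" for j
  have supp: "v j = 0" if "j \<notin> {m..n}" for j
    using that by (auto simp: v_def)
  let ?D = "\<lambda>j. cmatrix (D (iter j \<omega>))"
  let ?B = "M * (x m + x (n + 1))"
  have x_nonneg: "0 \<le> x j" for j by (simp add: x_def)
  have xa: "a j = (x j)\<^sup>2" for j by (simp add: a_def x_def)
  have u_le: "norm (u j) \<le> x j" "norm (?D (j - 1) *v u (j - 1)) \<le> x j" for j
    by (simp_all add: x_def phase_def norm_vec_pair_ge)
  have Du_le: "norm (?D i *v u j) \<le> M * x j" for i j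
    using M(2)[OF iter_in[OF \<omega>], of i "u j"] mult_left_mono[OF u_le(1)[of j], of M] M(1) by linarith
  have x_le: "x j \<le> M * x j" for j
    using mult_right_mono[OF M(1) x_nonneg[of j]] by simp
  \<comment> \<open>Where the cut-off function is locally constant, \<open>v\<close> solves the same equation as \<open>u\<close>.\<close>
  have commutator: "shifted_jacobi z \<omega> v j =
      (if j = m - 1 then ?D (m - 1) *v u m else 0) - (if j = m then ?D (m - 1) *v u (m - 1) else 0)
    - (if j = n then ?D n *v u (n + 1) else 0) + (if j = n + 1 then ?D n *v u n else 0)" for j
  proof -
    have "shifted_jacobi z \<omega> v j - (if m \<le> j \<and> j \<le> n then shifted_jacobi z \<omega> u j else 0) =
      (if j = m - 1 then ?D (m - 1) *v u m else 0) - (if j = m then ?D (m - 1) *v u (m - 1) else 0)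
    - (if j = n then ?D n *v u (n + 1) else 0) + (if j = n + 1 then ?D n *v u n else 0)"
    proof -
      consider "j < m - 1" | "j = m - 1" | "j = m" "m = n" | "j = m" "m < n" | "m < j" "j < n"
        | "j = n" "m < n" | "j = n + 1" | "j > n + 1"
        using mn by linarith
      then show ?thesis
        using mn by cases (simp_all add: shifted_jacobi_eq v_def)
    qed
    then show ?thesis unfolding sol if_cancel diff_0_right .
  qed
  have bound: "norm (shifted_jacobi z \<omega> v j) \<le> ?B" for j
  proof -
    have "norm (?D (m - 1) *v u (m - 1)) \<le> M * x m" "norm (?D n *v u n) \<le> M * x (n + 1)"
      using u_le(2)[of m] u_le(2)[of "n + 1"] x_le[of m] x_le[of "n + 1"] by auto
    moreover have "0 \<le> M * x m" "0 \<le> M * x (n + 1)"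
      using M(1) x_nonneg by auto
    moreover note Du_le[of "m - 1" m] Du_le[of n "n + 1"]
    ultimately show ?thesis
      unfolding commutator using mn
        norm_triangle_ineq4[of "- (?D (m - 1) *v u (m - 1))" "?D n *v u (n + 1)"]
      by (auto simp: algebra_simps)
  qed
  have "(\<Sum>j\<in>{m-1..n+1}. (norm (shifted_jacobi z \<omega> v j))\<^sup>2) = (\<Sum>j\<in>{m-1, m, n, n+1}. (norm (shifted_jacobi z \<omega> v j))\<^sup>2)"
    by (rule sum.mono_neutral_right) (use mn in \<open>auto simp: commutator\<close>)
  also have "\<dots> \<le> (\<Sum>j\<in>{m-1, m, n, n+1}. ?B\<^sup>2)"
    by (intro sum_mono power_mono bound) auto
  also have "\<dots> \<le> 4 * ?B\<^sup>2"
  proof -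
    have "card {m-1, m, n, n+1} \<le> 4"
      by (simp add: card_insert_if)
    then show ?thesis by (simp add: mult_right_mono)
  qed
  also have "\<dots> \<le> 8 * M\<^sup>2 * (a m + a (n + 1))"
  proof -
    have "(x m + x (n + 1))\<^sup>2 \<le> 2 * (a m + a (n + 1))"
      using zero_le_power2[of "x m - x (n + 1)"] by (simp add: xa power2_eq_square algebra_simps)
    then have "4 * M\<^sup>2 * (x m + x (n + 1))\<^sup>2 \<le> 4 * M\<^sup>2 * (2 * (a m + a (n + 1)))"
      by (intro mult_left_mono) auto
    then show ?thesis unfolding power_mult_distrib[of M] by (simp add: algebra_simps)
  qed
  finally have "c * (\<Sum>j\<in>{m..n}. (norm (v j))\<^sup>2) \<le> 8 * M\<^sup>2 * (a m + a (n + 1))"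
    using c(2)[where u = v and m = m and n = n, OF supp] by linarith
  moreover have "(\<Sum>j\<in>{m..n}. (norm (v j))\<^sup>2) = (\<Sum>j\<in>{m..n}. (norm (u j))\<^sup>2)"
    by (intro sum.cong) (auto simp: v_def)
  ultimately have u_sum: "(\<Sum>j\<in>{m..n}. (norm (u j))\<^sup>2) \<le> 8 * M\<^sup>2 / c * (a m + a (n + 1))"
    using c(1) by (simp add: field_simps)
  have "a j \<le> (norm (u j))\<^sup>2 + M\<^sup>2 * (norm (u (j - 1)))\<^sup>2" for j
  proof -
    have "(norm (?D (j - 1) *v u (j - 1)))\<^sup>2 \<le> (M * norm (u (j - 1)))\<^sup>2"
      by (intro power_mono M(2) iter_in \<omega>) simp
    then show ?thesis
      unfolding a_def phase_def norm_vec_pair by (simp add: power_mult_distrib)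
  qed
  then have "(\<Sum>j\<in>{m+1..n}. a j) \<le> (\<Sum>j\<in>{m+1..n}. (norm (u j))\<^sup>2 + M\<^sup>2 * (norm (u (j - 1)))\<^sup>2)"
    by (rule sum_mono)
  also have "\<dots> = (\<Sum>j\<in>{m+1..n}. (norm (u j))\<^sup>2) + M\<^sup>2 * (\<Sum>j\<in>{m+1..n}. (norm (u (j - 1)))\<^sup>2)"
    by (simp add: sum.distrib sum_distrib_left)
  also have "(\<Sum>j\<in>{m+1..n}. (norm (u (j - 1)))\<^sup>2) = (\<Sum>j\<in>{m..n-1}. (norm (u j))\<^sup>2)"
    by (rule sum.reindex_bij_witness[of _ "\<lambda>j. j + 1" "\<lambda>j. j - 1"]) auto
  also have "(\<Sum>j\<in>{m+1..n}. (norm (u j))\<^sup>2) + M\<^sup>2 * (\<Sum>j\<in>{m..n-1}. (norm (u j))\<^sup>2)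
      \<le> (\<Sum>j\<in>{m..n}. (norm (u j))\<^sup>2) + M\<^sup>2 * (\<Sum>j\<in>{m..n}. (norm (u j))\<^sup>2)"
    by (intro add_mono mult_left_mono sum_mono2) auto
  also have "\<dots> = (1 + M\<^sup>2) * (\<Sum>j\<in>{m..n}. (norm (u j))\<^sup>2)"
    by (simp add: algebra_simps)
  also have "\<dots> \<le> (1 + M\<^sup>2) * (8 * M\<^sup>2 / c * (a m + a (n + 1)))"
    by (intro mult_left_mono u_sum) simp
  finally have inner: "(\<Sum>j\<in>{m+1..n}. a j) \<le> (1 + M\<^sup>2) * (8 * M\<^sup>2) / c * (a m + a (n + 1))"
    by (simp add: mult.assoc)
  have "{m..n+1} = insert m (insert (n + 1) {m+1..n})"
    using mn by auto
  then have "(\<Sum>j\<in>{m..n+1}. a j) = a m + (a (n + 1) + (\<Sum>j\<in>{m+1..n}. a j))"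
    using mn by simp
  then show ?thesis using inner by (simp add: algebra_simps)
qed

lemma bounded_below_imp_UG:
  assumes minimal: "\<Omega> \<subseteq> closure (range (\<lambda>j. iter j \<omega>0))" and \<omega>0: "\<omega>0 \<in> \<Omega>"
    and below: "bounded_below z \<omega>0"
  shows "(T, J) \<in> UG \<Omega>"
proof -
  obtain M where M: "M \<ge> 1" "\<And>\<omega> x. \<omega> \<in> \<Omega> \<Longrightarrow> norm (cmatrix (D \<omega>) *v x) \<le> M * norm x"
    using coefficient_bound by blast
  obtain c where c: "c > 0"
    "\<And>\<omega> u m n. \<omega> \<in> \<Omega> \<Longrightarrow> (\<And>j. j \<notin> {m..n} \<Longrightarrow> u j = 0) \<Longrightarrow>
      c * (\<Sum>j\<in>{m..n}. (norm (u j))\<^sup>2) \<le> (\<Sum>j\<in>{m-1..n+1}. (norm (shifted_jacobi z \<omega> u j))\<^sup>2)"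
    using bounded_below_window[OF minimal \<omega>0 below] by blast
  define C where "C = 1 + (1 + M\<^sup>2) * (8 * M\<^sup>2) / c"
  have C: "C \<ge> 1" using c(1) by (simp add: C_def)
  define \<mu> where "\<mu> = 2 * C / (2 * C - 1)"
  have \<mu>: "\<mu> > 1" using C by (simp add: \<mu>_def)
  have growth: "(\<forall>n\<ge>1. \<mu> ^ n * (norm v)\<^sup>2 \<le> 2 * C * (norm (Aiter (int n) \<omega> *v v))\<^sup>2) \<or>
      (\<forall>n\<ge>1. \<mu> ^ n * (norm v)\<^sup>2 \<le> 2 * C * (norm (Aiter (- int n) \<omega> *v v))\<^sup>2)" if \<omega>: "\<omega> \<in> \<Omega>" for \<omega> v
  proof -
    define x where "x n = Aiter n \<omega> *v v" for n
    \<comment> \<open>The orbit over \<open>\<omega>\<close> belongs to the operator at \<open>T \<omega>\<close>, because \<open>A(z, \<omega>)\<close> is built from \<open>D (T \<omega>)\<close>.\<close>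
    have T\<omega>: "T \<omega> \<in> \<Omega>" using \<omega> by blast
    have "iter (n - 1) (T \<omega>) = iter n \<omega>" for n
      using iter_add[OF \<omega>, of "n - 1" 1] by simp
    then have "x (n + 1) = J (iter (n - 1) (T \<omega>)) *v x n" for n
      using Aiter_Suc[OF \<omega>, of n] by (simp add: x_def matrix_vector_mul_assoc)
    then obtain u where u: "\<And>n. x n = phase (T \<omega>) u n" "\<And>n. shifted_jacobi z (T \<omega>) u n = 0"
      using orbit_is_phase[OF T\<omega>, of x] by metis
    let ?a = "\<lambda>n. (norm (x n))\<^sup>2"
    have window: "(\<Sum>j\<in>{p..q}. ?a j) \<le> C * (?a p + ?a q)" if "p \<le> q" for p q
    proof (cases "p = q")
      case True
      have "1 * ?a p \<le> C * ?a p" using C by (intro mult_right_mono) auto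
      moreover have "0 \<le> C * ?a p" using C by simp
      ultimately show ?thesis using True by (simp add: algebra_simps)
    next
      case False
      then have "p \<le> q - 1" using that by simp
      from solution_window_sum[OF M c(1) c(2)[OF T\<omega>] T\<omega> u(2) this] show ?thesis
        by (simp add: C_def u(1))
    qed
    have x0: "x 0 = v" by (simp add: x_def)
    have "(\<forall>n\<ge>1. \<mu> ^ n * ?a 0 \<le> 2 * C * ?a (int n)) \<or> (\<forall>n\<ge>1. \<mu> ^ n * ?a 0 \<le> 2 * C * ?a (- int n))"
      unfolding \<mu>_def by (rule window_sums_dichotomy[OF _ C window]) auto
    then show ?thesis unfolding x0 by (simp add: x_def)
  qed
  define r \<beta> where "r = sqrt \<mu>" and "\<beta> = 1 / sqrt (2 * C)"
  have r: "r > 1" and \<beta>: "\<beta> > 0" using \<mu> C by (auto simp: r_def \<beta>_def)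
  have root: "\<beta> * r ^ n * norm v \<le> norm y" if "\<mu> ^ n * (norm v)\<^sup>2 \<le> 2 * C * (norm y)\<^sup>2"
    for n and v y :: "complex^('l + 'l)"
  proof (rule power2_le_imp_le)
    have "(r ^ n)\<^sup>2 = \<mu> ^ n"
      using \<mu> by (simp add: r_def flip: power_mult_distrib real_sqrt_power)
    then have "(\<beta> * r ^ n * norm v)\<^sup>2 = \<mu> ^ n * (norm v)\<^sup>2 / (2 * C)"
      using C by (simp add: power_mult_distrib \<beta>_def power_divide)
    also have "\<dots> \<le> 2 * C * (norm y)\<^sup>2 / (2 * C)"
      using that C by (intro divide_right_mono) auto
    also have "\<dots> = (norm y)\<^sup>2"
      using C by simp
    finally show "(\<beta> * r ^ n * norm v)\<^sup>2 \<le> (norm y)\<^sup>2" .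
  qed simp
  have "\<forall>\<omega>\<in>\<Omega>. \<forall>v. v \<noteq> 0 \<longrightarrow>
        (\<forall>n\<ge>1. norm (Aiter (int n) \<omega> *v v) \<ge> \<beta> * r ^ n * norm v) \<or>
        (\<forall>n\<ge>1. norm (Aiter (- int n) \<omega> *v v) \<ge> \<beta> * r ^ n * norm v)"
    using growth root by meson
  then show ?thesis
    unfolding UG_def using SL r \<beta> by blast
qed

end

section \<open>Uniform growth and uniform hyperbolicity\<close>

text \<open>The dynamical content of hyperbolicity, with continuity of the bundles left out. Both directions
  of the equivalence pass through it: a uniformly hyperbolic cocycle provides such families of subspaces, and so does
  uniform growth once the bounded orbits span. Contraction is written as a lower bound on the
  initial vector to match the shape of uniform growth.\<close>

locale dichotomy = compact_SL_cocycle \<Omega> T A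
  for \<Omega> :: "'a::metric_space set" and T :: "'a \<Rightarrow> 'a" and A :: "'a \<Rightarrow> complex^'n^'n" +
  fixes Es Eu :: "'a \<Rightarrow> (complex^'n) set" and \<beta> r :: real
  assumes \<beta>: "\<beta> > 0" and r: "r > 1"
    and invariant_s: "\<And>\<omega> a k. \<omega> \<in> \<Omega> \<Longrightarrow> a \<in> Es \<omega> \<Longrightarrow> Aiter k \<omega> *v a \<in> Es (iter k \<omega>)"
    and invariant_u: "\<And>\<omega> b k. \<omega> \<in> \<Omega> \<Longrightarrow> b \<in> Eu \<omega> \<Longrightarrow> Aiter k \<omega> *v b \<in> Eu (iter k \<omega>)"
    and contract_s: "\<And>\<omega> a n. \<omega> \<in> \<Omega> \<Longrightarrow> a \<in> Es \<omega> \<Longrightarrow> n \<ge> 1 \<Longrightarrow> \<beta> * r ^ n * norm (Aiter (int n) \<omega> *v a) \<le> norm a"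
    and contract_u: "\<And>\<omega> b n. \<omega> \<in> \<Omega> \<Longrightarrow> b \<in> Eu \<omega> \<Longrightarrow> n \<ge> 1 \<Longrightarrow> \<beta> * r ^ n * norm (Aiter (- int n) \<omega> *v b) \<le> norm b"
    and split: "\<And>\<omega> v. \<omega> \<in> \<Omega> \<Longrightarrow> \<exists>a\<in>Es \<omega>. \<exists>b\<in>Eu \<omega>. v = a + b"
begin

text \<open>Contraction read backwards, starting from the image vector.\<close>

lemma expand_s:
  assumes "\<omega> \<in> \<Omega>" "a \<in> Es \<omega>" "n \<ge> 1"
  shows "\<beta> * r ^ n * norm a \<le> norm (Aiter (- int n) \<omega> *v a)"
  using contract_s[OF iter_in[OF assms(1)] invariant_s[OF assms(1,2)] assms(3), of "- int n"]
    Aiter_uminus(2)[OF assms(1), of "int n" a] by simp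

lemma expand_u:
  assumes "\<omega> \<in> \<Omega>" "b \<in> Eu \<omega>" "n \<ge> 1"
  shows "\<beta> * r ^ n * norm b \<le> norm (Aiter (int n) \<omega> *v b)"
  using contract_u[OF iter_in[OF assms(1)] invariant_u[OF assms(1,2)] assms(3), of "int n"]
    Aiter_uminus(1)[OF assms(1), of "int n" b] by simp

lemma large_rate: obtains N where "N \<ge> 1" "2 \<le> \<beta> * r ^ N"
proof -
  obtain N0 where "2 / \<beta> < r ^ N0"
    using real_arch_pow[OF r] by blast
  also have "r ^ N0 \<le> r ^ Suc N0"
    using r by (intro power_increasing) auto
  finally have "2 \<le> \<beta> * r ^ Suc N0"
    using \<beta> by (simp add: field_simps)
  then show thesis by (intro that[of "Suc N0"]) auto
qed

text \<open>Run time for \<open>N\<close> steps in the direction in which the longer of the two components expands. It doubles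
  while the other one shrinks, so the image of \<open>a + b\<close> is at least as long as that component, whereas
  \<open>A\<^sub>N\<close> and \<open>A\<^sub>-\<^sub>N\<close> stretch \<open>a + b\<close> by a bounded factor only.\<close>

lemma transversality:
  obtains M where "M \<ge> 1"
    "\<And>\<omega> a b. \<omega> \<in> \<Omega> \<Longrightarrow> a \<in> Es \<omega> \<Longrightarrow> b \<in> Eu \<omega> \<Longrightarrow> norm a \<le> M * norm (a + b) \<and> norm b \<le> M * norm (a + b)"
proof -
  obtain N where N: "N \<ge> 1" "2 \<le> \<beta> * r ^ N" by (rule large_rate)
  obtain M where M: "M \<ge> 1" "\<And>n \<omega> v. \<bar>n\<bar> \<le> int N \<Longrightarrow> \<omega> \<in> \<Omega> \<Longrightarrow> norm (Aiter n \<omega> *v v) \<le> M * norm v"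
    using uniform_Aiter_bound[of N] by blast
  have shrink: "norm y \<le> norm x" if "\<beta> * r ^ N * norm y \<le> norm x" for x y :: "complex^'n"
  proof -
    have "2 * norm y \<le> \<beta> * r ^ N * norm y"
      using N(2) by (rule mult_right_mono) simp
    then show ?thesis using that norm_ge_zero[of y] by linarith
  qed
  have grow: "2 * norm x \<le> norm y" if "\<beta> * r ^ N * norm x \<le> norm y" for x y :: "complex^'n"
    using mult_right_mono[OF N(2), of "norm x"] that by simp
  have "norm a \<le> M * norm (a + b) \<and> norm b \<le> M * norm (a + b)"
    if \<omega>: "\<omega> \<in> \<Omega>" and a: "a \<in> Es \<omega>" and b: "b \<in> Eu \<omega>" for \<omega> a b
  proof (cases "norm a \<le> norm b")
    case True
    let ?F = "\<lambda>v. Aiter (int N) \<omega> *v v"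
    have "norm (?F a) \<le> norm a" "2 * norm b \<le> norm (?F b)"
      using shrink[OF contract_s[OF \<omega> a N(1)]] grow[OF expand_u[OF \<omega> b N(1)]] by auto
    moreover have "norm (?F b) \<le> norm (?F (a + b)) + norm (?F a)"
      using norm_triangle_ineq4[of "?F (a + b)" "?F a"] by (simp add: matrix_vector_right_distrib)
    moreover have "norm (?F (a + b)) \<le> M * norm (a + b)"
      using M(2) \<omega> by simp
    ultimately show ?thesis using True by linarith
  next
    case False
    let ?F = "\<lambda>v. Aiter (- int N) \<omega> *v v"
    have "norm (?F b) \<le> norm b" "2 * norm a \<le> norm (?F a)"
      using shrink[OF contract_u[OF \<omega> b N(1)]] grow[OF expand_s[OF \<omega> a N(1)]] by auto
    moreover have "norm (?F a) \<le> norm (?F (a + b)) + norm (?F b)"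
      using norm_triangle_ineq4[of "?F (a + b)" "?F b"] by (simp add: matrix_vector_right_distrib)
    moreover have "norm (?F (a + b)) \<le> M * norm (a + b)"
      using M(2) \<omega> by simp
    ultimately show ?thesis using False by linarith
  qed
  then show thesis using that M(1) by blast
qed

text \<open>One component has at least half the length of \<open>v\<close> and expands in one time direction. Transversality at the image
  point prevents the other component from cancelling it.\<close>

lemma dichotomy_imp_UG: "(T, A) \<in> UG \<Omega>"
proof -
  obtain M where M: "M \<ge> 1"
    "\<And>\<omega> a b. \<omega> \<in> \<Omega> \<Longrightarrow> a \<in> Es \<omega> \<Longrightarrow> b \<in> Eu \<omega> \<Longrightarrow> norm a \<le> M * norm (a + b) \<and> norm b \<le> M * norm (a + b)"
    using transversality by blast
  define \<gamma> where "\<gamma> = \<beta> / (2 * M)"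
  have \<gamma>: "\<gamma> > 0" using \<beta> M(1) by (simp add: \<gamma>_def)
  have final: "\<gamma> * r ^ n * norm v \<le> norm y"
    if "\<beta> * r ^ n * norm x \<le> norm x'" "norm x' \<le> M * norm y" "norm v \<le> 2 * norm x" for n and v x x' y :: "complex^'n"
  proof -
    have "\<beta> * r ^ n * norm v \<le> \<beta> * r ^ n * (2 * norm x)"
      using that(3) \<beta> r by (intro mult_left_mono) auto
    also have "\<dots> \<le> 2 * (M * norm y)"
      using that(1,2) by linarith
    finally show ?thesis using M(1) by (simp add: \<gamma>_def field_simps)
  qed
  have "(\<forall>n\<ge>1. norm (Aiter (int n) \<omega> *v v) \<ge> \<gamma> * r ^ n * norm v) \<or>
        (\<forall>n\<ge>1. norm (Aiter (- int n) \<omega> *v v) \<ge> \<gamma> * r ^ n * norm v)" if \<omega>: "\<omega> \<in> \<Omega>" for \<omega> v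
  proof -
    obtain a b where a: "a \<in> Es \<omega>" and b: "b \<in> Eu \<omega>" and v: "v = a + b"
      using split[OF \<omega>] by blast
    have comp: "norm (Aiter k \<omega> *v a) \<le> M * norm (Aiter k \<omega> *v v)" "norm (Aiter k \<omega> *v b) \<le> M * norm (Aiter k \<omega> *v v)" for k
      using M(2)[OF iter_in[OF \<omega>] invariant_s[OF \<omega> a] invariant_u[OF \<omega> b], of k]
      by (simp_all add: v matrix_vector_right_distrib)
    show ?thesis
    proof (cases "norm a \<le> norm b")
      case True
      then have "norm v \<le> 2 * norm b" using norm_triangle_ineq[of a b] v by simp
      then show ?thesis using final[OF expand_u[OF \<omega> b] comp(2)] by blast
    next
      case False
      then have "norm v \<le> 2 * norm a" using norm_triangle_ineq[of a b] v by simp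
      then show ?thesis using final[OF expand_s[OF \<omega> a] comp(1)] by blast
    qed
  qed
  then show ?thesis
    unfolding UG_def using SL r \<gamma> by blast
qed

end

context compact_SL_cocycle
begin

text \<open>The definition of uniform hyperbolicity contains forward invariance of the bundles. Backward invariance follows from the
  splitting: if \<open>A v\<close> is stable, then so is the image of the unstable part of \<open>v\<close>, which therefore vanishes.\<close>

lemma UH_imp_UG:
  assumes "(T, A) \<in> UH \<Omega>"
  shows "(T, A) \<in> UG \<Omega>"
proof -
  obtain Es Eu and C r :: real where W: "Whitney_splitting \<Omega> Es Eu" and C: "C > 0" and r: "r > 1"
    and inv: "\<And>\<omega> j v. \<omega> \<in> \<Omega> \<Longrightarrow> v \<in> Eu (iter j \<omega>) \<Longrightarrow> A (iter j \<omega>) *v v \<in> Eu (iter (j + 1) \<omega>)"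
      "\<And>\<omega> j v. \<omega> \<in> \<Omega> \<Longrightarrow> v \<in> Es (iter j \<omega>) \<Longrightarrow> A (iter j \<omega>) *v v \<in> Es (iter (j + 1) \<omega>)"
    and decay: "\<forall>\<omega>\<in>\<Omega>. \<forall>v\<in>Eu \<omega>. \<forall>w\<in>Es \<omega>. \<forall>n\<ge>1.
       norm (Aiter (- int n) \<omega> *v v) \<le> C * r powi (- int n) * norm v \<and>
       norm (Aiter (int n) \<omega> *v w) \<le> C * r powi (- int n) * norm w"
    using assms unfolding UH_def by auto
  have int0: "Es \<omega> \<inter> Eu \<omega> = {0}" and span: "{x + y | x y. x \<in> Es \<omega> \<and> y \<in> Eu \<omega>} = UNIV" if "\<omega> \<in> \<Omega>" for \<omega>
    using W that unfolding Whitney_splitting_def by auto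
  have split: "\<exists>a\<in>Es \<omega>. \<exists>b\<in>Eu \<omega>. v = a + b" if "\<omega> \<in> \<Omega>" for \<omega> v
  proof -
    have "v \<in> {x + y | x y. x \<in> Es \<omega> \<and> y \<in> Eu \<omega>}"
      unfolding span[OF that] by simp
    then show ?thesis by blast
  qed
  have zero: "0 \<in> Es \<omega>" "0 \<in> Eu \<omega>" if "\<omega> \<in> \<Omega>" for \<omega>
    using int0[OF that] by auto
  have subspace: "vec.subspace (Es \<omega>)" "vec.subspace (Eu \<omega>)" if "\<omega> \<in> \<Omega>" for \<omega>
    using W that unfolding Whitney_splitting_def continuous_subbundle_def
    by (metis IntI vec.subspace_span)+
  have preimage_s: "v \<in> Es \<omega>" if \<omega>: "\<omega> \<in> \<Omega>" and "A \<omega> *v v \<in> Es (T \<omega>)" for \<omega> v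
  proof -
    obtain a b where ab: "a \<in> Es \<omega>" "b \<in> Eu \<omega>" "v = a + b" using split[OF \<omega>] by blast
    have "A \<omega> *v a \<in> Es (T \<omega>)" "A \<omega> *v b \<in> Eu (T \<omega>)"
      using inv(2)[OF that(1), of a 0] inv(1)[OF that(1), of b 0] ab by auto
    moreover have "A \<omega> *v b = A \<omega> *v v - A \<omega> *v a"
      by (simp add: ab(3) matrix_vector_right_distrib)
    ultimately have "A \<omega> *v b \<in> Es (T \<omega>) \<inter> Eu (T \<omega>)"
      using vec.subspace_diff[OF subspace(1)[OF T_in[OF that(1)]] that(2)] by auto
    then have "A \<omega> *v b = A \<omega> *v 0" using int0[OF T_in[OF that(1)]] by simp
    then have "b = 0" using A_inj[OF that(1)] by blast
    then show ?thesis using ab by simp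
  qed
  have preimage_u: "v \<in> Eu \<omega>" if \<omega>: "\<omega> \<in> \<Omega>" and "A \<omega> *v v \<in> Eu (T \<omega>)" for \<omega> v
  proof -
    obtain a b where ab: "a \<in> Es \<omega>" "b \<in> Eu \<omega>" "v = a + b" using split[OF \<omega>] by blast
    have "A \<omega> *v a \<in> Es (T \<omega>)" "A \<omega> *v b \<in> Eu (T \<omega>)"
      using inv(2)[OF that(1), of a 0] inv(1)[OF that(1), of b 0] ab by auto
    moreover have "A \<omega> *v a = A \<omega> *v v - A \<omega> *v b"
      by (simp add: ab(3) matrix_vector_right_distrib)
    ultimately have "A \<omega> *v a \<in> Es (T \<omega>) \<inter> Eu (T \<omega>)"
      using vec.subspace_diff[OF subspace(2)[OF T_in[OF that(1)]] that(2)] by auto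
    then have "A \<omega> *v a = A \<omega> *v 0" using int0[OF T_in[OF that(1)]] by simp
    then have "a = 0" using A_inj[OF that(1)] by blast
    then show ?thesis using ab by simp
  qed
  have invariant: "Aiter k \<omega> *v a \<in> E (iter k \<omega>)"
    if \<omega>: "\<omega> \<in> \<Omega>" and a: "a \<in> E \<omega>"
      and fwd: "\<And>\<omega> j v. \<omega> \<in> \<Omega> \<Longrightarrow> v \<in> E (iter j \<omega>) \<Longrightarrow> A (iter j \<omega>) *v v \<in> E (iter (j + 1) \<omega>)"
      and bwd: "\<And>\<omega> v. \<omega> \<in> \<Omega> \<Longrightarrow> A \<omega> *v v \<in> E (T \<omega>) \<Longrightarrow> v \<in> E \<omega>" for \<omega> a k E
  proof (induction k rule: int_induct[where k = 0])
    case base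
    then show ?case using a by simp
  next
    case (step1 k)
    then show ?case
      using fwd[OF \<omega> step1(2)] Aiter_Suc[OF \<omega>, of k] by (simp add: matrix_vector_mul_assoc)
  next
    case (step2 k)
    have "A (iter (k - 1) \<omega>) *v (Aiter (k - 1) \<omega> *v a) \<in> E (T (iter (k - 1) \<omega>))"
      using step2 Aiter_Suc[OF \<omega>, of "k - 1"] iter_Suc[OF \<omega>, of "k - 1"] by (simp add: matrix_vector_mul_assoc)
    then show ?case using bwd iter_in[OF \<omega>] by blast
  qed
  have rate: "1 / C * r ^ n * x \<le> y" if "x \<le> C * r powi (- int n) * y" for x y n
  proof -
    have "r ^ n * x \<le> r ^ n * (C * r powi (- int n) * y)"
      using that r by (intro mult_left_mono) auto
    also have "\<dots> = C * y"
      using r by (simp add: power_int_minus field_simps)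
    finally show ?thesis using C by (simp add: field_simps)
  qed
  interpret dichotomy \<Omega> T A Es Eu "1 / C" r
  proof
    show "1 / C > 0" "r > 1" using C r by auto
    show "Aiter k \<omega> *v a \<in> Es (iter k \<omega>)" if "\<omega> \<in> \<Omega>" "a \<in> Es \<omega>" for \<omega> a k
      using invariant[OF that inv(2) preimage_s] by blast
    show "Aiter k \<omega> *v a \<in> Eu (iter k \<omega>)" if "\<omega> \<in> \<Omega>" "a \<in> Eu \<omega>" for \<omega> a k
      using invariant[OF that inv(1) preimage_u] by blast
    show "1 / C * r ^ n * norm (Aiter (int n) \<omega> *v a) \<le> norm a" if "\<omega> \<in> \<Omega>" "a \<in> Es \<omega>" "n \<ge> 1" for \<omega> a n
      using decay that zero(2)[OF that(1)] by (intro rate) blast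
    show "1 / C * r ^ n * norm (Aiter (- int n) \<omega> *v a) \<le> norm a" if "\<omega> \<in> \<Omega>" "a \<in> Eu \<omega>" "n \<ge> 1" for \<omega> a n
      using decay that zero(1)[OF that(1)] by (intro rate) blast
  qed (rule split)
  show ?thesis by (rule dichotomy_imp_UG)
qed

text \<open>The time direction is encoded by \<open>\<sigma> = 1\<close> (future) or \<open>\<sigma> = - 1\<close> (past).\<close>

definition bounded_orbits :: "int \<Rightarrow> 'a \<Rightarrow> (complex^'n) set" where
  "bounded_orbits \<sigma> \<omega> = {v. \<exists>K. \<forall>n. norm (Aiter (\<sigma> * int n) \<omega> *v v) \<le> K}"

lemma bounded_orbits_subspace: "vec.subspace (bounded_orbits \<sigma> \<omega>)"
proof (rule vec.subspaceI)
  show "0 \<in> bounded_orbits \<sigma> \<omega>" by (auto simp: bounded_orbits_def)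
  show "x + y \<in> bounded_orbits \<sigma> \<omega>" if x: "x \<in> bounded_orbits \<sigma> \<omega>" and y: "y \<in> bounded_orbits \<sigma> \<omega>" for x y
  proof -
    obtain K where "\<And>n. norm (Aiter (\<sigma> * int n) \<omega> *v x) \<le> K"
      using x unfolding bounded_orbits_def by blast
    moreover obtain L where "\<And>n. norm (Aiter (\<sigma> * int n) \<omega> *v y) \<le> L"
      using y unfolding bounded_orbits_def by blast
    ultimately have "norm (Aiter (\<sigma> * int n) \<omega> *v (x + y)) \<le> K + L" for n
      by (simp add: matrix_vector_right_distrib norm_triangle_mono)
    then show ?thesis unfolding bounded_orbits_def by blast
  qed
  show "c *s x \<in> bounded_orbits \<sigma> \<omega>" if x: "x \<in> bounded_orbits \<sigma> \<omega>" for c x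
  proof -
    obtain K where "\<And>n. norm (Aiter (\<sigma> * int n) \<omega> *v x) \<le> K"
      using x unfolding bounded_orbits_def by blast
    then have "norm (Aiter (\<sigma> * int n) \<omega> *v (c *s x)) \<le> norm c * K" for n
      by (simp add: vec.scale norm_vector_smult mult_left_mono)
    then show ?thesis unfolding bounded_orbits_def by blast
  qed
qed

lemma bounded_orbits_invariant:
  assumes \<omega>: "\<omega> \<in> \<Omega>" and v: "v \<in> bounded_orbits \<sigma> \<omega>"
  shows "Aiter k \<omega> *v v \<in> bounded_orbits \<sigma> (iter k \<omega>)"
proof -
  obtain K where K: "\<And>n. norm (Aiter (\<sigma> * int n) \<omega> *v v) \<le> K"
    using v unfolding bounded_orbits_def by blast
  obtain M where M: "M \<ge> 1" "\<And>n \<omega> v. \<bar>n\<bar> \<le> int (nat \<bar>k\<bar>) \<Longrightarrow> \<omega> \<in> \<Omega> \<Longrightarrow> norm (Aiter n \<omega> *v v) \<le> M * norm v"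
    using uniform_Aiter_bound[of "nat \<bar>k\<bar>"] by blast
  have "norm (Aiter (\<sigma> * int n) (iter k \<omega>) *v (Aiter k \<omega> *v v)) \<le> M * K" for n
  proof -
    have eq: "Aiter (\<sigma> * int n) (iter k \<omega>) *v (Aiter k \<omega> *v v) = Aiter k (iter (\<sigma> * int n) \<omega>) *v (Aiter (\<sigma> * int n) \<omega> *v v)"
      using Aiter_add[OF \<omega>, of "\<sigma> * int n" k v] Aiter_add[OF \<omega>, of k "\<sigma> * int n" v] by (simp add: add.commute)
    have "norm (Aiter k (iter (\<sigma> * int n) \<omega>) *v (Aiter (\<sigma> * int n) \<omega> *v v)) \<le> M * norm (Aiter (\<sigma> * int n) \<omega> *v v)"
      by (intro M(2) iter_in \<omega>) simp
    also have "\<dots> \<le> M * K"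
      using K M(1) by (intro mult_left_mono) auto
    finally show ?thesis unfolding eq .
  qed
  then show ?thesis unfolding bounded_orbits_def by blast
qed

end

text \<open>A basis of the fibre at \<open>\<omega>0\<close>, moved by injective matrices \<open>Q \<omega>\<close> that depend continuously on \<open>\<omega>\<close> and map this
  fibre onto the neighbouring ones, is a local frame.\<close>

lemma continuous_subbundle_transport:
  fixes E :: "'a::topological_space \<Rightarrow> (complex^'n) set"
  assumes sub: "\<And>\<omega>. \<omega> \<in> \<Omega> \<Longrightarrow> vec.subspace (E \<omega>)"
    and transport: "\<And>\<omega>0. \<omega>0 \<in> \<Omega> \<Longrightarrow> \<exists>U Q. open U \<and> \<omega>0 \<in> U \<and> continuous_on \<Omega> Q \<and>
      (\<forall>\<omega>\<in>U \<inter> \<Omega>. inj ((*v) (Q \<omega> :: complex^'n^'n)) \<and> (*v) (Q \<omega>) ` E \<omega>0 = E \<omega>)"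
  shows "continuous_subbundle \<Omega> E"
  unfolding continuous_subbundle_def
proof
  fix \<omega>0 assume \<omega>0: "\<omega>0 \<in> \<Omega>"
  obtain U Q where U: "open U" "\<omega>0 \<in> U" and Q: "continuous_on \<Omega> Q"
    and UQ: "\<And>\<omega>. \<omega> \<in> U \<inter> \<Omega> \<Longrightarrow> inj ((*v) (Q \<omega> :: complex^'n^'n)) \<and> (*v) (Q \<omega>) ` E \<omega>0 = E \<omega>"
    using transport[OF \<omega>0] by metis
  obtain B where B: "B \<subseteq> E \<omega>0" "vec.independent B" "E \<omega>0 \<subseteq> vec.span B"
    using vec.basis_exists by metis
  have spanB: "vec.span B = E \<omega>0"
    using B(1,3) sub[OF \<omega>0] by (meson subset_antisym vec.span_minimal)
  have "finite B" using B(2) by (rule vec.finiteI_independent)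
  then obtain h where h: "bij_betw h {0..<card B} B"
    using ex_bij_betw_nat_finite by blast
  have hB: "h ` {..<card B} = B" "inj_on h {..<card B}"
    using h by (auto simp: bij_betw_def atLeast0LessThan)
  show "\<exists>U (k::nat) (e :: nat \<Rightarrow> 'a \<Rightarrow> complex^'n).
        open U \<and> \<omega>0 \<in> U \<and> (\<forall>i<k. continuous_on (U \<inter> \<Omega>) (e i)) \<and>
        (\<forall>\<omega>\<in>U \<inter> \<Omega>. inj_on (\<lambda>i. e i \<omega>) {..<k} \<and> vec.independent ((\<lambda>i. e i \<omega>) ` {..<k}) \<and>
           vec.span ((\<lambda>i. e i \<omega>) ` {..<k}) = E \<omega>)"
  proof (intro exI[of _ U] exI[of _ "card B"] exI[of _ "\<lambda>i \<omega>. Q \<omega> *v h i"] conjI allI impI ballI U)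
    show "continuous_on (U \<inter> \<Omega>) (\<lambda>\<omega>. Q \<omega> *v h i)" for i
      by (intro continuous_on_matrix_vector_mult continuous_on_const continuous_on_subset[OF Q]) auto
    fix \<omega> assume "\<omega> \<in> U \<inter> \<Omega>"
    note inj = UQ[OF this, THEN conjunct1] and image = UQ[OF this, THEN conjunct2]
    have eq: "(\<lambda>i. Q \<omega> *v h i) ` {..<card B} = (*v) (Q \<omega>) ` B"
      using hB(1) by (metis image_image)
    show "inj_on (\<lambda>i. Q \<omega> *v h i) {..<card B}"
      using hB(2) inj by (simp add: inj_on_def)
    show "vec.independent ((\<lambda>i. Q \<omega> *v h i) ` {..<card B})"
      unfolding eq using B(2) inj
      by (intro vec.linear_independent_injective_image matrix_vector_mul_linear_gen) (auto intro: inj_on_subset)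
    show "vec.span ((\<lambda>i. Q \<omega> *v h i) ` {..<card B}) = E \<omega>"
      unfolding eq by (simp add: vec.linear_span_image[OF matrix_vector_mul_linear_gen] spanB image)
  qed
qed

context dichotomy
begin

text \<open>The subspaces are given by inequalities that are closed in \<open>(\<omega>, v)\<close>, and the projections along the
  splitting are uniformly bounded. Hence the graph of \<open>\<omega> \<mapsto> P \<omega> v\<close> is compact, and \<open>P\<close> is continuous. The
  matrices \<open>Q = P\<^sub>\<omega> P\<^sub>\<omega>\<^sub>0 + (1 - P\<^sub>\<omega>) (1 - P\<^sub>\<omega>\<^sub>0)\<close> equal the identity at \<open>\<omega>0\<close> and respect the splittings at \<open>\<omega>0\<close> and
  \<open>\<omega>\<close>; wherever they are invertible they transport both bundles.\<close>

lemma dichotomy_imp_UH: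
  assumes sub_s: "\<And>\<omega>. \<omega> \<in> \<Omega> \<Longrightarrow> vec.subspace (Es \<omega>)" and sub_u: "\<And>\<omega>. \<omega> \<in> \<Omega> \<Longrightarrow> vec.subspace (Eu \<omega>)"
    and Es_eq: "\<And>\<omega>. \<omega> \<in> \<Omega> \<Longrightarrow> Es \<omega> = {a. \<forall>n\<ge>1. \<beta> * r ^ n * norm (Aiter (int n) \<omega> *v a) \<le> norm a}"
    and Eu_eq: "\<And>\<omega>. \<omega> \<in> \<Omega> \<Longrightarrow> Eu \<omega> = {b. \<forall>n\<ge>1. \<beta> * r ^ n * norm (Aiter (- int n) \<omega> *v b) \<le> norm b}"
  shows "(T, A) \<in> UH \<Omega>"
proof -
  obtain M where M: "M \<ge> 1"
    "\<And>\<omega> a b. \<omega> \<in> \<Omega> \<Longrightarrow> a \<in> Es \<omega> \<Longrightarrow> b \<in> Eu \<omega> \<Longrightarrow> norm a \<le> M * norm (a + b) \<and> norm b \<le> M * norm (a + b)"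
    using transversality by blast
  have disjoint: "x = 0" if "\<omega> \<in> \<Omega>" "x \<in> Es \<omega>" "x \<in> Eu \<omega>" for \<omega> x
    using M(2)[OF that(1,2), of "- x"] vec.subspace_neg[OF sub_u[OF that(1)] that(3)] by simp
  define P where "P \<omega> v = (THE a. a \<in> Es \<omega> \<and> v - a \<in> Eu \<omega>)" for \<omega> v
  have P_eq: "P \<omega> v = a" if \<omega>: "\<omega> \<in> \<Omega>" and a: "a \<in> Es \<omega>" "v - a \<in> Eu \<omega>" for \<omega> v a
    unfolding P_def
  proof (rule the_equality)
    fix a' assume a': "a' \<in> Es \<omega> \<and> v - a' \<in> Eu \<omega>"
    then have "a' - a \<in> Es \<omega>" "(v - a) - (v - a') \<in> Eu \<omega>"
      using a vec.subspace_diff[OF sub_s[OF \<omega>]] vec.subspace_diff[OF sub_u[OF \<omega>]] by blast+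
    then show "a' = a" using disjoint[OF \<omega>, of "a' - a"] by simp
  qed (use a in blast)
  have P_mem: "P \<omega> v \<in> Es \<omega>" "v - P \<omega> v \<in> Eu \<omega>" if \<omega>: "\<omega> \<in> \<Omega>" for \<omega> v
  proof -
    obtain a b where "a \<in> Es \<omega>" "b \<in> Eu \<omega>" "v = a + b" using split[OF \<omega>] by blast
    then show "P \<omega> v \<in> Es \<omega>" "v - P \<omega> v \<in> Eu \<omega>" using P_eq[OF \<omega>, of a v] by auto
  qed
  have P_linear: "Vector_Spaces.linear (*s) (*s) (P \<omega>)" if \<omega>: "\<omega> \<in> \<Omega>" for \<omega>
    unfolding Vector_Spaces.linear_iff
  proof (intro conjI allI)
    show "vector_space ((*s) :: complex \<Rightarrow> complex^'n \<Rightarrow> complex^'n)"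
      "vector_space ((*s) :: complex \<Rightarrow> complex^'n \<Rightarrow> complex^'n)"
      by (rule vec.vector_space_axioms)+
    show "P \<omega> (v + w) = P \<omega> v + P \<omega> w" for v w
      using vec.subspace_add[OF sub_s[OF \<omega>] P_mem(1)[OF \<omega>, of v] P_mem(1)[OF \<omega>, of w]]
        vec.subspace_add[OF sub_u[OF \<omega>] P_mem(2)[OF \<omega>, of v] P_mem(2)[OF \<omega>, of w]]
      by (intro P_eq \<omega>) (simp_all add: algebra_simps)
    show "P \<omega> (c *s v) = c *s P \<omega> v" for c v
      using vec.subspace_scale[OF sub_s[OF \<omega>] P_mem(1)[OF \<omega>, of v], of c]
        vec.subspace_scale[OF sub_u[OF \<omega>] P_mem(2)[OF \<omega>, of v], of c]
      by (intro P_eq \<omega>) (simp_all add: vec.scale_right_diff_distrib)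
  qed
  have P_cont: "continuous_on \<Omega> (\<lambda>\<omega>. P \<omega> v)" for v
  proof -
    let ?K = "\<Omega> \<times> cball (0 :: complex^'n) (M * norm v)"
    let ?S = "\<lambda>n. {p \<in> ?K. \<beta> * r ^ n * norm (Aiter (int n) (fst p) *v snd p) \<le> norm (snd p)}"
    let ?U = "\<lambda>n. {p \<in> ?K. \<beta> * r ^ n * norm (Aiter (- int n) (fst p) *v (v - snd p)) \<le> norm (v - snd p)}"
    define G where "G = ?K \<inter> (\<Inter>n\<in>{1..}. ?S n \<inter> ?U n)"
    have K: "compact ?K" by (intro compact_Times compact compact_cball)
    have A: "continuous_on ?K (\<lambda>p. Aiter k (fst p))" for k
      by (rule continuous_on_compose2[OF continuous_on_Aiter]) (auto intro!: continuous_intros)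
    have "closed (?S n)" "closed (?U n)" for n
      using compact_imp_closed[OF K]
      by (intro continuous_on_closed_Collect_le continuous_intros continuous_on_matrix_vector_mult A; simp)+
    then have G_compact: "compact G"
      unfolding G_def by (intro compact_Int_closed K closed_INT ballI closed_Int)
    have G_iff: "p \<in> G \<longleftrightarrow> fst p \<in> \<Omega> \<and> snd p = P (fst p) v" for p
    proof
      assume "p \<in> G"
      then have "fst p \<in> \<Omega>" "snd p \<in> Es (fst p)" "v - snd p \<in> Eu (fst p)"
        by (auto simp: G_def Es_eq Eu_eq)
      then show "fst p \<in> \<Omega> \<and> snd p = P (fst p) v" using P_eq by metis
    next
      assume p: "fst p \<in> \<Omega> \<and> snd p = P (fst p) v"
      have "norm (P (fst p) v) \<le> M * norm v"
        using M(2)[OF _ P_mem[of "fst p" v]] p by simp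
      then show "p \<in> G"
        using p P_mem[of "fst p" v] Es_eq Eu_eq by (auto simp: G_def mem_Times_iff)
    qed
    \<comment> \<open>The first projection is a continuous bijection from the compact graph onto \<open>\<Omega>\<close>.\<close>
    have "continuous_on (fst ` G) (\<lambda>\<omega>. (\<omega>, P \<omega> v))"
    proof (rule continuous_on_inv)
      show "continuous_on G fst" by (intro continuous_intros)
      show "\<forall>p\<in>G. (fst p, P (fst p) v) = p" using G_iff by (simp add: prod_eq_iff)
    qed (rule G_compact)
    moreover have "fst ` G = \<Omega>"
    proof -
      have "\<omega> \<in> fst ` G" if "\<omega> \<in> \<Omega>" for \<omega>
        using that G_iff[of "(\<omega>, P \<omega> v)"] by force
      then show ?thesis using G_iff by blast
    qed
    ultimately have "continuous_on \<Omega> (\<lambda>\<omega>. (\<omega>, P \<omega> v))" by simp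
    from continuous_on_snd[OF this] show ?thesis by simp
  qed
  define PM where "PM \<omega> = matrix (P \<omega>)" for \<omega>
  have PM: "PM \<omega> *v v = P \<omega> v" if "\<omega> \<in> \<Omega>" for \<omega> v
    unfolding PM_def by (rule matrix_works[OF P_linear[OF that]])
  have PM_cont: "continuous_on \<Omega> PM"
    unfolding PM_def matrix_def by (intro continuous_on_vec_lambda continuous_on_component P_cont)
  define Q where "Q \<omega>0 \<omega> = PM \<omega> ** PM \<omega>0 + (mat 1 - PM \<omega>) ** (mat 1 - PM \<omega>0)" for \<omega>0 \<omega>
  have Q: "Q \<omega>0 \<omega> *v v = P \<omega> (P \<omega>0 v) + ((v - P \<omega>0 v) - P \<omega> (v - P \<omega>0 v))" if "\<omega>0 \<in> \<Omega>" "\<omega> \<in> \<Omega>" for \<omega>0 \<omega> v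
    using that unfolding Q_def
    by (simp add: matrix_vector_mult_add_rdistrib matrix_vector_mult_diff_rdistrib PM
        flip: matrix_vector_mul_assoc)
  have Q_cont: "continuous_on \<Omega> (Q \<omega>0)" for \<omega>0
    unfolding Q_def by (intro continuous_intros continuous_on_matrix_mult PM_cont)
  have P_s: "P \<omega> a = a" if "\<omega> \<in> \<Omega>" "a \<in> Es \<omega>" for \<omega> a
    using P_eq[OF that] vec.subspace_0[OF sub_u[OF that(1)]] by simp
  have P_u: "P \<omega> b = 0" if "\<omega> \<in> \<Omega>" "b \<in> Eu \<omega>" for \<omega> b
    using P_eq[OF that(1) vec.subspace_0[OF sub_s[OF that(1)]]] that(2) by simp
  have Q_s: "Q \<omega>0 \<omega> *v a \<in> Es \<omega>" if "\<omega>0 \<in> \<Omega>" "\<omega> \<in> \<Omega>" "a \<in> Es \<omega>0" for \<omega>0 \<omega> a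
    using that P_u[OF that(2) vec.subspace_0[OF sub_u[OF that(2)]]] P_mem(1)[OF that(2)] by (simp add: Q P_s)
  have Q_u: "Q \<omega>0 \<omega> *v b \<in> Eu \<omega>" if "\<omega>0 \<in> \<Omega>" "\<omega> \<in> \<Omega>" "b \<in> Eu \<omega>0" for \<omega>0 \<omega> b
    using that P_u[OF that(2) vec.subspace_0[OF sub_u[OF that(2)]]] P_mem(2)[OF that(2)] by (simp add: Q P_u)
  define transports where "transports \<omega>0 \<omega> \<longleftrightarrow> inj ((*v) (Q \<omega>0 \<omega>)) \<and>
      (*v) (Q \<omega>0 \<omega>) ` Es \<omega>0 = Es \<omega> \<and> (*v) (Q \<omega>0 \<omega>) ` Eu \<omega>0 = Eu \<omega>" for \<omega>0 \<omega>
  have transport: "\<exists>U. open U \<and> \<omega>0 \<in> U \<and> (\<forall>\<omega>\<in>U \<inter> \<Omega>. transports \<omega>0 \<omega>)" if \<omega>0: "\<omega>0 \<in> \<Omega>" for \<omega>0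
  proof -
    have "Q \<omega>0 \<omega>0 *v v = mat 1 *v v" for v
      using P_s[OF \<omega>0 P_mem(1)[OF \<omega>0]] P_u[OF \<omega>0 P_mem(2)[OF \<omega>0]] by (simp add: Q \<omega>0)
    then have "Q \<omega>0 \<omega>0 = mat 1" by (simp add: matrix_eq)
    then have det0: "det (Q \<omega>0 \<omega>0) \<noteq> 0" by simp
    have "openin (top_of_set \<Omega>) (\<Omega> \<inter> (\<lambda>\<omega>. det (Q \<omega>0 \<omega>)) -` (- {0}))"
      by (intro continuous_openin_preimage_gen continuous_on_det Q_cont) auto
    then obtain U where U: "open U" "\<Omega> \<inter> (\<lambda>\<omega>. det (Q \<omega>0 \<omega>)) -` (- {0}) = \<Omega> \<inter> U"
      by (auto simp: openin_open)
    have "transports \<omega>0 \<omega>"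
      if \<omega>: "\<omega> \<in> U \<inter> \<Omega>" for \<omega>
    proof -
      have "\<omega> \<in> \<Omega>" using \<omega> by simp
      have "det (Q \<omega>0 \<omega>) \<noteq> 0" using \<omega> U(2) by blast
      then have inv: "invertible (Q \<omega>0 \<omega>)" by (simp add: invertible_det_nz)
      then have inj: "inj ((*v) (Q \<omega>0 \<omega>))" by (rule inj_matrix_vector_mult)
      have decomp: "\<exists>a\<in>Es \<omega>0. \<exists>b\<in>Eu \<omega>0. x = Q \<omega>0 \<omega> *v a + Q \<omega>0 \<omega> *v b" for x
      proof -
        have "x = Q \<omega>0 \<omega> *v (matrix_inv (Q \<omega>0 \<omega>) *v x)"
          by (simp add: matrix_vector_mul_assoc matrix_inv_right[OF inv])
        then show ?thesis
          using split[OF \<omega>0, of "matrix_inv (Q \<omega>0 \<omega>) *v x"] by (metis matrix_vector_right_distrib)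
      qed
      have "x \<in> (*v) (Q \<omega>0 \<omega>) ` Es \<omega>0" if "x \<in> Es \<omega>" for x
      proof -
        obtain a b where a: "a \<in> Es \<omega>0" and b: "b \<in> Eu \<omega>0" and x: "x = Q \<omega>0 \<omega> *v a + Q \<omega>0 \<omega> *v b"
          using decomp by blast
        have "Q \<omega>0 \<omega> *v b \<in> Es \<omega>"
          using vec.subspace_diff[OF sub_s[OF \<open>\<omega> \<in> \<Omega>\<close>] that Q_s[OF \<omega>0 \<open>\<omega> \<in> \<Omega>\<close> a]] x by simp
        then have "Q \<omega>0 \<omega> *v b = 0"
          using disjoint[OF \<open>\<omega> \<in> \<Omega>\<close>] Q_u[OF \<omega>0 \<open>\<omega> \<in> \<Omega>\<close> b] by blast
        then show ?thesis using a x by auto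
      qed
      moreover have "x \<in> (*v) (Q \<omega>0 \<omega>) ` Eu \<omega>0" if "x \<in> Eu \<omega>" for x
      proof -
        obtain a b where a: "a \<in> Es \<omega>0" and b: "b \<in> Eu \<omega>0" and x: "x = Q \<omega>0 \<omega> *v a + Q \<omega>0 \<omega> *v b"
          using decomp by blast
        have "Q \<omega>0 \<omega> *v a \<in> Eu \<omega>"
          using vec.subspace_diff[OF sub_u[OF \<open>\<omega> \<in> \<Omega>\<close>] that Q_u[OF \<omega>0 \<open>\<omega> \<in> \<Omega>\<close> b]] x by simp
        then have "Q \<omega>0 \<omega> *v a = 0"
          using disjoint[OF \<open>\<omega> \<in> \<Omega>\<close>] Q_s[OF \<omega>0 \<open>\<omega> \<in> \<Omega>\<close> a] by blast
        then show ?thesis using b x by auto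
      qed
      ultimately show ?thesis
        unfolding transports_def using inj Q_s[OF \<omega>0 \<open>\<omega> \<in> \<Omega>\<close>] Q_u[OF \<omega>0 \<open>\<omega> \<in> \<Omega>\<close>] by blast
    qed
    moreover have "\<omega>0 \<in> U" using U(2) det0 \<omega>0 by blast
    ultimately show ?thesis using U(1) by blast
  qed
  have bundle_s: "continuous_subbundle \<Omega> Es"
  proof (rule continuous_subbundle_transport[OF sub_s])
    fix \<omega>0 assume \<omega>0: "\<omega>0 \<in> \<Omega>"
    obtain U where U: "open U" "\<omega>0 \<in> U" and transports_U: "\<forall>\<omega>\<in>U \<inter> \<Omega>. transports \<omega>0 \<omega>"
      using transport[OF \<omega>0] by blast
    show "\<exists>U Q. open U \<and> \<omega>0 \<in> U \<and> continuous_on \<Omega> Q \<and>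
        (\<forall>\<omega>\<in>U \<inter> \<Omega>. inj ((*v) (Q \<omega>)) \<and> (*v) (Q \<omega>) ` Es \<omega>0 = Es \<omega>)"
      by (intro exI[of _ U] exI[of _ "Q \<omega>0"] conjI ballI Q_cont U) (use transports_U in \<open>auto simp: transports_def\<close>)
  qed
  have bundle_u: "continuous_subbundle \<Omega> Eu"
  proof (rule continuous_subbundle_transport[OF sub_u])
    fix \<omega>0 assume \<omega>0: "\<omega>0 \<in> \<Omega>"
    obtain U where U: "open U" "\<omega>0 \<in> U" and transports_U: "\<forall>\<omega>\<in>U \<inter> \<Omega>. transports \<omega>0 \<omega>"
      using transport[OF \<omega>0] by blast
    show "\<exists>U Q. open U \<and> \<omega>0 \<in> U \<and> continuous_on \<Omega> Q \<and>
        (\<forall>\<omega>\<in>U \<inter> \<Omega>. inj ((*v) (Q \<omega>)) \<and> (*v) (Q \<omega>) ` Eu \<omega>0 = Eu \<omega>)"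
      by (intro exI[of _ U] exI[of _ "Q \<omega>0"] conjI ballI Q_cont U) (use transports_U in \<open>auto simp: transports_def\<close>)
  qed
  have int0: "Es \<omega> \<inter> Eu \<omega> = {0}" if "\<omega> \<in> \<Omega>" for \<omega>
    using disjoint[OF that] vec.subspace_0[OF sub_s[OF that]] vec.subspace_0[OF sub_u[OF that]] by blast
  have span: "{x + y | x y. x \<in> Es \<omega> \<and> y \<in> Eu \<omega>} = UNIV" if "\<omega> \<in> \<Omega>" for \<omega>
    using split[OF that] by blast
  have W: "Whitney_splitting \<Omega> Es Eu"
    unfolding Whitney_splitting_def using bundle_s bundle_u int0 span by simp
  have A1: "Aiter 1 \<omega> *v v = A \<omega> *v v" if "\<omega> \<in> \<Omega>" for \<omega> v
    using Aiter_Suc[OF that, of 0] by simp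
  have step: "iter 1 (iter j \<omega>) = iter (j + 1) \<omega>" if "\<omega> \<in> \<Omega>" for j \<omega>
    using iter_add[OF that, of 1 j] by (simp add: add.commute)
  have inv: "A (iter j \<omega>) *v v \<in> Eu (iter (j + 1) \<omega>)" if "\<omega> \<in> \<Omega>" "v \<in> Eu (iter j \<omega>)" for \<omega> j v
    using invariant_u[OF iter_in[OF that(1)] that(2), of 1] by (simp only: A1 step that iter_in)
  have inv': "A (iter j \<omega>) *v v \<in> Es (iter (j + 1) \<omega>)" if "\<omega> \<in> \<Omega>" "v \<in> Es (iter j \<omega>)" for \<omega> j v
    using invariant_s[OF iter_in[OF that(1)] that(2), of 1] by (simp only: A1 step that iter_in)
  have rate: "y \<le> 1 / \<beta> * r powi (- int n) * x" if "\<beta> * r ^ n * y \<le> x" for x y n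
    using that \<beta> r by (simp add: power_int_minus field_simps)
  have "\<forall>\<omega>\<in>\<Omega>. \<forall>v\<in>Eu \<omega>. \<forall>w\<in>Es \<omega>. \<forall>n\<ge>1.
      norm (Aiter (- int n) \<omega> *v v) \<le> 1 / \<beta> * r powi (- int n) * norm v \<and>
      norm (Aiter (int n) \<omega> *v w) \<le> 1 / \<beta> * r powi (- int n) * norm w"
    using rate[OF contract_u] rate[OF contract_s] by blast
  moreover have "1 / \<beta> > 0" using \<beta> by simp
  ultimately have "\<exists>C>0. \<exists>r::real>1. \<forall>\<omega>\<in>\<Omega>. \<forall>v\<in>Eu \<omega>. \<forall>w\<in>Es \<omega>. \<forall>n\<ge>1.
      norm (Aiter (- int n) \<omega> *v v) \<le> C * r powi (- int n) * norm v \<and>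
      norm (Aiter (int n) \<omega> *v w) \<le> C * r powi (- int n) * norm w"
    using r by blast
  then show ?thesis
    unfolding UH_def using SL W inv inv' by blast
qed

end

context compact_SL_cocycle
begin

text \<open>A vector with bounded orbit in one direction can only grow in the other one. Applied to its image after \<open>n\<close> steps,
  which is again such a vector, this growth says that the orbit has contracted.\<close>

lemma UG_splitting_imp_UH:
  assumes UG: "(T, A) \<in> UG \<Omega>"
    and split: "\<And>\<omega> v. \<omega> \<in> \<Omega> \<Longrightarrow> \<exists>a\<in>bounded_orbits 1 \<omega>. \<exists>b\<in>bounded_orbits (- 1) \<omega>. v = a + b"
  shows "(T, A) \<in> UH \<Omega>"
proof -
  obtain \<beta> r :: real where \<beta>: "\<beta> > 0" and r: "r > 1" and growth: "\<And>\<omega> v. \<omega> \<in> \<Omega> \<Longrightarrow> v \<noteq> 0 \<Longrightarrow>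
      (\<forall>n\<ge>1. norm (Aiter (int n) \<omega> *v v) \<ge> \<beta> * r ^ n * norm v) \<or>
      (\<forall>n\<ge>1. norm (Aiter (- int n) \<omega> *v v) \<ge> \<beta> * r ^ n * norm v)"
    using UG unfolding UG_def by auto
  have no_growth: "\<not> (\<forall>n\<ge>1. norm (Aiter (\<sigma> * int n) \<omega> *v v) \<ge> \<beta> * r ^ n * norm v)"
    if v: "v \<in> bounded_orbits \<sigma> \<omega>" and "v \<noteq> 0" for \<sigma> \<omega> v
  proof
    assume grow: "\<forall>n\<ge>1. norm (Aiter (\<sigma> * int n) \<omega> *v v) \<ge> \<beta> * r ^ n * norm v"
    obtain K where K: "\<And>n. norm (Aiter (\<sigma> * int n) \<omega> *v v) \<le> K"
      using v unfolding bounded_orbits_def by blast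
    obtain n where n: "K / (\<beta> * norm v) < r ^ n"
      using real_arch_pow[OF r] by blast
    also have "r ^ n \<le> r ^ Suc n" using r by (intro power_increasing) auto
    finally have "K < \<beta> * r ^ Suc n * norm v"
      using \<beta> that(2) by (simp add: field_simps)
    then show False using grow[rule_format, of "Suc n"] K[of "Suc n"] by simp
  qed
  have contract: "\<beta> * r ^ n * norm (Aiter (\<sigma> * int n) \<omega> *v v) \<le> norm v"
    if \<omega>: "\<omega> \<in> \<Omega>" and v: "v \<in> bounded_orbits \<sigma> \<omega>" and n: "n \<ge> 1" and \<sigma>: "\<sigma> = 1 \<or> \<sigma> = - 1" for \<omega> v n \<sigma>
  proof -
    let ?y = "Aiter (\<sigma> * int n) \<omega> *v v" and ?\<theta> = "iter (\<sigma> * int n) \<omega>"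
    have y: "?y \<in> bounded_orbits \<sigma> ?\<theta>" by (rule bounded_orbits_invariant[OF \<omega> v])
    have returns: "Aiter (- (\<sigma> * int n)) ?\<theta> *v ?y = v"
      by (rule Aiter_uminus(1)[OF \<omega>])
    show ?thesis
    proof (cases "?y = 0")
      case False
      then show ?thesis
        using growth[OF iter_in[OF \<omega>] False, of "\<sigma> * int n"] no_growth[OF y False] returns \<sigma> n by auto
    qed simp
  qed
  have bounded: "v \<in> bounded_orbits \<sigma> \<omega>"
    if v: "\<forall>n\<ge>1. \<beta> * r ^ n * norm (Aiter (\<sigma> * int n) \<omega> *v v) \<le> norm v" for \<sigma> \<omega> v
  proof -
    have "norm (Aiter (\<sigma> * int n) \<omega> *v v) \<le> norm v / \<beta> + norm v" for n
    proof (cases "n = 0")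
      case False
      have "1 \<le> r ^ n" using r by simp
      then have "\<beta> * norm (Aiter (\<sigma> * int n) \<omega> *v v) \<le> \<beta> * norm (Aiter (\<sigma> * int n) \<omega> *v v) * r ^ n"
        using mult_left_mono[of 1 "r ^ n" "\<beta> * norm (Aiter (\<sigma> * int n) \<omega> *v v)"] \<beta> by simp
      also have "\<dots> \<le> norm v"
        using v False by (simp add: mult_ac)
      finally have "norm (Aiter (\<sigma> * int n) \<omega> *v v) \<le> norm v / \<beta>"
        using \<beta> by (simp add: field_simps)
      then show ?thesis by (simp add: add_increasing2)
    qed (use \<beta> in simp)
    then show ?thesis unfolding bounded_orbits_def by blast
  qed
  interpret dichotomy \<Omega> T A "bounded_orbits 1" "bounded_orbits (- 1)" \<beta> r
  proof
    show "\<beta> * r ^ n * norm (Aiter (int n) \<omega> *v a) \<le> norm a"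
      if "\<omega> \<in> \<Omega>" "a \<in> bounded_orbits 1 \<omega>" "n \<ge> 1" for \<omega> a n
      using contract[OF that] by simp
    show "\<beta> * r ^ n * norm (Aiter (- int n) \<omega> *v b) \<le> norm b"
      if "\<omega> \<in> \<Omega>" "b \<in> bounded_orbits (- 1) \<omega>" "n \<ge> 1" for \<omega> b n
      using contract[OF that] by simp
  qed (use \<beta> r split bounded_orbits_invariant in blast)+
  show ?thesis
  proof (rule dichotomy_imp_UH)
    show "vec.subspace (bounded_orbits 1 \<omega>)" "vec.subspace (bounded_orbits (- 1) \<omega>)" for \<omega>
      by (rule bounded_orbits_subspace)+
    show "bounded_orbits 1 \<omega> = {a. \<forall>n\<ge>1. \<beta> * r ^ n * norm (Aiter (int n) \<omega> *v a) \<le> norm a}" if "\<omega> \<in> \<Omega>" for \<omega>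
      using contract[OF that, of _ 1] bounded[of 1 \<omega>] by auto
    show "bounded_orbits (- 1) \<omega> = {a. \<forall>n\<ge>1. \<beta> * r ^ n * norm (Aiter (- int n) \<omega> *v a) \<le> norm a}" if "\<omega> \<in> \<Omega>" for \<omega>
      using contract[OF that, of _ "- 1"] bounded[of "- 1" \<omega>] by auto
  qed
qed

end

section \<open>Green functions split the phase space\<close>

context jacobi_energy
begin

text \<open>Let \<open>u\<close> be the \<open>\<ell>\<^sup>2\<close> solution of \<open>(H - z) u = f\<close> with \<open>f\<close> concentrated at the site \<open>0\<close>. Its phase vectors solve the
  free recursion on either side of the jump and are bounded, so the jump is a difference of a forward
  bounded and a backward bounded vector. In this way all vectors with vanishing second component are
  reached. The cocycle moves first components into second components, and applying it once to these
  vectors gives the rest.\<close>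

lemma bounded_below_splitting:
  assumes below: "\<And>\<omega>. \<omega> \<in> \<Omega> \<Longrightarrow> bounded_below z \<omega>" and \<omega>: "\<omega> \<in> \<Omega>"
  shows "\<exists>a\<in>bounded_orbits 1 \<omega>. \<exists>b\<in>bounded_orbits (- 1) \<omega>. v = a + b"
proof -
  define S where "S \<omega> = {a + b | a b. a \<in> bounded_orbits 1 \<omega> \<and> b \<in> bounded_orbits (- 1) \<omega>}" for \<omega>
  have S_sub: "vec.subspace (S \<omega>)" for \<omega>
    unfolding S_def by (intro vec.subspace_sums bounded_orbits_subspace)
  have kick: "kick \<theta> y \<in> S \<theta>" if \<theta>: "\<theta> \<in> \<Omega>" for \<theta> y
  proof -
    define f where "f n = (if n = 0 then y else 0)" for n :: int
    have "((\<lambda>n. (norm (f n))\<^sup>2) has_sum (norm (f 0))\<^sup>2) {0}"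
      by (rule has_sum_finiteI) auto
    then have "((\<lambda>n. (norm (f n))\<^sup>2) has_sum (norm (f 0))\<^sup>2) UNIV"
      by (rule has_sum_cong_neutral[THEN iffD1, rotated -1]) (auto simp: f_def)
    then have "f \<in> ell2"
      by (auto simp: ell2_def has_sum_iff)
    then obtain u where u: "u \<in> ell2" "shifted_jacobi z \<theta> u = f"
      using bounded_below_surjective[OF \<theta> below[OF \<theta>]] by blast
    define w where "w = phase \<theta> u"
    have w_bound: "norm (w n) \<le> ell2_norm w" for n
      unfolding w_def by (rule norm_le_ell2_norm[OF phase_ell2(1)[OF \<theta> u(1)]])
    let ?\<theta>' = "iter (- 1) \<theta>"
    have \<theta>': "?\<theta>' \<in> \<Omega>" using \<theta> by simp
    have it: "iter n ?\<theta>' = iter (n - 1) \<theta>" for n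
      using iter_add[OF \<theta>, of n "-1"] by simp
    have w_Suc: "w (n + 1) = J (iter (n - 1) \<theta>) *v w n + (if n = 0 then kick \<theta> y else 0)" for n
      using phase_Suc[OF \<theta>, of u n] by (auto simp: w_def u(2) f_def kick_def)
    have right: "w (1 + int n) = Aiter (int n) \<theta> *v w 1" for n
    proof (induction n)
      case (Suc n)
      have "w (1 + int (Suc n)) = J (iter (int n) \<theta>) *v w (1 + int n)"
        using w_Suc[of "1 + int n"] by (simp add: algebra_simps)
      then show ?case
        using Suc Aiter_Suc[OF \<theta>, of "int n"] by (simp add: matrix_vector_mul_assoc add.commute)
    qed simp
    have left: "w (- int n) = Aiter (- int n) ?\<theta>' *v w 0" for n
    proof (induction n)
      case (Suc n)
      let ?m = "- int (Suc n)"
      have "J (iter ?m ?\<theta>') *v w ?m = w (- int n)"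
        using w_Suc[of ?m] by (simp add: it)
      also have "\<dots> = J (iter ?m ?\<theta>') *v (Aiter ?m ?\<theta>' *v w 0)"
        using Suc Aiter_Suc[OF \<theta>', of ?m] by (simp add: matrix_vector_mul_assoc)
      finally show ?case using A_inj[OF iter_in[OF \<theta>']] by blast
    qed simp
    have "norm (Aiter (1 * int n) \<theta> *v w 1) \<le> ell2_norm w" for n
      using w_bound[of "1 + int n"] right[of n] by simp
    then have "w 1 \<in> bounded_orbits 1 \<theta>"
      unfolding bounded_orbits_def by blast
    moreover have "norm (Aiter (- 1 * int n) ?\<theta>' *v w 0) \<le> ell2_norm w" for n
      using w_bound[of "- int n"] left[of n] by simp
    then have "w 0 \<in> bounded_orbits (- 1) ?\<theta>'"
      unfolding bounded_orbits_def by blast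
    then have "Aiter 1 ?\<theta>' *v w 0 \<in> bounded_orbits (- 1) \<theta>"
      using bounded_orbits_invariant[OF \<theta>', of "w 0" "- 1" 1] by (simp only: it) simp
    moreover have "kick \<theta> y = w 1 + (- 1) *s (Aiter 1 ?\<theta>' *v w 0)"
      using w_Suc[of 0] Aiter_Suc[OF \<theta>', of 0] by (simp add: vector_smult_lneg)
    ultimately show ?thesis
      unfolding S_def using vec.subspace_scale[OF bounded_orbits_subspace] by blast
  qed
  have upper: "vec_pair x 0 \<in> S \<theta>" if \<theta>: "\<theta> \<in> \<Omega>" for \<theta> x
    using kick[OF \<theta>, of "cmatrix (D \<theta>) *v x"] D_inverse_vec(2)[OF \<theta>] by (simp add: kick_def)
  have lower: "vec_pair 0 x \<in> S \<omega>" for x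
  proof -
    let ?\<theta> = "iter (- 1) \<omega>"
    have \<theta>: "?\<theta> \<in> \<Omega>" using \<omega> by simp
    have it: "iter 1 ?\<theta> = \<omega>"
      using iter_add[OF \<omega>, of 1 "-1"] by simp
    define y where "y = cmatrix (matrix_inv (D \<omega>)) *v x"
    obtain a b where a: "a \<in> bounded_orbits 1 ?\<theta>" and b: "b \<in> bounded_orbits (- 1) ?\<theta>"
      and ab: "vec_pair y 0 = a + b"
      using upper[OF \<theta>, of y] unfolding S_def by blast
    have "Aiter 1 ?\<theta> *v a \<in> bounded_orbits 1 \<omega>" "Aiter 1 ?\<theta> *v b \<in> bounded_orbits (- 1) \<omega>"
      using bounded_orbits_invariant[OF \<theta> a, of 1] bounded_orbits_invariant[OF \<theta> b, of 1] by (simp_all only: it)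
    then have "Aiter 1 ?\<theta> *v vec_pair y 0 \<in> S \<omega>"
      unfolding ab matrix_vector_right_distrib S_def by blast
    moreover obtain x' where "Aiter 1 ?\<theta> *v vec_pair y 0 = vec_pair x' (cmatrix (D \<omega>) *v y)"
      using J_vec_pair[OF \<omega>, of 0 y 0] Aiter_Suc[OF \<theta>, of 0] by simp
    moreover have "cmatrix (D \<omega>) *v y = x"
      using D_inverse_vec(1)[OF \<omega>] by (simp add: y_def)
    ultimately have "vec_pair x' x \<in> S \<omega>" by simp
    moreover have "vec_pair x' x - vec_pair x' 0 = vec_pair 0 x"
      using vec_pair_add[of 0 x x' 0] by (simp add: diff_eq_eq)
    ultimately show ?thesis
      using vec.subspace_diff[OF S_sub _ upper[OF \<omega>, of x'], of "vec_pair x' x"] by simp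
  qed
  obtain x y where "v = vec_pair x y" by (rule vec_pair_cases)
  then have "v = vec_pair x 0 + vec_pair 0 y" by (simp add: vec_pair_add)
  then have "v \<in> S \<omega>"
    using vec.subspace_add[OF S_sub upper[OF \<omega>] lower] by simp
  then show ?thesis unfolding S_def by blast
qed

end

section \<open>Resolvent set, uniform growth and uniform hyperbolicity coincide\<close>

theorem theorem1p7:
  fixes \<Omega> :: "'a::metric_space set"
    and T :: "'a \<Rightarrow> 'a"
    and D V :: "'a \<Rightarrow> real^'l^'l"
  assumes "\<Omega> \<noteq> {}" and "compact \<Omega>"
    and "minimal_homeomorphism \<Omega> T"
    and "continuous_on \<Omega> D" and "continuous_on \<Omega> V"
    and "\<And>\<omega>. \<omega> \<in> \<Omega> \<Longrightarrow> transpose (D \<omega>) = D \<omega>"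
    and "\<And>\<omega>. \<omega> \<in> \<Omega> \<Longrightarrow> transpose (V \<omega>) = V \<omega>"
    and "\<And>\<omega>. \<omega> \<in> \<Omega> \<Longrightarrow> invertible (D \<omega>)"
  shows "\<forall>\<omega>\<in>\<Omega>.
    resolvent_set (jacobi_operator \<Omega> T D V \<omega>) = {z. (T, jacobi_cocycle T D V z) \<in> UG \<Omega>} \<and>
    {z. (T, jacobi_cocycle T D V z) \<in> UG \<Omega>} = {z. (T, jacobi_cocycle T D V z) \<in> UH \<Omega>}"
proof -
  have homeo: "self_homeomorphism \<Omega> T"
    and minimal: "\<Omega> \<subseteq> closure (range (\<lambda>j. int_iterate \<Omega> T j \<omega>))" if "\<omega> \<in> \<Omega>" for \<omega>
    using assms(3) that unfolding minimal_homeomorphism_def by auto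
  have "jacobi \<Omega> T D V"
    using assms homeo by unfold_locales blast+
  then have energy: "jacobi_energy \<Omega> T D V"
    by (rule jacobi_energy.intro)
  have "z \<in> resolvent_set (jacobi_operator \<Omega> T D V \<omega>) \<longleftrightarrow> (T, jacobi_cocycle T D V z) \<in> UG \<Omega>"
    and "(T, jacobi_cocycle T D V z) \<in> UG \<Omega> \<longleftrightarrow> (T, jacobi_cocycle T D V z) \<in> UH \<Omega>"
    if \<omega>: "\<omega> \<in> \<Omega>" for z \<omega>
  proof -
    interpret jacobi_energy \<Omega> T D V z by (rule energy)
    show "z \<in> resolvent_set (jacobi_operator \<Omega> T D V \<omega>) \<longleftrightarrow> (T, J) \<in> UG \<Omega>"
      using resolvent_iff_bounded_below[OF \<omega>] UG_imp_bounded_below[OF _ \<omega>]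
        bounded_below_imp_UG[OF minimal[OF \<omega>] \<omega>] by blast
    show "(T, J) \<in> UG \<Omega> \<longleftrightarrow> (T, J) \<in> UH \<Omega>"
      using UH_imp_UG UG_splitting_imp_UH[OF _ bounded_below_splitting] UG_imp_bounded_below by blast
  qed
  then show ?thesis by blast
qed

end
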